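(* Let $k$ be an algebraically closed field of characteristic $0$, and let $A$ be the complete local ring of a simple (hypersurface) singularity over $k$ of dimension $d \ge 3$. Let $M$ be a maximal Cohen-Macaulay $A$-module. Then $M$ admits a connection if and only if $M$ is a free $A$-module.
   Context: The complete local ring of a simple singularity of dimension $d \ge 1$ over $k$ is $A \cong k[[z_0, \dots, z_d]]/(f)$, where $f$ is one of: - $A_n$ ($n \ge 1$): $f = z_0^2 + z_1^{n+1} + z_2^2 + \dots + z_d^2$; - $D_n$ ($n \ge 4$): $f = z_0^2 z_1 + z_1^{n-1} + z_2^2 + \dots + z_d^2$; - $E_6$: $f = z_0^3 + z_1^4 + z_2^2 + \dots + z_d^2$; - $E_7$: $f = z_0^3 + z_0 z_1^3 + z_2^2 + \dots + z_d^2$; - $E_8$: $f = z_0^3 + z_1^5 + z_2^2 + \dots + z_d^2$. A finitely generated $A$-module $M$ is maximal Cohen-Macaulay (MCM) if $\operatorname{depth}(M) = \dim(A)$. A connection on an $A$-module $M$ is an $A$-linear map $\nabla: \operatorname{Der}_k(A) \to \operatorname{End}_k(M)$, $D \mapsto \nabla_D$, such that $\nabla_D(am) = a \nabla_D(m) + D(a) m$ for all $D \in \operatorname{Der}_k(A)$, $a \in A$, $m \in M$. *)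

theory Defs
  imports "HOL-Algebra.Algebra" "HOL-Library.Extended_Nat"
begin

section \<open>Modules over a commutative ring\<close>

definition linear_maps ::
  "('a, 'r) ring_scheme \<Rightarrow> ('a, 'm, 's) module_scheme \<Rightarrow> ('a, 'n, 't) module_scheme \<Rightarrow> ('m \<Rightarrow> 'n) set"
  where "linear_maps R M N = {h \<in> carrier M \<rightarrow>\<^sub>E carrier N.
    (\<forall>x\<in>carrier M. \<forall>y\<in>carrier M. h (x \<oplus>\<^bsub>M\<^esub> y) = h x \<oplus>\<^bsub>N\<^esub> h y) \<and>
    (\<forall>a\<in>carrier R. \<forall>x\<in>carrier M. h (a \<odot>\<^bsub>M\<^esub> x) = a \<odot>\<^bsub>N\<^esub> h x)}"

definition module_span :: "('a, 'r) ring_scheme \<Rightarrow> ('a, 'm, 's) module_scheme \<Rightarrow> 'm set \<Rightarrow> 'm set"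
  where "module_span R M S = \<Inter>{N. submodule N R M \<and> S \<subseteq> N}"

definition finitely_generated :: "('a, 'r) ring_scheme \<Rightarrow> ('a, 'm, 's) module_scheme \<Rightarrow> bool"
  where "finitely_generated R M \<longleftrightarrow>
    (\<exists>S. finite S \<and> S \<subseteq> carrier M \<and> module_span R M S = carrier M)"

definition lin_independent :: "('a, 'r) ring_scheme \<Rightarrow> ('a, 'm, 's) module_scheme \<Rightarrow> 'm set \<Rightarrow> bool"
  where "lin_independent R M B \<longleftrightarrow>
    (\<forall>F c. finite F \<and> F \<subseteq> B \<and> c \<in> F \<rightarrow> carrier R \<and> (\<Oplus>\<^bsub>M\<^esub>b\<in>F. c b \<odot>\<^bsub>M\<^esub> b) = \<zero>\<^bsub>M\<^esub>
      \<longrightarrow> (\<forall>b\<in>F. c b = \<zero>\<^bsub>R\<^esub>))"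

definition free_module :: "('a, 'r) ring_scheme \<Rightarrow> ('a, 'm, 's) module_scheme \<Rightarrow> bool"
  where "free_module R M \<longleftrightarrow>
    (\<exists>B \<subseteq> carrier M. lin_independent R M B \<and> module_span R M B = carrier M)"


section \<open>Krull dimension and depth\<close>

definition krull_dim :: "('a, 'r) ring_scheme \<Rightarrow> enat"
  where "krull_dim R =
    Sup {enat n | n. \<exists>p. (\<forall>i\<le>n. primeideal (p i) R) \<and> (\<forall>i<n. p i \<subset> p (Suc i))}"

text \<open>Meaningful only for local rings.\<close>

definition max_ideal :: "('a, 'r) ring_scheme \<Rightarrow> 'a set"
  where "max_ideal R = (THE I. maximalideal I R)"

text \<open>\<open>set_smult R M S\<close> is \<open>I M\<close>, where \<open>I\<close> is the ideal generated by \<open>S\<close>.\<close>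

definition set_smult :: "('a, 'r) ring_scheme \<Rightarrow> ('a, 'm, 's) module_scheme \<Rightarrow> 'a set \<Rightarrow> 'm set"
  where "set_smult R M S = module_span R M {a \<odot>\<^bsub>M\<^esub> x | a x. a \<in> S \<and> x \<in> carrier M}"

text \<open>
  The first condition says that each \<open>x\<^sub>i\<close> is a nonzerodivisor on
  \<open>M / (x\<^sub>0, \<dots>, x\<^sub>i\<^sub>-\<^sub>1) M\<close>, written out with representatives.
\<close>

definition regular_sequence ::
  "('a, 'r) ring_scheme \<Rightarrow> ('a, 'm, 's) module_scheme \<Rightarrow> 'a list \<Rightarrow> bool"
  where "regular_sequence R M xs \<longleftrightarrow> set xs \<subseteq> carrier R \<and>
    (\<forall>i<length xs. \<forall>m\<in>carrier M.
      xs ! i \<odot>\<^bsub>M\<^esub> m \<in> set_smult R M (set (take i xs)) \<longrightarrow> m \<in> set_smult R M (set (take i xs))) \<and>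
    set_smult R M (set xs) \<noteq> carrier M"

text \<open>For \<open>R\<close> local and \<open>M\<close> finitely generated; the zero module has depth \<open>\<infinity>\<close>.\<close>

definition depth :: "('a, 'r) ring_scheme \<Rightarrow> ('a, 'm, 's) module_scheme \<Rightarrow> enat"
  where "depth R M =
    (if set_smult R M (max_ideal R) = carrier M then \<infinity>
     else Sup {enat (length xs) | xs. set xs \<subseteq> max_ideal R \<and> regular_sequence R M xs})"

definition maximal_cohen_macaulay :: "('a, 'r) ring_scheme \<Rightarrow> ('a, 'm, 's) module_scheme \<Rightarrow> bool"
  where "maximal_cohen_macaulay R M \<longleftrightarrow>
    module R M \<and> finitely_generated R M \<and> depth R M = krull_dim R"


section \<open>Formal power series in \<open>z\<^sub>0, \<dots>, z\<^sub>d\<close>\<close>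

definition monomials :: "nat \<Rightarrow> (nat \<Rightarrow> nat) set"
  where "monomials d = {m. \<forall>i>d. m i = 0}"

text \<open>A power series is the extensional family of its coefficients; the product is the Cauchy product.\<close>

definition power_series :: "('k, 'r) ring_scheme \<Rightarrow> nat \<Rightarrow> ('k, (nat \<Rightarrow> nat) \<Rightarrow> 'k) module"
  where "power_series K d =
    \<lparr>carrier = monomials d \<rightarrow>\<^sub>E carrier K,
     monoid.mult = (\<lambda>g h. \<lambda>m\<in>monomials d.
       \<Oplus>\<^bsub>K\<^esub>a\<in>{a. \<forall>i. a i \<le> m i}. g a \<otimes>\<^bsub>K\<^esub> h (\<lambda>i. m i - a i)),
     one = (\<lambda>m\<in>monomials d. if m = (\<lambda>_. 0) then \<one>\<^bsub>K\<^esub> else \<zero>\<^bsub>K\<^esub>),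
     ring.zero = (\<lambda>m\<in>monomials d. \<zero>\<^bsub>K\<^esub>),
     add = (\<lambda>g h. \<lambda>m\<in>monomials d. g m \<oplus>\<^bsub>K\<^esub> h m),
     smult = (\<lambda>c g. \<lambda>m\<in>monomials d. c \<otimes>\<^bsub>K\<^esub> g m)\<rparr>"

definition ps_var :: "('k, 'r) ring_scheme \<Rightarrow> nat \<Rightarrow> nat \<Rightarrow> (nat \<Rightarrow> nat) \<Rightarrow> 'k"
  where "ps_var K d i =
    (\<lambda>m\<in>monomials d. if m = (\<lambda>j. if j = i then 1 else 0) then \<one>\<^bsub>K\<^esub> else \<zero>\<^bsub>K\<^esub>)"


section \<open>Simple singularities\<close>

text \<open>The equations of types \<open>A\<^sub>n\<close>, \<open>D\<^sub>n\<close>, \<open>E\<^sub>6\<close>, \<open>E\<^sub>7\<close>, \<open>E\<^sub>8\<close>, in this order.\<close>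

definition simple_equations :: "('k, 'r) ring_scheme \<Rightarrow> nat \<Rightarrow> ((nat \<Rightarrow> nat) \<Rightarrow> 'k) set"
  where "simple_equations K d =
    (let P = power_series K d;
         x = ps_var K d 0;
         y = ps_var K d 1;
         q = (\<Oplus>\<^bsub>P\<^esub>i\<in>{2..d}. ps_var K d i [^]\<^bsub>P\<^esub> (2::nat))
     in {x [^]\<^bsub>P\<^esub> (2::nat) \<oplus>\<^bsub>P\<^esub> y [^]\<^bsub>P\<^esub> (n + 1) \<oplus>\<^bsub>P\<^esub> q | n::nat. n \<ge> 1} \<union>
        {x [^]\<^bsub>P\<^esub> (2::nat) \<otimes>\<^bsub>P\<^esub> y \<oplus>\<^bsub>P\<^esub> y [^]\<^bsub>P\<^esub> (n - 1) \<oplus>\<^bsub>P\<^esub> q | n::nat. n \<ge> 4} \<union>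
        {x [^]\<^bsub>P\<^esub> (3::nat) \<oplus>\<^bsub>P\<^esub> y [^]\<^bsub>P\<^esub> (4::nat) \<oplus>\<^bsub>P\<^esub> q,
         x [^]\<^bsub>P\<^esub> (3::nat) \<oplus>\<^bsub>P\<^esub> x \<otimes>\<^bsub>P\<^esub> y [^]\<^bsub>P\<^esub> (3::nat) \<oplus>\<^bsub>P\<^esub> q,
         x [^]\<^bsub>P\<^esub> (3::nat) \<oplus>\<^bsub>P\<^esub> y [^]\<^bsub>P\<^esub> (5::nat) \<oplus>\<^bsub>P\<^esub> q})"

text \<open>The quotient ring of an algebra by an ideal, with the induced scalar multiplication.\<close>

definition quotient_algebra :: "('k, 'a, 's) module_scheme \<Rightarrow> 'a set \<Rightarrow> ('k, 'a set) module"
  where "quotient_algebra P I =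
    ring.extend (P Quot I) \<lparr>smult = (\<lambda>c Y. \<Union>x\<in>Y. I +>\<^bsub>P\<^esub> (c \<odot>\<^bsub>P\<^esub> x))\<rparr>"

definition algebra_iso ::
  "('k, 'r) ring_scheme \<Rightarrow> ('k, 'a, 's) module_scheme \<Rightarrow> ('k, 'b, 't) module_scheme \<Rightarrow> ('a \<Rightarrow> 'b) set"
  where "algebra_iso K A B = {\<phi> \<in> ring_iso A B.
    \<forall>c\<in>carrier K. \<forall>a\<in>carrier A. \<phi> (c \<odot>\<^bsub>A\<^esub> a) = c \<odot>\<^bsub>B\<^esub> \<phi> a}"

definition simple_singularity ::
  "('k, 'r) ring_scheme \<Rightarrow> nat \<Rightarrow> ('k, 'a, 's) module_scheme \<Rightarrow> bool"
  where "simple_singularity K d A \<longleftrightarrow> algebra K A \<and>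
    (\<exists>f\<in>simple_equations K d.
      algebra_iso K A (quotient_algebra (power_series K d) (PIdl\<^bsub>power_series K d\<^esub> f)) \<noteq> {})"


section \<open>Connections\<close>

text \<open>
  In the modules of derivations and of endomorphisms, only the additive structure and the scalar
  multiplication matter; the ring multiplication fields of the records are left undefined.
  Maps are extensional, so that equality of maps is equality on the carrier.
\<close>

definition derivations :: "('k, 'r) ring_scheme \<Rightarrow> ('k, 'a, 's) module_scheme \<Rightarrow> ('a, 'a \<Rightarrow> 'a) module"
  where "derivations K A =
    \<lparr>carrier = {D \<in> linear_maps K A A. \<forall>a\<in>carrier A. \<forall>b\<in>carrier A.
       D (a \<otimes>\<^bsub>A\<^esub> b) = a \<otimes>\<^bsub>A\<^esub> D b \<oplus>\<^bsub>A\<^esub> b \<otimes>\<^bsub>A\<^esub> D a},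
     monoid.mult = undefined,
     one = undefined,
     ring.zero = (\<lambda>a\<in>carrier A. \<zero>\<^bsub>A\<^esub>),
     add = (\<lambda>D E. \<lambda>a\<in>carrier A. D a \<oplus>\<^bsub>A\<^esub> E a),
     smult = (\<lambda>b D. \<lambda>a\<in>carrier A. b \<otimes>\<^bsub>A\<^esub> D a)\<rparr>"

text \<open>An \<open>A\<close>-module viewed as a module over the base ring of the algebra \<open>A\<close>.\<close>

definition restrict_scalars ::
  "('k, 'a, 's) module_scheme \<Rightarrow> ('a, 'm, 't) module_scheme \<Rightarrow> ('k, 'm) module"
  where "restrict_scalars A M =
    \<lparr>carrier = carrier M, monoid.mult = monoid.mult M, one = one M,
     ring.zero = ring.zero M, add = add M,
     smult = (\<lambda>c m. (c \<odot>\<^bsub>A\<^esub> \<one>\<^bsub>A\<^esub>) \<odot>\<^bsub>M\<^esub> m)\<rparr>"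

definition endomorphisms ::
  "('k, 'r) ring_scheme \<Rightarrow> ('k, 'a, 's) module_scheme \<Rightarrow> ('a, 'm, 't) module_scheme
    \<Rightarrow> ('a, 'm \<Rightarrow> 'm) module"
  where "endomorphisms K A M =
    \<lparr>carrier = linear_maps K (restrict_scalars A M) (restrict_scalars A M),
     monoid.mult = undefined,
     one = undefined,
     ring.zero = (\<lambda>m\<in>carrier M. \<zero>\<^bsub>M\<^esub>),
     add = (\<lambda>g h. \<lambda>m\<in>carrier M. g m \<oplus>\<^bsub>M\<^esub> h m),
     smult = (\<lambda>a g. \<lambda>m\<in>carrier M. a \<odot>\<^bsub>M\<^esub> g m)\<rparr>"

definition module_connection ::
  "('k, 'r) ring_scheme \<Rightarrow> ('k, 'a, 's) module_scheme \<Rightarrow> ('a, 'm, 't) module_scheme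
    \<Rightarrow> (('a \<Rightarrow> 'a) \<Rightarrow> 'm \<Rightarrow> 'm) \<Rightarrow> bool"
  where "module_connection K A M nabla \<longleftrightarrow>
    nabla \<in> linear_maps A (derivations K A) (endomorphisms K A M) \<and>
    (\<forall>D\<in>carrier (derivations K A). \<forall>a\<in>carrier A. \<forall>m\<in>carrier M.
      nabla D (a \<odot>\<^bsub>M\<^esub> m) = a \<odot>\<^bsub>M\<^esub> nabla D m \<oplus>\<^bsub>M\<^esub> D a \<odot>\<^bsub>M\<^esub> m)"

end

theory Submission
  imports Defs
begin

text \<open>
  Write the equation as \<open>f = g(z\<^sub>0, \<dots>, z\<^sub>d\<^sub>-\<^sub>2) + w\<^sup>2 + t\<^sup>2\<close> and let \<open>M\<close> be an MCM module with a connection,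
  with a minimal set of generators. Let \<open>I\<close> be the ideal of power series generated by the coefficients
  of all relations between the generators; \<open>f \<in> I\<close>, minimality gives \<open>I \<subseteq> m\<close>, and \<open>M\<close> is free iff
  \<open>I = (f)\<close>.

  A derivation that kills \<open>f\<close> acts on \<open>M\<close>, hence maps \<open>I\<close> into itself. For an arbitrary derivation
  \<open>D\<close> of the power series ring, depth at least three gives \<open>D(I) \<subseteq> I + (D f)\<close>: if \<open>a, b, c\<close> is
  an \<open>M\<close>-regular sequence in the Jacobian ideal of \<open>f\<close> (the singularity is isolated, so powers of any
  regular sequence will do), the obstruction to extending the connection to \<open>D\<close> on \<open>M / D(f) M\<close> is a
  Koszul cocycle on \<open>a, b, c\<close>, and these are coboundaries.

  Let \<open>e\<^sup>2 = -1\<close>, so that \<open>f = g + u v\<close> with \<open>u = w + e t\<close> and \<open>v = w - e t\<close>. For \<open>D = \<partial>\<^sub>w + e \<partial>\<^sub>t\<close> we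
  have \<open>D f = 2 u\<close> and \<open>D u = 0\<close>, so \<open>I + (u)\<close> is a \<open>D\<close>-stable ideal in \<open>m\<close>, which forces
  \<open>I \<subseteq> (z\<^sub>0, \<dots>, z\<^sub>d\<^sub>-\<^sub>2, u)\<close>; likewise with \<open>v\<close>. Since \<open>I\<close> is stable under the Hamiltonian derivations, which
  act on leading forms in \<open>z\<^sub>0, \<dots>, z\<^sub>d\<^sub>-\<^sub>2\<close> as \<open>v \<partial>\<^sub>j\<close> and \<open>u \<partial>\<^sub>j\<close>, the remainder of any element of
  \<open>I\<close> after division by \<open>f\<close> vanishes to every order.
\<close>

section \<open>Derivations of commutative rings\<close>

text \<open>The connection directly controls only derivations that kill \<open>f\<close>. The Koszul
  ones have coefficients in the Jacobian ideal, which for the equations at hand lies in the maximal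
  ideal, so they preserve the maximal ideal, and stability under them cannot separate
  \<open>I\<close> from it. Derivations with \<open>D f\<close> nonzero have to be brought in, and
  \<open>I\<close> is kept in the power series ring because such derivations need not act on the
  quotient. The price is a regular sequence of length three, obtained from depth = dimension and a
  chain of four primes in the quotient. Apart from the maximal ideal itself, primes enter only as
  stable cores, so none has to be described by generators. Two isotropic directions are used because
  the remainder after division by \<open>f\<close> has two coefficients as a polynomial in
  \<open>t\<close>; its restrictions to the two axes detect both. Characteristic zero enters through
  positive integer factors: binomial coefficients when a power of a derivation meets a product,
  rising factorials when coefficients are read off derivatives. The converse direction
  differentiates coordinates in a basis.\<close>

locale ring_derivation = cring R for R (structure) +
  fixes D
  assumes D_closed [simp, intro]: "a \<in> carrier R \<Longrightarrow> D a \<in> carrier R"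
    and D_add: "\<lbrakk>a \<in> carrier R; b \<in> carrier R\<rbrakk> \<Longrightarrow> D (a \<oplus> b) = D a \<oplus> D b"
    and D_mult: "\<lbrakk>a \<in> carrier R; b \<in> carrier R\<rbrakk> \<Longrightarrow> D (a \<otimes> b) = a \<otimes> D b \<oplus> b \<otimes> D a"
begin

lemma D_zero [simp]: "D \<zero> = \<zero>"
proof -
  have "D \<zero> \<oplus> D \<zero> = D \<zero>" using D_add[of \<zero> \<zero>] by simp
  then show ?thesis by (metis D_closed add.r_cancel_one' zero_closed)
qed

lemma D_one [simp]: "D \<one> = \<zero>"
proof -
  have "D \<one> \<oplus> D \<one> = D \<one>" using D_mult[of \<one> \<one>] by simp
  then show ?thesis by (metis D_closed add.r_cancel_one' one_closed)
qed

lemma D_neg: "a \<in> carrier R \<Longrightarrow> D (\<ominus> a) = \<ominus> D a"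
  using D_add[of a "\<ominus> a"] by (metis D_closed D_zero a_inv_closed minus_equality r_neg a_comm)

lemma D_minus: "\<lbrakk>a \<in> carrier R; b \<in> carrier R\<rbrakk> \<Longrightarrow> D (a \<ominus> b) = D a \<ominus> D b"
  by (simp add: D_add D_neg minus_eq)

lemma D_finsum: "g \<in> B \<rightarrow> carrier R \<Longrightarrow> D (finsum R g B) = finsum R (\<lambda>x. D (g x)) B"
proof (induction B rule: infinite_finite_induct)
  case (insert x F)
  then have "(\<lambda>x. D (g x)) \<in> F \<rightarrow> carrier R" by auto
  then show ?case using insert by (simp add: D_add Pi_def)
qed auto

lemma D_funpow_closed [simp]: "a \<in> carrier R \<Longrightarrow> (D ^^ k) a \<in> carrier R"
  by (induction k) auto

lemma D_funpow_D: "(D ^^ k) (D a) = (D ^^ Suc k) a"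
  by (simp add: funpow_swap1)

lemma D_funpow_zero [simp]: "(D ^^ k) \<zero> = \<zero>"
  by (induction k) auto

lemma D_funpow_add:
  "\<lbrakk>a \<in> carrier R; b \<in> carrier R\<rbrakk> \<Longrightarrow> (D ^^ k) (a \<oplus> b) = (D ^^ k) a \<oplus> (D ^^ k) b"
  by (induction k) (auto simp: D_add)

lemma ring_derivation: "ring_derivation R D" ..

end

text \<open>For an ideal \<open>Q\<close> this is the largest \<open>D\<close>-stable ideal inside
  \<open>Q\<close>. Over characteristic zero it inherits primality from \<open>Q\<close>, which
  makes it a source of primes that need no explicit generators.\<close>

definition stable_core :: "('a \<Rightarrow> 'a) \<Rightarrow> ('a, 's) ring_scheme \<Rightarrow> 'a set \<Rightarrow> 'a set"
  where "stable_core D R Q = {a \<in> carrier R. \<forall>k. (D ^^ k) a \<in> Q}"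

context ring_derivation
begin

lemma stable_core_subset: "stable_core D R Q \<subseteq> Q"
  unfolding stable_core_def by (auto dest: spec[of _ 0])

lemma stable_core_stable: "a \<in> stable_core D R Q \<Longrightarrow> D a \<in> stable_core D R Q"
  unfolding stable_core_def by (auto simp del: funpow.simps simp: funpow_Suc_right[symmetric] funpow_swap1
      dest: spec[of _ "Suc _"]) (metis comp_apply funpow_Suc_right)

lemma stable_core_greatest:
  assumes "J \<subseteq> Q" "J \<subseteq> carrier R" "\<And>a. a \<in> J \<Longrightarrow> D a \<in> J"
  shows "J \<subseteq> stable_core D R Q"
proof
  fix a assume "a \<in> J"
  then have "(D ^^ k) a \<in> J" for k by (induction k) (auto simp: assms(3))
  then show "a \<in> stable_core D R Q" using assms \<open>a \<in> J\<close> unfolding stable_core_def by blast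
qed

lemma stable_coreI_kernel:
  assumes "a \<in> Q" "a \<in> carrier R" "D a = \<zero>" "ideal Q R"
  shows "a \<in> stable_core D R Q"
proof -
  interpret Q: ideal Q R by fact
  have "(D ^^ k) a \<in> Q" for k
    by (cases k) (auto simp: assms funpow_Suc_right simp del: funpow.simps)
  then show ?thesis using assms unfolding stable_core_def by blast
qed

context
  fixes Q
  assumes Q: "ideal Q R"
begin

interpretation Q: ideal Q R by (fact Q)

text \<open>In the Leibniz expansion of an \<open>n\<close>-th derivative with
  \<open>n < p + q\<close>, every term has fewer than \<open>p\<close> derivatives on
  \<open>a\<close> or fewer than \<open>q\<close> on \<open>b\<close>. Peeling off one derivative at
  a time avoids the binomial formula.\<close>

lemma funpow_mult_low:
  assumes "a \<in> carrier R" "b \<in> carrier R"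
    "\<And>i. i < p \<Longrightarrow> (D ^^ i) a \<in> Q" "\<And>i. i < q \<Longrightarrow> (D ^^ i) b \<in> Q" "n < p + q"
  shows "(D ^^ n) (a \<otimes> b) \<in> Q"
  using assms
proof (induction n arbitrary: a b p q)
  case 0
  then have "a \<in> Q \<or> b \<in> Q" by (metis funpow_0 gr0I less_numeral_extra(3) add_is_0)
  then show ?case using 0 Q.I_l_closed Q.I_r_closed by auto
next
  case (Suc n)
  have "(D ^^ n) (a \<otimes> D b) \<in> Q"
    by (rule Suc.IH[of _ _ p "q - 1"])
      (use Suc.prems in \<open>auto simp: D_funpow_D simp del: funpow.simps\<close>)
  moreover have "(D ^^ n) (b \<otimes> D a) \<in> Q"
    by (rule Suc.IH[of _ _ q "p - 1"])
      (use Suc.prems in \<open>auto simp: D_funpow_D simp del: funpow.simps\<close>)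
  ultimately have "(D ^^ n) (D (a \<otimes> b)) \<in> Q"
    using Suc.prems by (simp add: D_mult D_funpow_add Q.a_closed)
  then show ?case by (simp add: funpow_swap1)
qed

text \<open>At \<open>n = p + q\<close> exactly one Leibniz term survives modulo \<open>Q\<close>.
  The factor \<open>c\<close> is the binomial coefficient of \<open>p + q\<close> over
  \<open>p\<close>, built up by Pascal's rule; only its positivity is recorded.\<close>

lemma funpow_mult_lead:
  assumes "a \<in> carrier R" "b \<in> carrier R"
    "\<And>i. i < p \<Longrightarrow> (D ^^ i) a \<in> Q" "\<And>i. i < q \<Longrightarrow> (D ^^ i) b \<in> Q" "n = p + q"
  shows "\<exists>c::nat. c > 0 \<and> (D ^^ n) (a \<otimes> b) \<ominus> [c] \<cdot>\<^bsub>R\<^esub> ((D ^^ p) a \<otimes> (D ^^ q) b) \<in> Q"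
  using assms
proof (induction n arbitrary: a b p q)
  case 0
  then have "(D ^^ 0) (a \<otimes> b) \<ominus> [(1::nat)] \<cdot>\<^bsub>R\<^esub> ((D ^^ p) a \<otimes> (D ^^ q) b) = \<zero>"
    by (simp add: minus_eq r_neg)
  then show ?case using Q.zero_closed by (metis zero_less_one)
next
  case (Suc n)
  define t where "t = (D ^^ p) a \<otimes> (D ^^ q) b"
  have t: "t \<in> carrier R" using Suc.prems t_def by auto
  \<comment> \<open>When \<open>q = 0\<close> this summand lies in \<open>Q\<close> already and
    contributes the factor 0. Positivity of the total survives because \<open>p\<close> and
    \<open>q\<close> are not both 0.\<close>
  have 1: "\<exists>c::nat. (q > 0 \<longrightarrow> c > 0) \<and> (D ^^ n) (a \<otimes> D b) \<ominus> [c] \<cdot>\<^bsub>R\<^esub> t \<in> Q"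
  proof (cases q)
    case 0
    have "(D ^^ n) (a \<otimes> D b) \<in> Q"
      by (rule funpow_mult_low[of _ _ p 0]) (use Suc.prems 0 in auto)
    then have "(D ^^ n) (a \<otimes> D b) \<ominus> [(0::nat)] \<cdot>\<^bsub>R\<^esub> t \<in> Q" using Suc.prems t by (simp add: minus_eq)
    then show ?thesis using 0 by blast
  next
    case (Suc q')
    have "\<exists>c::nat. c > 0 \<and> (D ^^ n) (a \<otimes> D b) \<ominus> [c] \<cdot>\<^bsub>R\<^esub> ((D ^^ p) a \<otimes> (D ^^ q') (D b)) \<in> Q"
      by (rule Suc.IH) (use Suc.prems Suc in \<open>auto simp: D_funpow_D simp del: funpow.simps\<close>)
    then show ?thesis by (auto simp: t_def Suc funpow_swap1)
  qed
  have 2: "\<exists>c::nat. (p > 0 \<longrightarrow> c > 0) \<and> (D ^^ n) (b \<otimes> D a) \<ominus> [c] \<cdot>\<^bsub>R\<^esub> t \<in> Q"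
  proof (cases p)
    case 0
    have "(D ^^ n) (b \<otimes> D a) \<in> Q"
      by (rule funpow_mult_low[of _ _ q 0]) (use Suc.prems 0 in auto)
    then have "(D ^^ n) (b \<otimes> D a) \<ominus> [(0::nat)] \<cdot>\<^bsub>R\<^esub> t \<in> Q" using Suc.prems t by (simp add: minus_eq)
    then show ?thesis using 0 by blast
  next
    case (Suc p')
    have "\<exists>c::nat. c > 0 \<and> (D ^^ n) (D a \<otimes> b) \<ominus> [c] \<cdot>\<^bsub>R\<^esub> ((D ^^ p') (D a) \<otimes> (D ^^ q) b) \<in> Q"
      by (rule Suc.IH) (use Suc.prems Suc in \<open>auto simp: D_funpow_D simp del: funpow.simps\<close>)
    then show ?thesis using Suc.prems by (auto simp: t_def Suc funpow_swap1 m_comm[of b])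
  qed
  obtain c1 c2 :: nat where c: "q > 0 \<longrightarrow> c1 > 0" "p > 0 \<longrightarrow> c2 > 0"
    "(D ^^ n) (a \<otimes> D b) \<ominus> [c1] \<cdot>\<^bsub>R\<^esub> t \<in> Q" "(D ^^ n) (b \<otimes> D a) \<ominus> [c2] \<cdot>\<^bsub>R\<^esub> t \<in> Q"
    using 1 2 by blast
  have "(D ^^ Suc n) (a \<otimes> b) = (D ^^ n) (a \<otimes> D b) \<oplus> (D ^^ n) (b \<otimes> D a)"
    using Suc.prems(1,2) by (simp add: funpow_swap1 D_mult D_funpow_add)
  moreover have "[(c1 + c2)] \<cdot>\<^bsub>R\<^esub> t = [c1] \<cdot>\<^bsub>R\<^esub> t \<oplus> [c2] \<cdot>\<^bsub>R\<^esub> t"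
    using t by (simp add: add.nat_pow_mult)
  ultimately have "(D ^^ Suc n) (a \<otimes> b) \<ominus> [(c1 + c2)] \<cdot>\<^bsub>R\<^esub> t =
     ((D ^^ n) (a \<otimes> D b) \<ominus> [c1] \<cdot>\<^bsub>R\<^esub> t) \<oplus> ((D ^^ n) (b \<otimes> D a) \<ominus> [c2] \<cdot>\<^bsub>R\<^esub> t)"
    using Suc.prems t by (simp add: minus_eq minus_add a_ac)
  then have "(D ^^ Suc n) (a \<otimes> b) \<ominus> [(c1 + c2)] \<cdot>\<^bsub>R\<^esub> t \<in> Q" using c Q.a_closed by auto
  moreover have "c1 + c2 > 0" using c Suc.prems by auto
  ultimately show ?case unfolding t_def by blast
qed

lemma stable_core_ideal: "ideal (stable_core D R Q) R"
proof (rule idealI)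
  show "subgroup (stable_core D R Q) (add_monoid R)"
  proof (rule add.subgroupI)
    show "stable_core D R Q \<noteq> {}" using Q.zero_closed unfolding stable_core_def by auto
    fix a b assume a: "a \<in> stable_core D R Q"
    have "(D ^^ k) (\<ominus> a) = \<ominus> (D ^^ k) a" for k
      using a by (induction k) (auto simp: D_neg stable_core_def)
    then show "\<ominus> a \<in> stable_core D R Q" using a unfolding stable_core_def by auto
    assume "b \<in> stable_core D R Q"
    then show "a \<oplus> b \<in> stable_core D R Q"
      using a unfolding stable_core_def by (auto simp: D_funpow_add)
  qed (auto simp: stable_core_def)
  fix a x assume a: "a \<in> stable_core D R Q" and x: "x \<in> carrier R"
  have "(D ^^ k) (a \<otimes> x) \<in> Q" for k
    by (rule funpow_mult_low[of _ _ "Suc k" 0]) (use a x in \<open>auto simp: stable_core_def simp del: funpow.simps\<close>)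
  then show "a \<otimes> x \<in> stable_core D R Q" using a x unfolding stable_core_def by auto
  then show "x \<otimes> a \<in> stable_core D R Q" using a x m_comm by (auto simp: stable_core_def)
qed (rule ring_axioms)

end

text \<open>For \<open>a, b\<close> outside the core, \<open>D\<^sup>p\<^sup>+\<^sup>q (a b)\<close> is, modulo \<open>Q\<close>, a positive multiple of
  \<open>D\<^sup>p a D\<^sup>q b\<close>, where \<open>p\<close> and \<open>q\<close> are the first exponents at which the iterates leave \<open>Q\<close>.\<close>

lemma stable_core_prime:
  assumes "primeideal Q R" and char: "\<And>n::nat. n > 0 \<Longrightarrow> [n] \<cdot>\<^bsub>R\<^esub> \<one> \<notin> Q"
  shows "primeideal (stable_core D R Q) R"
proof -
  interpret Q: primeideal Q R by fact
  show ?thesis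
  proof (rule primeidealI[OF stable_core_ideal])
    show "ideal Q R" "cring R" by unfold_locales
    show "carrier R \<noteq> stable_core D R Q"
      using stable_core_subset Q.I_notcarr Q.Icarr by blast
    fix a b assume a: "a \<in> carrier R" and b: "b \<in> carrier R" and ab: "a \<otimes> b \<in> stable_core D R Q"
    show "a \<in> stable_core D R Q \<or> b \<in> stable_core D R Q"
    proof (rule ccontr)
      assume "\<not> ?thesis"
      then obtain p0 q0 where "(D ^^ p0) a \<notin> Q" "(D ^^ q0) b \<notin> Q"
        using a b unfolding stable_core_def by auto
      define p where "p = (LEAST p. (D ^^ p) a \<notin> Q)"
      define q where "q = (LEAST q. (D ^^ q) b \<notin> Q)"
      have p: "(D ^^ p) a \<notin> Q" "\<And>i. i < p \<Longrightarrow> (D ^^ i) a \<in> Q"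
        using LeastI[of "\<lambda>p. (D ^^ p) a \<notin> Q", OF \<open>(D ^^ p0) a \<notin> Q\<close>] not_less_Least p_def by blast+
      have q: "(D ^^ q) b \<notin> Q" "\<And>i. i < q \<Longrightarrow> (D ^^ i) b \<in> Q"
        using LeastI[of "\<lambda>p. (D ^^ p) b \<notin> Q", OF \<open>(D ^^ q0) b \<notin> Q\<close>] not_less_Least q_def by blast+
      define t where "t = (D ^^ p) a \<otimes> (D ^^ q) b"
      have t: "t \<in> carrier R" using a b t_def by auto
      obtain c :: nat where c: "c > 0" "(D ^^ (p + q)) (a \<otimes> b) \<ominus> [c] \<cdot>\<^bsub>R\<^esub> t \<in> Q"
        using funpow_mult_lead[OF Q.is_ideal a b p(2) q(2) refl] t_def by auto
      moreover have "(D ^^ (p + q)) (a \<otimes> b) \<in> Q" using ab unfolding stable_core_def by auto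
      ultimately have "(D ^^ (p + q)) (a \<otimes> b) \<ominus> ((D ^^ (p + q)) (a \<otimes> b) \<ominus> [c] \<cdot>\<^bsub>R\<^esub> t) \<in> Q"
        using Q.a_closed Q.a_inv_closed by (simp add: minus_eq)
      moreover have "(D ^^ (p + q)) (a \<otimes> b) \<ominus> ((D ^^ (p + q)) (a \<otimes> b) \<ominus> [c] \<cdot>\<^bsub>R\<^esub> t) = [c] \<cdot>\<^bsub>R\<^esub> t"
      proof -
        have x: "(D ^^ (p + q)) (a \<otimes> b) \<in> carrier R" and y: "[c] \<cdot>\<^bsub>R\<^esub> t \<in> carrier R" using a b t by auto
        show ?thesis using x y by algebra
      qed
      moreover have "[c] \<cdot>\<^bsub>R\<^esub> t = ([c] \<cdot>\<^bsub>R\<^esub> \<one>) \<otimes> t" using t by (simp add: add_pow_ldistr)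
      ultimately have "([c] \<cdot>\<^bsub>R\<^esub> \<one>) \<otimes> t \<in> Q" by simp
      then have "t \<in> Q" using Q.I_prime[OF _ t] char[OF c(1)] by blast
      then show False using Q.I_prime[of "(D ^^ p) a" "(D ^^ q) b"] a b p(1) q(1) unfolding t_def by auto
    qed
  qed
qed

end

lemma (in cring) ring_derivation_comb:
  assumes "ring_derivation R D" "ring_derivation R E" "a \<in> carrier R" "b \<in> carrier R"
  shows "ring_derivation R (\<lambda>x. a \<otimes> D x \<oplus> b \<otimes> E x)"
proof -
  interpret D: ring_derivation R D by fact
  interpret E: ring_derivation R E by fact
  show ?thesis
  proof unfold_locales
    fix x y assume x: "x \<in> carrier R" and y: "y \<in> carrier R"
    then show "a \<otimes> D (x \<oplus> y) \<oplus> b \<otimes> E (x \<oplus> y) = a \<otimes> D x \<oplus> b \<otimes> E x \<oplus> (a \<otimes> D y \<oplus> b \<otimes> E y)"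
      using assms by (simp add: D.D_add E.D_add r_distr a_ac)
    show "a \<otimes> D (x \<otimes> y) \<oplus> b \<otimes> E (x \<otimes> y) =
      x \<otimes> (a \<otimes> D y \<oplus> b \<otimes> E y) \<oplus> y \<otimes> (a \<otimes> D x \<oplus> b \<otimes> E x)"
      using assms x y by (simp add: D.D_mult E.D_mult r_distr a_ac m_ac)
  qed (use assms in auto)
qed

text \<open>The elements of the ideal whose derivative stays in it form an ideal themselves, so
  stability can be tested on generators.\<close>

lemma (in ring_derivation) genideal_stable:
  assumes "G \<subseteq> carrier R" "D ` G \<subseteq> Idl G" "a \<in> Idl G"
  shows "D a \<in> Idl G"
proof -
  interpret J: ideal "Idl G" R using genideal_ideal assms by auto
  have "ideal {a \<in> Idl G. D a \<in> Idl G} R"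
  proof (rule idealI)
    show "subgroup {a \<in> Idl G. D a \<in> Idl G} (add_monoid R)"
      by (rule add.subgroupI) (use J.Icarr J.zero_closed in \<open>auto simp: D_add D_neg intro!: exI[of _ \<zero>]\<close>)
    fix a x assume "a \<in> {a \<in> Idl G. D a \<in> Idl G}" "x \<in> carrier R"
    then show "a \<otimes> x \<in> {a \<in> Idl G. D a \<in> Idl G}" "x \<otimes> a \<in> {a \<in> Idl G. D a \<in> Idl G}"
      using J.Icarr by (auto simp: D_mult J.I_l_closed J.I_r_closed J.a_closed)
  qed (rule ring_axioms)
  then have "Idl G \<subseteq> {a \<in> Idl G. D a \<in> Idl G}"
    by (rule genideal_minimal) (use assms genideal_self in auto)
  then show ?thesis using assms by auto
qed

section \<open>The ring of formal power series\<close>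

lemma (in abelian_monoid) finsum_Sigma:
  assumes "finite A" "\<And>x. x \<in> A \<Longrightarrow> finite (B x)" "\<And>x y. \<lbrakk>x \<in> A; y \<in> B x\<rbrakk> \<Longrightarrow> f (x, y) \<in> carrier G"
  shows "finsum G (\<lambda>x. finsum G (\<lambda>y. f (x, y)) (B x)) A = finsum G f (Sigma A B)"
  using assms
proof (induction A rule: finite_induct)
  case (insert x F)
  have "Sigma (insert x F) B = Pair x ` B x \<union> Sigma F B" by auto
  moreover have "finsum G f (Pair x ` B x \<union> Sigma F B) = finsum G f (Pair x ` B x) \<oplus> finsum G f (Sigma F B)"
    by (rule finsum_Un_disjoint) (use insert in auto)
  moreover have "finsum G f (Pair x ` B x) = finsum G (\<lambda>y. f (x, y)) (B x)"
    by (rule finsum_reindex) (use insert in \<open>auto simp: inj_on_def\<close>)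
  moreover have "finsum G (\<lambda>x. finsum G (\<lambda>y. f (x, y)) (B x)) (insert x F) =
     finsum G (\<lambda>y. f (x, y)) (B x) \<oplus> finsum G (\<lambda>x. finsum G (\<lambda>y. f (x, y)) (B x)) F"
    using insert by (auto intro!: finsum_insert finsum_closed)
  ultimately show ?case using insert by simp
qed auto

lemma (in abelian_monoid) finsum_eq_single:
  assumes "finite A" "i \<in> A" "\<And>j. \<lbrakk>j \<in> A; j \<noteq> i\<rbrakk> \<Longrightarrow> f j = \<zero>" "f i \<in> carrier G"
  shows "finsum G f A = f i"
proof -
  have "finsum G f {i} = finsum G f A"
    by (rule add.finprod_mono_neutral_cong_left) (use assms in \<open>auto simp: Pi_def, metis zero_closed\<close>)
  then show ?thesis using assms by simp
qed

lemma (in abelian_monoid) finsum_all_zero: "(\<And>i. i \<in> A \<Longrightarrow> f i = \<zero>) \<Longrightarrow> finsum G f A = \<zero>"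
  by (rule add.finprod_one_eqI)

definition below :: "(nat \<Rightarrow> nat) \<Rightarrow> (nat \<Rightarrow> nat) set"
  where "below m = {a. \<forall>i. a i \<le> m i}"

abbreviation unit_exp :: "nat \<Rightarrow> nat \<Rightarrow> nat"
  where "unit_exp i \<equiv> (\<lambda>j. if j = i then 1 else 0)"

lemma monomials_below:
  assumes "m \<in> monomials d" "a \<in> below m"
  shows "a \<in> monomials d"
proof -
  have "a i \<le> m i" for i using assms by (simp add: below_def)
  moreover have "m i = 0" if "i > d" for i using assms that by (simp add: monomials_def)
  ultimately show ?thesis by (simp add: monomials_def) (metis le_zero_eq)
qed

lemma monomials_zero [simp]: "(\<lambda>_. 0) \<in> monomials d"
  unfolding monomials_def by simp

lemma monomials_add: "\<lbrakk>a \<in> monomials d; b \<in> monomials d\<rbrakk> \<Longrightarrow> (\<lambda>i. a i + b i) \<in> monomials d"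
  unfolding monomials_def by simp

lemma monomials_diff: "m \<in> monomials d \<Longrightarrow> (\<lambda>i. m i - a i) \<in> monomials d"
  unfolding monomials_def by simp

lemma monomials_unit: "i \<le> d \<Longrightarrow> unit_exp i \<in> monomials d"
  unfolding monomials_def by simp

lemma monomials_single: "i \<le> d \<Longrightarrow> (\<lambda>j. if j = i then k else 0) \<in> monomials d"
  unfolding monomials_def by simp

lemma monomials_add_unit: "\<lbrakk>m \<in> monomials d; i \<le> d\<rbrakk> \<Longrightarrow> (\<lambda>j. m j + unit_exp i j) \<in> monomials d"
  by (rule monomials_add) (auto simp: monomials_unit)

lemma finite_below: "m \<in> monomials d \<Longrightarrow> finite (below m)"
proof (rule finite_subset)
  assume m: "m \<in> monomials d"
  show "below m \<subseteq> (\<lambda>g i. if i \<le> d then g i else 0) ` (PiE {..d} (\<lambda>i. {..m i}))"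
  proof
    fix a assume a: "a \<in> below m"
    then have "a = (\<lambda>i. if i \<le> d then restrict a {..d} i else 0)"
      using monomials_below[OF m a] unfolding monomials_def by (auto simp: fun_eq_iff)
    moreover have "restrict a {..d} \<in> PiE {..d} (\<lambda>i. {..m i})" using a unfolding below_def by auto
    ultimately show "a \<in> (\<lambda>g i. if i \<le> d then g i else 0) ` (PiE {..d} (\<lambda>i. {..m i}))" by blast
  qed
  show "finite ((\<lambda>g i. if i \<le> d then g i else (0::nat)) ` (PiE {..d} (\<lambda>i. {..m i})))"
    by (intro finite_imageI finite_PiE) auto
qed

section \<open>The ring of power series under the Cauchy product\<close>

locale power_series_ring = K?: cring K for K (structure) +
  fixes d :: nat
begin

abbreviation P where "P \<equiv> power_series K d"

lemma coeff_closed [simp]: "\<lbrakk>g \<in> carrier P; m \<in> monomials d\<rbrakk> \<Longrightarrow> g m \<in> carrier K"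
  unfolding power_series_def by auto

lemma ps_eqI: "\<lbrakk>g \<in> carrier P; h \<in> carrier P; \<And>m. m \<in> monomials d \<Longrightarrow> g m = h m\<rbrakk> \<Longrightarrow> g = h"
  unfolding power_series_def by (auto intro: PiE_ext)

lemma ps_memI: "(\<And>m. m \<in> monomials d \<Longrightarrow> c m \<in> carrier K) \<Longrightarrow> (\<lambda>m\<in>monomials d. c m) \<in> carrier P"
  unfolding power_series_def by auto

lemma coeff_mult: "m \<in> monomials d \<Longrightarrow>
    (g \<otimes>\<^bsub>P\<^esub> h) m = (\<Oplus>a\<in>below m. g a \<otimes> h (\<lambda>i. m i - a i))"
  unfolding power_series_def below_def by simp

lemma coeff_add [simp]: "m \<in> monomials d \<Longrightarrow> (g \<oplus>\<^bsub>P\<^esub> h) m = g m \<oplus> h m"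
  unfolding power_series_def by simp

lemma coeff_zero [simp]: "m \<in> monomials d \<Longrightarrow> \<zero>\<^bsub>P\<^esub> m = \<zero>"
  unfolding power_series_def by simp

lemma coeff_one: "m \<in> monomials d \<Longrightarrow> \<one>\<^bsub>P\<^esub> m = (if m = (\<lambda>_. 0) then \<one> else \<zero>)"
  unfolding power_series_def by simp

lemma coeff_smult [simp]: "m \<in> monomials d \<Longrightarrow> (c \<odot>\<^bsub>P\<^esub> g) m = c \<otimes> g m"
  unfolding power_series_def by simp

lemma term_closed: "\<lbrakk>g \<in> carrier P; h \<in> carrier P; m \<in> monomials d; a \<in> below m\<rbrakk> \<Longrightarrow>
    g a \<otimes> h (\<lambda>i. m i - a i) \<in> carrier K"
  by (simp add: monomials_below monomials_diff)

lemma ps_mult_closed: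
  assumes gh: "g \<in> carrier P" "h \<in> carrier P"
  shows "g \<otimes>\<^bsub>P\<^esub> h \<in> carrier P"
proof -
  have "g \<otimes>\<^bsub>P\<^esub> h = (\<lambda>m\<in>monomials d. \<Oplus>a\<in>below m. g a \<otimes> h (\<lambda>i. m i - a i))"
    unfolding power_series_def below_def by simp
  also have "\<dots> \<in> carrier P"
    by (rule ps_memI, rule finsum_closed) (simp add: Pi_def term_closed[OF gh])
  finally show ?thesis .
qed

lemma ps_add_closed: "\<lbrakk>g \<in> carrier P; h \<in> carrier P\<rbrakk> \<Longrightarrow> g \<oplus>\<^bsub>P\<^esub> h \<in> carrier P"
  unfolding power_series_def by auto

lemma ps_zero_closed: "\<zero>\<^bsub>P\<^esub> \<in> carrier P"
  unfolding power_series_def by auto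

lemma ps_one_closed: "\<one>\<^bsub>P\<^esub> \<in> carrier P"
  unfolding power_series_def by auto

lemma ps_smult_closed: "\<lbrakk>c \<in> carrier K; g \<in> carrier P\<rbrakk> \<Longrightarrow> c \<odot>\<^bsub>P\<^esub> g \<in> carrier P"
  unfolding power_series_def by auto

lemma ps_mult_comm:
  assumes g: "g \<in> carrier P" and h: "h \<in> carrier P"
  shows "g \<otimes>\<^bsub>P\<^esub> h = h \<otimes>\<^bsub>P\<^esub> g"
proof (rule ps_eqI)
  fix m assume m: "m \<in> monomials d"
  define r where "r = (\<lambda>a i. m i - a i :: nat)"
  have rr: "r (r a) = a" if "a \<in> below m" for a
    using that unfolding r_def below_def by auto
  have rb: "r a \<in> below m" for a unfolding r_def below_def by auto
  have r: "r ` below m = below m"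
  proof (intro equalityI subsetI)
    fix a assume "a \<in> below m"
    then show "a \<in> r ` below m" using rr rb by (metis imageI)
  qed (use rb in auto)
  have "(\<Oplus>a\<in>r ` below m. g a \<otimes> h (r a)) = (\<Oplus>a\<in>below m. g (r a) \<otimes> h (r (r a)))"
  proof (rule finsum_reindex)
    show "inj_on r (below m)" using rr by (metis inj_onI)
    show "(\<lambda>a. g a \<otimes> h (r a)) \<in> r ` below m \<rightarrow> carrier K"
      unfolding r unfolding r_def using term_closed[OF g h m] by auto
  qed
  also have "\<dots> = (\<Oplus>a\<in>below m. h a \<otimes> g (r a))"
    by (rule finsum_cong')
      (use g h m rr term_closed[OF h g m] in \<open>auto simp: r_def monomials_below monomials_diff intro!: m_comm\<close>)
  finally show "(g \<otimes>\<^bsub>P\<^esub> h) m = (h \<otimes>\<^bsub>P\<^esub> g) m"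
    using m r by (simp add: coeff_mult r_def)
qed (use assms ps_mult_closed in auto)

text \<open>Both sides are sums over triples of exponents with total \<open>m\<close>. The left side
  is indexed by pairs \<open>(c, a)\<close> with \<open>a\<close> below \<open>c\<close>, the right
  side by pairs \<open>(a, b)\<close>; the substitution \<open>c = a + b\<close> matches
  them.\<close>

lemma ps_mult_assoc:
  assumes g: "g \<in> carrier P" and h: "h \<in> carrier P" and k: "k \<in> carrier P"
  shows "(g \<otimes>\<^bsub>P\<^esub> h) \<otimes>\<^bsub>P\<^esub> k = g \<otimes>\<^bsub>P\<^esub> (h \<otimes>\<^bsub>P\<^esub> k)"
proof (rule ps_eqI)
  fix m assume m: "m \<in> monomials d"
  define F where "F = (\<lambda>(c, a). g a \<otimes> h (\<lambda>i. c i - a i) \<otimes> k (\<lambda>i. m i - c i))"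
  define G where "G = (\<lambda>(a, b). g a \<otimes> h b \<otimes> k (\<lambda>i. m i - a i - b i))"
  define S where "S = Sigma (below m) (\<lambda>a. below (\<lambda>i. m i - a i))"
  define r where "r = (\<lambda>(a, b). ((\<lambda>i. a i + b i), a) :: (nat \<Rightarrow> nat) \<times> (nat \<Rightarrow> nat))"
  have mono: "a \<in> monomials d" "(\<lambda>i. m i - a i) \<in> monomials d" if "a \<in> below m" for a
    using monomials_below[OF m that] monomials_diff[OF m] by auto
  have mono2: "a \<in> monomials d" "(\<lambda>i. c i - a i) \<in> monomials d" if "c \<in> below m" "a \<in> below c" for a c
    using monomials_below[OF mono(1)[OF that(1)] that(2)] monomials_diff[OF mono(1)[OF that(1)]] by auto
  have mono3: "b \<in> monomials d" "(\<lambda>i. m i - a i - b i) \<in> monomials d"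
    if "a \<in> below m" "b \<in> below (\<lambda>i. m i - a i)" for a b
    using monomials_below[OF mono(2)[OF that(1)] that(2)] monomials_diff[OF mono(2)[OF that(1)]] by auto
  have fin: "finite (below m)" "\<And>a. a \<in> below m \<Longrightarrow> finite (below a)"
    "\<And>a. a \<in> below m \<Longrightarrow> finite (below (\<lambda>i. m i - a i))"
    using finite_below m mono by auto
  have Fc: "F (c, a) \<in> carrier K" if "c \<in> below m" "a \<in> below c" for c a
    using g h k mono[OF that(1)] mono2[OF that] by (simp add: F_def)
  have Gc: "G (a, b) \<in> carrier K" if "a \<in> below m" "b \<in> below (\<lambda>i. m i - a i)" for a b
    using g h k mono[OF that(1)] mono3[OF that] by (simp add: G_def)
  have "((g \<otimes>\<^bsub>P\<^esub> h) \<otimes>\<^bsub>P\<^esub> k) m =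
     (\<Oplus>c\<in>below m. (\<Oplus>a\<in>below c. g a \<otimes> h (\<lambda>i. c i - a i)) \<otimes> k (\<lambda>i. m i - c i))"
    unfolding coeff_mult[OF m]
    by (rule finsum_cong')
      (use g h k mono2 in \<open>auto simp: coeff_mult mono Pi_def intro!: finsum_closed m_closed\<close>)
  also have "\<dots> = (\<Oplus>c\<in>below m. \<Oplus>a\<in>below c. F (c, a))"
  proof (rule finsum_cong')
    fix c assume c: "c \<in> below m"
    show "(\<Oplus>a\<in>below c. g a \<otimes> h (\<lambda>i. c i - a i)) \<otimes> k (\<lambda>i. m i - c i) = (\<Oplus>a\<in>below c. F (c, a))"
      unfolding F_def prod.case
      by (rule finsum_ldistr) (use c fin g h k mono2[OF c] in \<open>auto simp: mono Pi_def\<close>)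
  qed (use Fc in \<open>auto simp: Pi_def intro!: finsum_closed\<close>)
  also have "\<dots> = finsum K F (Sigma (below m) below)"
    by (rule finsum_Sigma) (use fin Fc in auto)
  also have "Sigma (below m) below = r ` S"
  proof (intro equalityI subsetI)
    fix x assume x: "x \<in> Sigma (below m) below"
    obtain c a where ca: "x = (c, a)" by force
    then have "x = r (a, \<lambda>i. c i - a i)" using x by (auto simp: r_def below_def)
    moreover have "(a, \<lambda>i. c i - a i) \<in> S"
      using x ca unfolding S_def below_def by (auto intro: le_trans diff_le_mono)
    ultimately show "x \<in> r ` S" by blast
  next
    fix x assume "x \<in> r ` S"
    then obtain a b where ab: "x = ((\<lambda>i. a i + b i), a)" "\<And>i. a i \<le> m i" "\<And>i. b i \<le> m i - a i"
      by (auto simp: r_def S_def below_def)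
    then have "a i + b i \<le> m i" for i using ab(2,3)[of i] by arith
    then show "x \<in> Sigma (below m) below" using ab by (auto simp: below_def)
  qed
  also have "finsum K F (r ` S) = finsum K (\<lambda>x. F (r x)) S"
  proof (rule finsum_reindex)
    show "inj_on r S" by (auto simp: inj_on_def r_def fun_eq_iff)
    show "F \<in> r ` S \<rightarrow> carrier K"
      unfolding \<open>Sigma (below m) below = r ` S\<close>[symmetric] using Fc by auto
  qed
  also have "\<dots> = finsum K G S"
    by (rule finsum_cong') (use Gc in \<open>auto simp: F_def G_def r_def S_def\<close>)
  also have "\<dots> = (\<Oplus>a\<in>below m. \<Oplus>b\<in>below (\<lambda>i. m i - a i). G (a, b))"
    unfolding S_def by (rule finsum_Sigma[symmetric]) (use fin Gc in auto)
  also have "\<dots> = (\<Oplus>a\<in>below m. g a \<otimes> (h \<otimes>\<^bsub>P\<^esub> k) (\<lambda>i. m i - a i))"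
  proof (rule finsum_cong')
    fix a assume a: "a \<in> below m"
    have ma: "(\<lambda>i. m i - a i) \<in> monomials d" using mono[OF a] by simp
    have "g a \<otimes> (h \<otimes>\<^bsub>P\<^esub> k) (\<lambda>i. m i - a i) =
      (\<Oplus>b\<in>below (\<lambda>i. m i - a i). g a \<otimes> (h b \<otimes> k (\<lambda>i. m i - a i - b i)))"
      unfolding coeff_mult[OF ma]
      by (rule finsum_rdistr) (use fin term_closed[OF h k ma] g a in \<open>auto simp: mono\<close>)
    also have "\<dots> = (\<Oplus>b\<in>below (\<lambda>i. m i - a i). G (a, b))"
      by (rule finsum_cong')
        (use Gc a mono[OF a] mono3[OF a] g h k in \<open>auto simp: G_def intro!: m_assoc[symmetric]\<close>)
    finally show "(\<Oplus>b\<in>below (\<lambda>i. m i - a i). G (a, b)) = g a \<otimes> (h \<otimes>\<^bsub>P\<^esub> k) (\<lambda>i. m i - a i)" ..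
  qed (use g h k ps_mult_closed mono in auto)
  finally show "((g \<otimes>\<^bsub>P\<^esub> h) \<otimes>\<^bsub>P\<^esub> k) m = (g \<otimes>\<^bsub>P\<^esub> (h \<otimes>\<^bsub>P\<^esub> k)) m"
    unfolding coeff_mult[OF m, of g] .
qed (use assms ps_mult_closed in auto)

text \<open>An exponent that involves a variable beyond index \<open>d\<close> gives the zero
  series. Closure of monomials, and of \<open>ps_var\<close>, therefore holds for every
  index.\<close>

definition ps_monom :: "(nat \<Rightarrow> nat) \<Rightarrow> (nat \<Rightarrow> nat) \<Rightarrow> 'a"
  where "ps_monom c = (\<lambda>m\<in>monomials d. if m = c then \<one> else \<zero>)"

lemma ps_monom_closed [simp, intro]: "ps_monom c \<in> carrier P"
  unfolding ps_monom_def by (rule ps_memI) auto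

lemma coeff_monom: "m \<in> monomials d \<Longrightarrow> ps_monom c m = (if m = c then \<one> else \<zero>)"
  unfolding ps_monom_def by simp

lemma coeff_monom_mult:
  assumes g: "g \<in> carrier P" and m: "m \<in> monomials d"
  shows "(ps_monom c \<otimes>\<^bsub>P\<^esub> g) m = (if c \<in> below m then g (\<lambda>i. m i - c i) else \<zero>)"
proof (cases "c \<in> below m")
  case True
  have "(ps_monom c \<otimes>\<^bsub>P\<^esub> g) m = ps_monom c c \<otimes> g (\<lambda>i. m i - c i)"
    unfolding coeff_mult[OF m]
    by (rule finsum_eq_single)
      (use True finite_below m g in \<open>auto simp: coeff_monom monomials_below monomials_diff\<close>)
  then show ?thesis using True m g by (simp add: coeff_monom monomials_below monomials_diff)
next
  case False
  have "(ps_monom c \<otimes>\<^bsub>P\<^esub> g) m = \<zero>"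
    unfolding coeff_mult[OF m]
    by (rule finsum_all_zero)
      (use False m g in \<open>auto simp: coeff_monom monomials_below monomials_diff\<close>)
  then show ?thesis using False by simp
qed

lemma ps_one_monom: "\<one>\<^bsub>P\<^esub> = ps_monom (\<lambda>_. 0)"
  by (rule ps_eqI) (auto simp: ps_one_closed coeff_one coeff_monom)

lemma cring_P: "cring P"
proof (rule cringI)
  show "abelian_group P"
  proof (rule abelian_groupI)
    fix x assume x: "x \<in> carrier P"
    have "(\<lambda>m\<in>monomials d. \<ominus> x m) \<oplus>\<^bsub>P\<^esub> x = \<zero>\<^bsub>P\<^esub>"
      by (rule ps_eqI) (use x in \<open>auto simp: l_neg intro!: ps_memI ps_add_closed ps_zero_closed\<close>)
    then show "\<exists>y\<in>carrier P. y \<oplus>\<^bsub>P\<^esub> x = \<zero>\<^bsub>P\<^esub>"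
      using x by (auto intro!: bexI[of _ "\<lambda>m\<in>monomials d. \<ominus> x m"] ps_memI)
  qed (auto intro!: ps_eqI ps_add_closed ps_zero_closed simp: a_ac)
  show "Group.comm_monoid P"
  proof (rule comm_monoidI)
    fix x assume "x \<in> carrier P"
    then show "\<one>\<^bsub>P\<^esub> \<otimes>\<^bsub>P\<^esub> x = x"
      unfolding ps_one_monom
      by (intro ps_eqI ps_mult_closed) (auto simp: coeff_monom_mult below_def)
  qed (auto intro!: ps_mult_closed ps_one_closed simp: ps_mult_assoc ps_mult_comm)
  fix x y z assume x: "x \<in> carrier P" and y: "y \<in> carrier P" and z: "z \<in> carrier P"
  show "(x \<oplus>\<^bsub>P\<^esub> y) \<otimes>\<^bsub>P\<^esub> z = x \<otimes>\<^bsub>P\<^esub> z \<oplus>\<^bsub>P\<^esub> y \<otimes>\<^bsub>P\<^esub> z"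
  proof (rule ps_eqI)
    fix m assume m: "m \<in> monomials d"
    have "((x \<oplus>\<^bsub>P\<^esub> y) \<otimes>\<^bsub>P\<^esub> z) m =
      (\<Oplus>a\<in>below m. x a \<otimes> z (\<lambda>i. m i - a i) \<oplus> y a \<otimes> z (\<lambda>i. m i - a i))"
      unfolding coeff_mult[OF m]
      by (rule finsum_cong')
        (use x y z m in \<open>auto simp: monomials_below monomials_diff l_distr\<close>)
    also have "\<dots> = (x \<otimes>\<^bsub>P\<^esub> z \<oplus>\<^bsub>P\<^esub> y \<otimes>\<^bsub>P\<^esub> z) m"
      unfolding coeff_add[OF m] coeff_mult[OF m]
      by (rule finsum_addf) (use term_closed[OF x z m] term_closed[OF y z m] in auto)
    finally show "((x \<oplus>\<^bsub>P\<^esub> y) \<otimes>\<^bsub>P\<^esub> z) m = (x \<otimes>\<^bsub>P\<^esub> z \<oplus>\<^bsub>P\<^esub> y \<otimes>\<^bsub>P\<^esub> z) m" .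
  qed (use x y z in \<open>auto intro!: ps_mult_closed ps_add_closed\<close>)
qed

end

sublocale power_series_ring \<subseteq> P: cring "power_series K d"
  by (rule cring_P)

lemma exp_diff_unit: "m i > 0 \<Longrightarrow> (\<lambda>j. (m j - unit_exp i j) + unit_exp i j) = m"
  by auto

lemma unit_exp_below: "unit_exp i \<in> below m \<longleftrightarrow> m i > 0"
  unfolding below_def by (auto dest: spec[of _ i])

context power_series_ring
begin

lemma ps_var_monom: "ps_var K d i = ps_monom (unit_exp i)"
  unfolding ps_var_def ps_monom_def ..

lemma ps_var_closed [simp, intro]: "ps_var K d i \<in> carrier P"
  unfolding ps_var_monom by simp

lemma coeff_var_mult:
  "\<lbrakk>g \<in> carrier P; m \<in> monomials d\<rbrakk> \<Longrightarrow>
    (ps_var K d i \<otimes>\<^bsub>P\<^esub> g) m = (if m i > 0 then g (\<lambda>j. m j - unit_exp i j) else \<zero>)"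
  unfolding ps_var_monom by (simp add: coeff_monom_mult unit_exp_below)

lemma coeff_var_mult_shift:
  assumes "g \<in> carrier P" "m \<in> monomials d" "i \<le> d"
  shows "(ps_var K d i \<otimes>\<^bsub>P\<^esub> g) (\<lambda>j. m j + unit_exp i j) = g m"
proof -
  have "(\<lambda>j. m j + unit_exp i j - unit_exp i j) = m" by auto
  then show ?thesis using assms monomials_add_unit[OF assms(2,3)] by (simp add: coeff_var_mult)
qed

text \<open>Multiplication by a variable only shifts coefficients, so it is injective over any
  coefficient ring. This lets identities be checked for Euler operators and then divided by the
  variable.\<close>

lemma var_cancel:
  assumes "g \<in> carrier P" "h \<in> carrier P" "i \<le> d" "ps_var K d i \<otimes>\<^bsub>P\<^esub> g = ps_var K d i \<otimes>\<^bsub>P\<^esub> h"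
  shows "g = h"
proof (rule ps_eqI)
  fix m assume m: "m \<in> monomials d"
  show "g m = h m"
    using coeff_var_mult_shift[OF assms(1) m assms(3)] coeff_var_mult_shift[OF assms(2) m assms(3)] assms(4)
    by simp
qed (use assms in auto)

lemma ps_monom_mult:
  assumes "a \<in> monomials d" "b \<in> monomials d"
  shows "ps_monom a \<otimes>\<^bsub>P\<^esub> ps_monom b = ps_monom (\<lambda>i. a i + b i)"
proof (rule ps_eqI)
  fix m assume m: "m \<in> monomials d"
  have "m = (\<lambda>i. a i + b i) \<longleftrightarrow> a \<in> below m \<and> (\<lambda>i. m i - a i) = b"
    unfolding below_def fun_eq_iff mem_Collect_eq
    by (metis add_diff_cancel_left' le_add1 le_add_diff_inverse)
  then show "(ps_monom a \<otimes>\<^bsub>P\<^esub> ps_monom b) m = ps_monom (\<lambda>i. a i + b i) m"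
    using m by (auto simp: coeff_monom_mult coeff_monom monomials_diff)
qed auto

lemma ps_var_pow:
  assumes "i \<le> d"
  shows "ps_var K d i [^]\<^bsub>P\<^esub> (k::nat) = ps_monom (\<lambda>j. if j = i then k else 0)"
proof (induction k)
  case (Suc k)
  have "(\<lambda>j. (if j = i then k else 0) + unit_exp i j) = (\<lambda>j. if j = i then Suc k else 0)" by auto
  then show ?case
    using Suc ps_monom_mult[OF monomials_single[OF assms, of k] monomials_unit[OF assms]]
    by (simp add: ps_var_monom)
qed (simp add: ps_one_monom)

lemma coeff_finsum:
  assumes "g \<in> B \<rightarrow> carrier P" "m \<in> monomials d"
  shows "finsum P g B m = (\<Oplus>x\<in>B. g x m)"
  using assms
proof (induction B rule: infinite_finite_induct)
  case (insert x F)
  then show ?case by (simp add: Pi_def)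
qed auto

lemma coeff_uminus:
  assumes "g \<in> carrier P" "m \<in> monomials d"
  shows "(\<ominus>\<^bsub>P\<^esub> g) m = \<ominus> g m"
proof -
  have "g m \<oplus> (\<ominus>\<^bsub>P\<^esub> g) m = \<zero>"
    using P.r_neg[OF assms(1)] assms(2) coeff_add[OF assms(2), of g "\<ominus>\<^bsub>P\<^esub> g"] by simp
  then show ?thesis
    using assms minus_equality[of "(\<ominus>\<^bsub>P\<^esub> g) m" "g m"] a_comm[of "g m" "(\<ominus>\<^bsub>P\<^esub> g) m"] by simp
qed

lemma coeff_minus [simp]:
  "\<lbrakk>g \<in> carrier P; h \<in> carrier P; m \<in> monomials d\<rbrakk> \<Longrightarrow> (g \<ominus>\<^bsub>P\<^esub> h) m = g m \<ominus> h m"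
  by (simp add: P.minus_eq K.minus_eq coeff_uminus)

text \<open>Constants turn scalar multiplication into ring multiplication, so that linearity of a
  derivation over \<open>K\<close> becomes the condition that it kills constants.\<close>

definition ps_const :: "'a \<Rightarrow> (nat \<Rightarrow> nat) \<Rightarrow> 'a"
  where "ps_const c = c \<odot>\<^bsub>P\<^esub> \<one>\<^bsub>P\<^esub>"

lemma ps_const_closed [simp, intro]: "c \<in> carrier K \<Longrightarrow> ps_const c \<in> carrier P"
  unfolding ps_const_def by (simp add: ps_smult_closed)

lemma coeff_smult_mult:
  assumes "c \<in> carrier K" "g \<in> carrier P" "h \<in> carrier P"
  shows "(c \<odot>\<^bsub>P\<^esub> g) \<otimes>\<^bsub>P\<^esub> h = c \<odot>\<^bsub>P\<^esub> (g \<otimes>\<^bsub>P\<^esub> h)"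
proof (rule ps_eqI)
  fix m assume m: "m \<in> monomials d"
  have "c \<otimes> (\<Oplus>a\<in>below m. g a \<otimes> h (\<lambda>i. m i - a i)) = (\<Oplus>a\<in>below m. c \<otimes> (g a \<otimes> h (\<lambda>i. m i - a i)))"
    by (rule finsum_rdistr) (use assms m term_closed finite_below in auto)
  also have "\<dots> = (\<Oplus>a\<in>below m. (c \<odot>\<^bsub>P\<^esub> g) a \<otimes> h (\<lambda>i. m i - a i))"
    by (rule finsum_cong')
      (use assms m in \<open>auto simp: monomials_below[OF m] monomials_diff m_assoc\<close>)
  finally show "((c \<odot>\<^bsub>P\<^esub> g) \<otimes>\<^bsub>P\<^esub> h) m = (c \<odot>\<^bsub>P\<^esub> (g \<otimes>\<^bsub>P\<^esub> h)) m"
    using m by (simp add: coeff_mult)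
qed (use assms ps_smult_closed in auto)

lemma ps_smult_const: "\<lbrakk>c \<in> carrier K; g \<in> carrier P\<rbrakk> \<Longrightarrow> c \<odot>\<^bsub>P\<^esub> g = ps_const c \<otimes>\<^bsub>P\<^esub> g"
  unfolding ps_const_def by (simp add: coeff_smult_mult)

lemma coeff_const: "\<lbrakk>c \<in> carrier K; m \<in> monomials d\<rbrakk> \<Longrightarrow> ps_const c m = (if m = (\<lambda>_. 0) then c else \<zero>)"
  unfolding ps_const_def by (simp add: coeff_one)

lemma ps_const_mult: "\<lbrakk>a \<in> carrier K; b \<in> carrier K\<rbrakk> \<Longrightarrow> ps_const a \<otimes>\<^bsub>P\<^esub> ps_const b = ps_const (a \<otimes> b)"
  by (subst ps_smult_const[symmetric]) (auto intro!: ps_eqI simp: ps_smult_closed coeff_const)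

lemma ps_const_add: "\<lbrakk>a \<in> carrier K; b \<in> carrier K\<rbrakk> \<Longrightarrow> ps_const (a \<oplus> b) = ps_const a \<oplus>\<^bsub>P\<^esub> ps_const b"
  by (auto intro!: ps_eqI simp: coeff_const)

lemma ps_const_one: "ps_const \<one> = \<one>\<^bsub>P\<^esub>"
  by (auto intro!: ps_eqI simp: coeff_const coeff_one)

lemma ps_const_zero: "ps_const \<zero> = \<zero>\<^bsub>P\<^esub>"
  by (auto intro!: ps_eqI simp: coeff_const)

subsection \<open>Partial derivatives\<close>

definition ps_deriv :: "nat \<Rightarrow> ((nat \<Rightarrow> nat) \<Rightarrow> 'a) \<Rightarrow> (nat \<Rightarrow> nat) \<Rightarrow> 'a"
  where "ps_deriv i g = (\<lambda>m\<in>monomials d. [Suc (m i)] \<cdot>\<^bsub>K\<^esub> g (\<lambda>j. m j + unit_exp i j))"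

lemma coeff_deriv: "m \<in> monomials d \<Longrightarrow> ps_deriv i g m = [Suc (m i)] \<cdot>\<^bsub>K\<^esub> g (\<lambda>j. m j + unit_exp i j)"
  unfolding ps_deriv_def by simp

lemma ps_deriv_closed [simp]: "\<lbrakk>i \<le> d; g \<in> carrier P\<rbrakk> \<Longrightarrow> ps_deriv i g \<in> carrier P"
  unfolding ps_deriv_def
  by (rule ps_memI) (simp add: monomials_add_unit del: add.nat_pow_Suc)

lemma var_mult_deriv:
  assumes "i \<le> d" "g \<in> carrier P" "m \<in> monomials d"
  shows "(ps_var K d i \<otimes>\<^bsub>P\<^esub> ps_deriv i g) m = [m i] \<cdot>\<^bsub>K\<^esub> g m"
proof (cases "m i > 0")
  case True
  have "(\<lambda>j. m j - unit_exp i j) \<in> monomials d" by (rule monomials_diff[OF assms(3)])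
  then show ?thesis using True assms exp_diff_unit[of m i, OF True]
    by (simp add: coeff_var_mult coeff_deriv del: add.nat_pow_Suc)
qed (use assms in \<open>simp add: coeff_var_mult\<close>)

text \<open>The Leibniz rule is checked for the Euler operator \<open>z\<^sub>i \<partial>\<^sub>i\<close>, which only rescales
  coefficients; then \<open>z\<^sub>i\<close> is cancelled.\<close>

lemma ps_deriv_mult:
  assumes i: "i \<le> d" and g: "g \<in> carrier P" and h: "h \<in> carrier P"
  shows "ps_deriv i (g \<otimes>\<^bsub>P\<^esub> h) = g \<otimes>\<^bsub>P\<^esub> ps_deriv i h \<oplus>\<^bsub>P\<^esub> h \<otimes>\<^bsub>P\<^esub> ps_deriv i g"
proof (rule var_cancel[OF _ _ i])
  let ?z = "ps_var K d i" and ?d = "ps_deriv i"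
  have "?z \<otimes>\<^bsub>P\<^esub> ?d (g \<otimes>\<^bsub>P\<^esub> h) = g \<otimes>\<^bsub>P\<^esub> (?z \<otimes>\<^bsub>P\<^esub> ?d h) \<oplus>\<^bsub>P\<^esub> (?z \<otimes>\<^bsub>P\<^esub> ?d g) \<otimes>\<^bsub>P\<^esub> h"
  proof (rule ps_eqI)
    fix m assume m: "m \<in> monomials d"
    define t where "t = (\<lambda>a. g a \<otimes> h (\<lambda>j. m j - a j))"
    have t: "t a \<in> carrier K" if "a \<in> below m" for a
      unfolding t_def by (rule term_closed[OF g h m that])
    have "(?z \<otimes>\<^bsub>P\<^esub> ?d (g \<otimes>\<^bsub>P\<^esub> h)) m = [m i] \<cdot>\<^bsub>K\<^esub> (\<Oplus>a\<in>below m. t a)"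
      using i g h m by (simp add: var_mult_deriv) (simp add: coeff_mult t_def)
    also have "\<dots> = ([m i] \<cdot>\<^bsub>K\<^esub> \<one>) \<otimes> (\<Oplus>a\<in>below m. t a)"
      using t by (simp add: add_pow_ldistr Pi_def)
    also have "\<dots> = (\<Oplus>a\<in>below m. ([m i] \<cdot>\<^bsub>K\<^esub> \<one>) \<otimes> t a)"
      by (rule finsum_rdistr) (use t finite_below[OF m] in auto)
    also have "\<dots> = (\<Oplus>a\<in>below m. g a \<otimes> (?z \<otimes>\<^bsub>P\<^esub> ?d h) (\<lambda>j. m j - a j) \<oplus>
        (?z \<otimes>\<^bsub>P\<^esub> ?d g) a \<otimes> h (\<lambda>j. m j - a j))"
    proof (rule finsum_cong')
      fix a assume a: "a \<in> below m"
      then have mi: "m i = (m i - a i) + a i" unfolding below_def by auto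
      have ac: "a \<in> monomials d" "(\<lambda>j. m j - a j) \<in> monomials d"
        using monomials_below[OF m a] monomials_diff[OF m] by auto
      have "([m i] \<cdot>\<^bsub>K\<^esub> \<one>) \<otimes> t a = [m i] \<cdot>\<^bsub>K\<^esub> t a" using t[OF a] by (simp add: add_pow_ldistr)
      also have "\<dots> = [(m i - a i)] \<cdot>\<^bsub>K\<^esub> t a \<oplus> [(a i)] \<cdot>\<^bsub>K\<^esub> t a"
        using t[OF a] by (subst mi) (simp only: add.nat_pow_mult)
      finally show "([m i] \<cdot>\<^bsub>K\<^esub> \<one>) \<otimes> t a = g a \<otimes> (?z \<otimes>\<^bsub>P\<^esub> ?d h) (\<lambda>j. m j - a j) \<oplus>
        (?z \<otimes>\<^bsub>P\<^esub> ?d g) a \<otimes> h (\<lambda>j. m j - a j)"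
        using i g h ac by (simp add: var_mult_deriv t_def add_pow_ldistr add_pow_rdistr)
    qed (use i g h in \<open>auto simp: monomials_below[OF m] monomials_diff[OF m]\<close>)
    also have "\<dots> = (g \<otimes>\<^bsub>P\<^esub> (?z \<otimes>\<^bsub>P\<^esub> ?d h) \<oplus>\<^bsub>P\<^esub> (?z \<otimes>\<^bsub>P\<^esub> ?d g) \<otimes>\<^bsub>P\<^esub> h) m"
      unfolding coeff_add[OF m] coeff_mult[OF m, of g] coeff_mult[OF m, of "?z \<otimes>\<^bsub>P\<^esub> ?d g"]
      by (rule finsum_addf) (use i g h in \<open>auto simp: monomials_below[OF m] monomials_diff[OF m]\<close>)
    finally show "(?z \<otimes>\<^bsub>P\<^esub> ?d (g \<otimes>\<^bsub>P\<^esub> h)) m =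
      (g \<otimes>\<^bsub>P\<^esub> (?z \<otimes>\<^bsub>P\<^esub> ?d h) \<oplus>\<^bsub>P\<^esub> (?z \<otimes>\<^bsub>P\<^esub> ?d g) \<otimes>\<^bsub>P\<^esub> h) m" .
  qed (use i g h in auto)
  then show "?z \<otimes>\<^bsub>P\<^esub> ?d (g \<otimes>\<^bsub>P\<^esub> h) = ?z \<otimes>\<^bsub>P\<^esub> (g \<otimes>\<^bsub>P\<^esub> ?d h \<oplus>\<^bsub>P\<^esub> h \<otimes>\<^bsub>P\<^esub> ?d g)"
    using i g h by (simp add: P.r_distr P.m_ac)
qed (use i g h in auto)

lemma ps_deriv_derivation: "i \<le> d \<Longrightarrow> ring_derivation P (ps_deriv i)"
proof unfold_locales
  fix g h assume i: "i \<le> d" and g: "g \<in> carrier P" and h: "h \<in> carrier P"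
  show "ps_deriv i (g \<oplus>\<^bsub>P\<^esub> h) = ps_deriv i g \<oplus>\<^bsub>P\<^esub> ps_deriv i h"
    by (rule ps_eqI)
      (use i g h in \<open>auto simp: coeff_deriv monomials_add_unit add.nat_pow_distrib simp del: add.nat_pow_Suc\<close>)
qed (auto simp: ps_deriv_mult)

lemma ps_deriv_comm:
  assumes "i \<le> d" "j \<le> d" "g \<in> carrier P"
  shows "ps_deriv i (ps_deriv j g) = ps_deriv j (ps_deriv i g)"
proof (rule ps_eqI)
  fix m assume m: "m \<in> monomials d"
  have sw: "(\<lambda>k. m k + unit_exp j k + unit_exp i k) = (\<lambda>k. m k + unit_exp i k + unit_exp j k)"
    by auto
  show "ps_deriv i (ps_deriv j g) m = ps_deriv j (ps_deriv i g) m"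
    using assms m sw
    by (cases "i = j") (simp_all add: coeff_deriv monomials_add_unit add.nat_pow_pow mult.commute
        del: add.nat_pow_Suc)
qed (use assms in auto)

lemma ps_deriv_const: "c \<in> carrier K \<Longrightarrow> i \<le> d \<Longrightarrow> ps_deriv i (ps_const c) = \<zero>\<^bsub>P\<^esub>"
proof (rule ps_eqI)
  fix m assume a: "m \<in> monomials d" "c \<in> carrier K" "i \<le> d"
  have "(\<lambda>j. m j + unit_exp i j) \<noteq> (\<lambda>_. 0)" by (auto simp: fun_eq_iff)
  then show "ps_deriv i (ps_const c) m = \<zero>\<^bsub>P\<^esub> m"
    using a by (simp add: coeff_deriv coeff_const monomials_add_unit del: add.nat_pow_Suc)
qed auto

lemma ps_deriv_var:
  assumes "i \<le> d" "j \<le> d"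
  shows "ps_deriv i (ps_var K d j) = (if i = j then \<one>\<^bsub>P\<^esub> else \<zero>\<^bsub>P\<^esub>)"
proof (rule ps_eqI)
  fix m assume m: "m \<in> monomials d"
  have "(\<lambda>k. m k + unit_exp i k) = unit_exp j \<longleftrightarrow> i = j \<and> m = (\<lambda>_. 0)"
    by (auto simp: fun_eq_iff split: if_splits)
  then show "ps_deriv i (ps_var K d j) m = (if i = j then \<one>\<^bsub>P\<^esub> else \<zero>\<^bsub>P\<^esub>) m"
    using assms m by (auto simp: coeff_deriv ps_var_monom coeff_monom monomials_add_unit coeff_one)
qed (use assms in auto)

end

subsection \<open>Weighted orders\<close>

context power_series_ring
begin

text \<open>Weight zero is allowed. All weights 1 give the adic order used for convergence; weights
  that vanish on the last two variables give the order in the remaining ones, by which leading forms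
  are taken.\<close>

definition weight :: "(nat \<Rightarrow> nat) \<Rightarrow> (nat \<Rightarrow> nat) \<Rightarrow> nat"
  where "weight \<mu> m = (\<Sum>i\<le>d. \<mu> i * m i)"

definition ord_ge :: "(nat \<Rightarrow> nat) \<Rightarrow> nat \<Rightarrow> ((nat \<Rightarrow> nat) \<Rightarrow> 'a) set"
  where "ord_ge \<mu> n = {g \<in> carrier P. \<forall>m\<in>monomials d. weight \<mu> m < n \<longrightarrow> g m = \<zero>}"

lemma weight_zero [simp]: "weight \<mu> (\<lambda>_. 0) = 0"
  unfolding weight_def by simp

lemma weight_add: "weight \<mu> (\<lambda>i. a i + b i) = weight \<mu> a + weight \<mu> b"
  unfolding weight_def by (simp add: sum.distrib algebra_simps)

lemma weight_split: "a \<in> below m \<Longrightarrow> weight \<mu> m = weight \<mu> a + weight \<mu> (\<lambda>i. m i - a i)"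
  by (subst weight_add[symmetric]) (simp add: below_def)

lemma weight_unit: "i \<le> d \<Longrightarrow> weight \<mu> (unit_exp i) = \<mu> i"
  unfolding weight_def by (simp add: if_distrib sum.delta cong: if_cong)

lemma ord_geD: "\<lbrakk>g \<in> ord_ge \<mu> n; m \<in> monomials d; weight \<mu> m < n\<rbrakk> \<Longrightarrow> g m = \<zero>"
  unfolding ord_ge_def by auto

lemma ord_ge_carrier: "g \<in> ord_ge \<mu> n \<Longrightarrow> g \<in> carrier P"
  unfolding ord_ge_def by auto

lemma ord_geI:
  "\<lbrakk>g \<in> carrier P; \<And>m. \<lbrakk>m \<in> monomials d; weight \<mu> m < n\<rbrakk> \<Longrightarrow> g m = \<zero>\<rbrakk> \<Longrightarrow> g \<in> ord_ge \<mu> n"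
  unfolding ord_ge_def by auto

lemma ord_ge_0: "ord_ge \<mu> 0 = carrier P"
  unfolding ord_ge_def by auto

lemma ord_ge_antimono: "n \<le> k \<Longrightarrow> ord_ge \<mu> k \<subseteq> ord_ge \<mu> n"
  unfolding ord_ge_def by auto

lemma ord_ge_zero: "\<zero>\<^bsub>P\<^esub> \<in> ord_ge \<mu> n"
  by (rule ord_geI) auto

lemma ord_ge_add: "\<lbrakk>g \<in> ord_ge \<mu> n; h \<in> ord_ge \<mu> n\<rbrakk> \<Longrightarrow> g \<oplus>\<^bsub>P\<^esub> h \<in> ord_ge \<mu> n"
  by (rule ord_geI) (auto simp: ord_geD ord_ge_carrier)

lemma ord_ge_uminus: "g \<in> ord_ge \<mu> n \<Longrightarrow> \<ominus>\<^bsub>P\<^esub> g \<in> ord_ge \<mu> n"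
  by (rule ord_geI) (auto simp: ord_geD ord_ge_carrier coeff_uminus)

lemma ord_ge_minus: "\<lbrakk>g \<in> ord_ge \<mu> n; h \<in> ord_ge \<mu> n\<rbrakk> \<Longrightarrow> g \<ominus>\<^bsub>P\<^esub> h \<in> ord_ge \<mu> n"
  by (simp add: P.minus_eq ord_ge_add ord_ge_uminus)

lemma ord_ge_mult:
  assumes g: "g \<in> ord_ge \<mu> n" and h: "h \<in> ord_ge \<mu> k"
  shows "g \<otimes>\<^bsub>P\<^esub> h \<in> ord_ge \<mu> (n + k)"
proof (rule ord_geI)
  note gh = ord_ge_carrier[OF g] ord_ge_carrier[OF h]
  then show "g \<otimes>\<^bsub>P\<^esub> h \<in> carrier P" by simp
  fix m assume m: "m \<in> monomials d" and w: "weight \<mu> m < n + k"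
  show "(g \<otimes>\<^bsub>P\<^esub> h) m = \<zero>"
    unfolding coeff_mult[OF m]
  proof (rule finsum_all_zero)
    fix a assume a: "a \<in> below m"
    have c: "a \<in> monomials d" "(\<lambda>i. m i - a i) \<in> monomials d"
      using monomials_below[OF m a] monomials_diff[OF m] by auto
    have "weight \<mu> a < n \<or> weight \<mu> (\<lambda>i. m i - a i) < k"
      using w weight_split[OF a] by (metis add_less_cancel_left add_mono not_le)
    then show "g a \<otimes> h (\<lambda>i. m i - a i) = \<zero>"
      using ord_geD[OF g c(1)] ord_geD[OF h c(2)] c gh by auto
  qed
qed

lemma ord_ge_pow: "g \<in> ord_ge \<mu> n \<Longrightarrow> g [^]\<^bsub>P\<^esub> (k::nat) \<in> ord_ge \<mu> (n * k)"
proof (induction k)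
  case (Suc k)
  then show ?case using ord_ge_mult[of "g [^]\<^bsub>P\<^esub> k" \<mu> "n * k" g n] by (simp add: add.commute)
qed (simp add: ord_ge_0)

lemma ord_ge_ideal: "ideal (ord_ge \<mu> n) P"
proof (rule idealI)
  show "subgroup (ord_ge \<mu> n) (add_monoid P)"
    by (rule P.add.subgroupI)
      (use ord_ge_zero in \<open>auto simp: ord_ge_carrier ord_ge_add ord_ge_uminus\<close>)
  fix a x assume "a \<in> ord_ge \<mu> n" "x \<in> carrier P"
  then show "a \<otimes>\<^bsub>P\<^esub> x \<in> ord_ge \<mu> n" "x \<otimes>\<^bsub>P\<^esub> a \<in> ord_ge \<mu> n"
    using ord_ge_mult[of a \<mu> n x 0] ord_ge_mult[of x \<mu> 0 a n] by (auto simp: ord_ge_0)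
qed (rule P.ring_axioms)

lemma ord_ge_var: "i \<le> d \<Longrightarrow> ps_var K d i \<in> ord_ge \<mu> (\<mu> i)"
  by (rule ord_geI) (auto simp: ps_var_monom coeff_monom weight_unit)

text \<open>The additive form avoids truncated subtraction and covers variables of weight zero,
  where differentiation loses no order.\<close>

lemma ord_ge_deriv:
  assumes "i \<le> d" "g \<in> ord_ge \<mu> (n + \<mu> i)"
  shows "ps_deriv i g \<in> ord_ge \<mu> n"
proof (rule ord_geI)
  fix m assume m: "m \<in> monomials d" "weight \<mu> m < n"
  have "g (\<lambda>j. m j + unit_exp i j) = \<zero>"
    by (rule ord_geD[OF assms(2)]) (use m assms monomials_add_unit in \<open>auto simp: weight_add weight_unit\<close>)
  then show "ps_deriv i g m = \<zero>" using m by (simp add: coeff_deriv)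
qed (use assms ord_ge_carrier in auto)

lemma ord_ge_all_zero:
  assumes "\<And>n. g \<in> ord_ge \<mu> n"
  shows "g = \<zero>\<^bsub>P\<^esub>"
proof (rule ps_eqI)
  fix m assume m: "m \<in> monomials d"
  show "g m = \<zero>\<^bsub>P\<^esub> m" using ord_geD[OF assms[of "Suc (weight \<mu> m)"] m] m by simp
qed (use ord_ge_carrier[OF assms] in auto)

text \<open>A summand of order above the weight of \<open>m\<close> has no coefficient at
  \<open>m\<close>, so every coefficient of the infinite sum is a finite sum in
  \<open>K\<close>.\<close>

lemma ord_ge_complete:
  assumes c: "\<And>n::nat. c n \<in> ord_ge \<mu> n"
  shows "\<exists>s\<in>carrier P. \<forall>N. s \<ominus>\<^bsub>P\<^esub> (\<Oplus>\<^bsub>P\<^esub>n\<in>{..<N}. c n) \<in> ord_ge \<mu> N"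
proof -
  note cc = ord_ge_carrier[OF c]
  define s where "s = (\<lambda>m\<in>monomials d. \<Oplus>n\<in>{..weight \<mu> m}. c n m)"
  have s: "s \<in> carrier P"
    unfolding s_def by (rule ps_memI, rule finsum_closed) (simp add: Pi_def cc)
  have "s \<ominus>\<^bsub>P\<^esub> (\<Oplus>\<^bsub>P\<^esub>n\<in>{..<N}. c n) \<in> ord_ge \<mu> N" for N
  proof (rule ord_geI)
    fix m assume m: "m \<in> monomials d" and w: "weight \<mu> m < N"
    have "(\<Oplus>n\<in>{..weight \<mu> m}. c n m) = (\<Oplus>n\<in>{..<N}. c n m)"
      by (rule add.finprod_mono_neutral_cong_left) (use w ord_geD[OF c m] cc m in auto)
    then have "s m = (\<Oplus>\<^bsub>P\<^esub>n\<in>{..<N}. c n) m"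
      using m cc by (simp add: s_def coeff_finsum)
    then show "(s \<ominus>\<^bsub>P\<^esub> (\<Oplus>\<^bsub>P\<^esub>n\<in>{..<N}. c n)) m = \<zero>"
      using m s cc by (simp add: Pi_def K.minus_eq r_neg)
  qed (use s cc in \<open>auto simp: Pi_def\<close>)
  then show ?thesis using s by blast
qed

text \<open>Each monomial in the support is assigned to the first variable whose exponent is at least
  \<open>k\<close>.\<close>

lemma var_pow_decomposition:
  assumes g: "g \<in> carrier P"
    and supp: "\<And>m. \<lbrakk>m \<in> monomials d; g m \<noteq> \<zero>\<rbrakk> \<Longrightarrow> \<exists>i\<le>d. k \<le> m i"
  shows "\<exists>c\<in>{..d} \<rightarrow> carrier P. g = (\<Oplus>\<^bsub>P\<^esub>i\<in>{..d}. ps_var K d i [^]\<^bsub>P\<^esub> k \<otimes>\<^bsub>P\<^esub> c i)"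
proof -
  define e where "e = (\<lambda>i j. if j = (i::nat) then k else (0::nat))"
  define s where "s = (\<lambda>m. LEAST i. i \<le> d \<and> k \<le> m i)"
  define c where "c = (\<lambda>i. \<lambda>m\<in>monomials d. if s (\<lambda>j. m j + e i j) = i then g (\<lambda>j. m j + e i j) else \<zero>)"
  have em: "(\<lambda>j. m j + e i j) \<in> monomials d" if "m \<in> monomials d" "i \<le> d" for m i
    using monomials_add[OF that(1) monomials_single[OF that(2), of k]] by (simp add: e_def)
  have c: "c i \<in> carrier P" if "i \<le> d" for i
    unfolding c_def by (rule ps_memI) (use em[OF _ that] g in auto)
  have "g = (\<Oplus>\<^bsub>P\<^esub>i\<in>{..d}. ps_var K d i [^]\<^bsub>P\<^esub> k \<otimes>\<^bsub>P\<^esub> c i)"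
  proof (rule ps_eqI)
    fix m assume m: "m \<in> monomials d"
    have t: "(ps_var K d i [^]\<^bsub>P\<^esub> k \<otimes>\<^bsub>P\<^esub> c i) m = (if k \<le> m i \<and> s m = i then g m else \<zero>)"
      if i: "i \<le> d" for i
    proof -
      have b: "e i \<in> below m \<longleftrightarrow> k \<le> m i"
        unfolding below_def e_def by (auto dest: spec[of _ i])
      have vp: "ps_var K d i [^]\<^bsub>P\<^esub> k = ps_monom (e i)"
        using ps_var_pow[OF i] by (simp add: e_def)
      have cm: "c i (\<lambda>j. m j - e i j) = (if s m = i then g m else \<zero>)" if "k \<le> m i"
      proof -
        have "(\<lambda>j. m j - e i j + e i j) = m" using that by (auto simp: e_def)
        then show ?thesis using monomials_diff[OF m, of "e i"] by (simp add: c_def)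
      qed
      show ?thesis
        unfolding vp using coeff_monom_mult[OF c[OF i] m, of "e i"] b cm by auto
    qed
    have "(\<Oplus>\<^bsub>P\<^esub>i\<in>{..d}. ps_var K d i [^]\<^bsub>P\<^esub> k \<otimes>\<^bsub>P\<^esub> c i) m =
        (\<Oplus>i\<in>{..d}. (ps_var K d i [^]\<^bsub>P\<^esub> k \<otimes>\<^bsub>P\<^esub> c i) m)"
      by (rule coeff_finsum) (use c m in auto)
    also have "\<dots> = (\<Oplus>i\<in>{..d}. if k \<le> m i \<and> s m = i then g m else \<zero>)"
      by (rule finsum_cong') (use t g m in auto)
    also have "\<dots> = g m"
    proof (cases "g m = \<zero>")
      case True
      then show ?thesis by (auto intro!: finsum_all_zero)
    next
      case False
      then obtain i where "i \<le> d \<and> k \<le> m i" using supp[OF m] by blast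
      then have s: "s m \<le> d \<and> k \<le> m (s m)" unfolding s_def by (rule LeastI)
      then have "(\<Oplus>i\<in>{..d}. if k \<le> m i \<and> s m = i then g m else \<zero>) =
          (if k \<le> m (s m) \<and> s m = s m then g m else \<zero>)"
        by (intro finsum_eq_single) (use g m in auto)
      then show ?thesis using s by simp
    qed
    finally show "g m = (\<Oplus>\<^bsub>P\<^esub>i\<in>{..d}. ps_var K d i [^]\<^bsub>P\<^esub> k \<otimes>\<^bsub>P\<^esub> c i) m" ..
  qed (use g c in \<open>auto intro!: P.finsum_closed\<close>)
  then show ?thesis using c by (intro bexI[of _ c]) auto
qed

section \<open>The maximal ideal of the power series ring\<close>

definition max_ps where "max_ps = ord_ge (\<lambda>_. 1) 1"

lemma weight_one_eq_zero: "m \<in> monomials d \<Longrightarrow> weight (\<lambda>_. 1) m = 0 \<longleftrightarrow> m = (\<lambda>_. 0)"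
  unfolding weight_def monomials_def by (auto simp: fun_eq_iff not_le[symmetric])

lemma max_ps_iff: "g \<in> max_ps \<longleftrightarrow> g \<in> carrier P \<and> g (\<lambda>_. 0) = \<zero>"
proof
  assume g: "g \<in> max_ps"
  then have "g (\<lambda>_. 0) = \<zero>" unfolding max_ps_def by (intro ord_geD[of g]) auto
  then show "g \<in> carrier P \<and> g (\<lambda>_. 0) = \<zero>" using g ord_ge_carrier by (auto simp: max_ps_def)
next
  assume g: "g \<in> carrier P \<and> g (\<lambda>_. 0) = \<zero>"
  have "g m = \<zero>" if "m \<in> monomials d" "weight (\<lambda>_. 1) m < 1" for m
    using g weight_one_eq_zero[OF that(1)] that(2) by simp
  then show "g \<in> max_ps" unfolding max_ps_def using g by (intro ord_geI) auto
qed

lemma max_ps_carrier: "g \<in> max_ps \<Longrightarrow> g \<in> carrier P"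
  by (simp add: max_ps_iff)

lemma max_ps_ideal: "ideal max_ps P"
  unfolding max_ps_def by (rule ord_ge_ideal)

lemma coeff_mult_0:
  assumes "g \<in> carrier P" "h \<in> carrier P"
  shows "(g \<otimes>\<^bsub>P\<^esub> h) (\<lambda>_. 0) = g (\<lambda>_. 0) \<otimes> h (\<lambda>_. 0)"
proof -
  have "below (\<lambda>_. 0) = {\<lambda>_. 0}" unfolding below_def by auto
  then show ?thesis using assms by (simp add: coeff_mult)
qed

text \<open>Pigeonhole: total degree at least \<open>Suc d * k\<close> in \<open>d + 1\<close>
  variables forces some exponent to be at least \<open>k\<close>.\<close>

lemma ord_ge_one_decomposition:
  assumes "g \<in> ord_ge (\<lambda>_. 1) (Suc d * k)"
  shows "\<exists>c\<in>{..d} \<rightarrow> carrier P. g = (\<Oplus>\<^bsub>P\<^esub>i\<in>{..d}. ps_var K d i [^]\<^bsub>P\<^esub> k \<otimes>\<^bsub>P\<^esub> c i)"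
proof (rule var_pow_decomposition)
  show "g \<in> carrier P" by (rule ord_ge_carrier[OF assms])
  fix m assume m: "m \<in> monomials d" "g m \<noteq> \<zero>"
  then have w: "Suc d * k \<le> weight (\<lambda>_. 1) m" using ord_geD[OF assms m(1)] by (meson not_le)
  show "\<exists>i\<le>d. k \<le> m i"
  proof (cases "k = 0")
    case False
    show ?thesis
    proof (rule ccontr)
      assume "\<not> ?thesis"
      then have "m i < k" if "i \<le> d" for i using that not_le by blast
      then have "weight (\<lambda>_. 1) m < (\<Sum>i\<le>d. k)"
        unfolding weight_def by (intro sum_strict_mono) auto
      then show False using w by simp
    qed
  qed auto
qed

end

section \<open>Coefficients in a field of characteristic zero: units and primality\<close>

locale power_series_field = power_series_ring +
  assumes K_field: "field K"
    and char_zero: "(n::nat) > 0 \<Longrightarrow> [n] \<cdot>\<^bsub>K\<^esub> \<one> \<noteq> \<zero>"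

sublocale power_series_field \<subseteq> K?: field K
  by (rule K_field)

context power_series_field
begin

lemma nat_multiple_eq_zero: "\<lbrakk>(n::nat) > 0; a \<in> carrier K; [n] \<cdot>\<^bsub>K\<^esub> a = \<zero>\<rbrakk> \<Longrightarrow> a = \<zero>"
  using char_zero[of n] add_pow_ldistr[of \<one> a n] integral[of "[n] \<cdot>\<^bsub>K\<^esub> \<one>" a] by simp

lemma geometric_series:
  assumes b: "b \<in> max_ps"
  shows "\<exists>s\<in>carrier P. (\<one>\<^bsub>P\<^esub> \<ominus>\<^bsub>P\<^esub> b) \<otimes>\<^bsub>P\<^esub> s = \<one>\<^bsub>P\<^esub>"
proof -
  note bc = max_ps_carrier[OF b]
  have bn: "b [^]\<^bsub>P\<^esub> n \<in> ord_ge (\<lambda>_. 1) n" for n :: nat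
    using ord_ge_pow[OF b[unfolded max_ps_def], of n] by simp
  obtain s where s: "s \<in> carrier P"
    "\<And>N. s \<ominus>\<^bsub>P\<^esub> (\<Oplus>\<^bsub>P\<^esub>n\<in>{..<N}. b [^]\<^bsub>P\<^esub> n) \<in> ord_ge (\<lambda>_. 1) N"
    using ord_ge_complete[OF bn] by blast
  have tel: "(\<one>\<^bsub>P\<^esub> \<ominus>\<^bsub>P\<^esub> b) \<otimes>\<^bsub>P\<^esub> (\<Oplus>\<^bsub>P\<^esub>n\<in>{..<N}. b [^]\<^bsub>P\<^esub> n) = \<one>\<^bsub>P\<^esub> \<ominus>\<^bsub>P\<^esub> b [^]\<^bsub>P\<^esub> N" for N :: nat
  proof (induction N)
    case 0
    show ?case using bc by (simp add: P.minus_eq P.r_neg)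
  next
    case (Suc N)
    define S where "S = (\<Oplus>\<^bsub>P\<^esub>n\<in>{..<N}. b [^]\<^bsub>P\<^esub> n)"
    have S: "S \<in> carrier P" "b [^]\<^bsub>P\<^esub> N \<in> carrier P" using bc by (auto simp: S_def intro!: P.finsum_closed)
    have "(\<Oplus>\<^bsub>P\<^esub>n\<in>{..<Suc N}. b [^]\<^bsub>P\<^esub> n) = b [^]\<^bsub>P\<^esub> N \<oplus>\<^bsub>P\<^esub> S"
      unfolding S_def using bc by (simp add: lessThan_Suc Pi_def)
    then have "(\<one>\<^bsub>P\<^esub> \<ominus>\<^bsub>P\<^esub> b) \<otimes>\<^bsub>P\<^esub> (\<Oplus>\<^bsub>P\<^esub>n\<in>{..<Suc N}. b [^]\<^bsub>P\<^esub> n) =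
       (\<one>\<^bsub>P\<^esub> \<ominus>\<^bsub>P\<^esub> b) \<otimes>\<^bsub>P\<^esub> b [^]\<^bsub>P\<^esub> N \<oplus>\<^bsub>P\<^esub> (\<one>\<^bsub>P\<^esub> \<ominus>\<^bsub>P\<^esub> b [^]\<^bsub>P\<^esub> N)"
      using S bc Suc S_def by (simp add: P.r_distr)
    also have "\<dots> = \<one>\<^bsub>P\<^esub> \<ominus>\<^bsub>P\<^esub> b [^]\<^bsub>P\<^esub> N \<otimes>\<^bsub>P\<^esub> b"
      using S bc by (simp add: P.ring_simprules P.cring_simprules)
    finally show ?case by simp
  qed
  have "(\<one>\<^bsub>P\<^esub> \<ominus>\<^bsub>P\<^esub> b) \<otimes>\<^bsub>P\<^esub> s \<ominus>\<^bsub>P\<^esub> \<one>\<^bsub>P\<^esub> \<in> ord_ge (\<lambda>_. 1) N" for N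
  proof -
    interpret O: ideal "ord_ge (\<lambda>_. 1) N" P by (rule ord_ge_ideal)
    define S where "S = (\<Oplus>\<^bsub>P\<^esub>n\<in>{..<N}. b [^]\<^bsub>P\<^esub> n)"
    have S: "S \<in> carrier P" "b [^]\<^bsub>P\<^esub> N \<in> carrier P" using bc by (auto simp: S_def intro!: P.finsum_closed)
    have "(\<one>\<^bsub>P\<^esub> \<ominus>\<^bsub>P\<^esub> b) \<otimes>\<^bsub>P\<^esub> s = (\<one>\<^bsub>P\<^esub> \<ominus>\<^bsub>P\<^esub> b) \<otimes>\<^bsub>P\<^esub> (s \<ominus>\<^bsub>P\<^esub> S) \<oplus>\<^bsub>P\<^esub> (\<one>\<^bsub>P\<^esub> \<ominus>\<^bsub>P\<^esub> b) \<otimes>\<^bsub>P\<^esub> S"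
      using S bc s(1) by (simp add: P.ring_simprules P.cring_simprules)
    also have "\<dots> = (\<one>\<^bsub>P\<^esub> \<ominus>\<^bsub>P\<^esub> b) \<otimes>\<^bsub>P\<^esub> (s \<ominus>\<^bsub>P\<^esub> S) \<oplus>\<^bsub>P\<^esub> (\<one>\<^bsub>P\<^esub> \<ominus>\<^bsub>P\<^esub> b [^]\<^bsub>P\<^esub> N)"
      using tel S_def by simp
    finally have e: "(\<one>\<^bsub>P\<^esub> \<ominus>\<^bsub>P\<^esub> b) \<otimes>\<^bsub>P\<^esub> s =
       (\<one>\<^bsub>P\<^esub> \<ominus>\<^bsub>P\<^esub> b) \<otimes>\<^bsub>P\<^esub> (s \<ominus>\<^bsub>P\<^esub> S) \<oplus>\<^bsub>P\<^esub> (\<one>\<^bsub>P\<^esub> \<ominus>\<^bsub>P\<^esub> b [^]\<^bsub>P\<^esub> N)" .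
    define Y where "Y = (\<one>\<^bsub>P\<^esub> \<ominus>\<^bsub>P\<^esub> b) \<otimes>\<^bsub>P\<^esub> (s \<ominus>\<^bsub>P\<^esub> S)"
    have "Y \<in> carrier P" using S bc s(1) by (simp add: Y_def)
    then have "(\<one>\<^bsub>P\<^esub> \<ominus>\<^bsub>P\<^esub> b) \<otimes>\<^bsub>P\<^esub> s \<ominus>\<^bsub>P\<^esub> \<one>\<^bsub>P\<^esub> = Y \<ominus>\<^bsub>P\<^esub> b [^]\<^bsub>P\<^esub> N"
      unfolding e Y_def[symmetric] using S by (simp add: P.ring_simprules)
    moreover have "Y \<in> ord_ge (\<lambda>_. 1) N"
      unfolding Y_def by (rule O.I_l_closed) (use s(2)[of N] bc in \<open>auto simp: S_def\<close>)
    ultimately show ?thesis using ord_ge_minus bn by simp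
  qed
  then have "(\<one>\<^bsub>P\<^esub> \<ominus>\<^bsub>P\<^esub> b) \<otimes>\<^bsub>P\<^esub> s \<ominus>\<^bsub>P\<^esub> \<one>\<^bsub>P\<^esub> = \<zero>\<^bsub>P\<^esub>" by (rule ord_ge_all_zero)
  then show ?thesis using s(1) bc by (auto intro!: bexI[of _ s])
qed

text \<open>Scaling by the inverse of the constant term brings the series to the form
  \<open>1 - b\<close> with \<open>b\<close> in the maximal ideal, where the geometric series is an
  inverse.\<close>

lemma unit_outside_max_ps:
  assumes a: "a \<in> carrier P" "a \<notin> max_ps"
  shows "\<exists>s\<in>carrier P. a \<otimes>\<^bsub>P\<^esub> s = \<one>\<^bsub>P\<^esub>"
proof -
  define c where "c = inv (a (\<lambda>_. 0))"
  have a0: "a (\<lambda>_. 0) \<noteq> \<zero>" "a (\<lambda>_. 0) \<in> carrier K" using a max_ps_iff by auto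
  then have c: "c \<in> carrier K" "a (\<lambda>_. 0) \<otimes> c = \<one>"
    using field_Units by (auto simp: c_def)
  define b where "b = \<one>\<^bsub>P\<^esub> \<ominus>\<^bsub>P\<^esub> a \<otimes>\<^bsub>P\<^esub> ps_const c"
  have "b (\<lambda>_. 0) = \<zero>"
    using a c by (simp add: b_def coeff_mult_0 coeff_const coeff_one K.minus_eq r_neg)
  then have "b \<in> max_ps" using a c by (simp add: max_ps_iff b_def)
  then obtain s where s: "s \<in> carrier P" "(\<one>\<^bsub>P\<^esub> \<ominus>\<^bsub>P\<^esub> b) \<otimes>\<^bsub>P\<^esub> s = \<one>\<^bsub>P\<^esub>"
    using geometric_series by blast
  moreover have "\<one>\<^bsub>P\<^esub> \<ominus>\<^bsub>P\<^esub> b = a \<otimes>\<^bsub>P\<^esub> ps_const c"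
    using a c by (simp add: b_def P.minus_eq P.minus_add P.r_neg2)
  ultimately have "a \<otimes>\<^bsub>P\<^esub> (ps_const c \<otimes>\<^bsub>P\<^esub> s) = \<one>\<^bsub>P\<^esub>" using a c by (simp add: P.m_assoc)
  then show ?thesis using c s by (intro bexI[of _ "ps_const c \<otimes>\<^bsub>P\<^esub> s"]) auto
qed

lemma max_ps_prime: "primeideal max_ps P"
proof (rule primeidealI[OF max_ps_ideal])
  show "cring P" ..
  have "\<one>\<^bsub>P\<^esub> \<notin> max_ps" by (simp add: max_ps_iff coeff_one)
  then show "carrier P \<noteq> max_ps" by blast
  fix a b assume "a \<in> carrier P" "b \<in> carrier P" "a \<otimes>\<^bsub>P\<^esub> b \<in> max_ps"
  then show "a \<in> max_ps \<or> b \<in> max_ps"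
    by (simp add: max_ps_iff coeff_mult_0 integral_iff)
qed

lemma coeff_nat_multiple: "\<lbrakk>g \<in> carrier P; m \<in> monomials d\<rbrakk> \<Longrightarrow> ([(n::nat)] \<cdot>\<^bsub>P\<^esub> g) m = [n] \<cdot>\<^bsub>K\<^esub> g m"
  by (induction n) auto

lemma nat_multiple_one_notin_max_ps: "n > 0 \<Longrightarrow> [(n::nat)] \<cdot>\<^bsub>P\<^esub> \<one>\<^bsub>P\<^esub> \<notin> max_ps"
  using char_zero[of n] by (simp add: max_ps_iff coeff_nat_multiple coeff_one)

end

section \<open>Finitely generated modules\<close>

context module
begin

lemma smult_lcomm:
  "\<lbrakk>a \<in> carrier R; b \<in> carrier R; x \<in> carrier M\<rbrakk> \<Longrightarrow> a \<odot>\<^bsub>M\<^esub> (b \<odot>\<^bsub>M\<^esub> x) = b \<odot>\<^bsub>M\<^esub> (a \<odot>\<^bsub>M\<^esub> x)"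
  by (simp add: smult_assoc1[symmetric] R.m_comm)

lemma submodule_carrier: "submodule (carrier M) R M"
  by (rule submoduleI) auto

lemma submodule_zero: "submodule N R M \<Longrightarrow> \<zero>\<^bsub>M\<^esub> \<in> N"
  using subgroup.one_closed[OF submodule.axioms(1)] by fastforce

lemma module_span_submodule: "S \<subseteq> carrier M \<Longrightarrow> submodule (module_span R M S) R M"
  using submodule_carrier unfolding module_span_def
  by (intro submoduleI) (auto intro: submodule_zero submoduleE(3-5))

lemma module_span_superset: "S \<subseteq> module_span R M S"
  unfolding module_span_def by auto

lemma module_span_minimal: "\<lbrakk>submodule N R M; S \<subseteq> N\<rbrakk> \<Longrightarrow> module_span R M S \<subseteq> N"
  unfolding module_span_def by auto

lemma submodule_finsum:
  assumes "submodule N R M" "g \<in> S \<rightarrow> N"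
  shows "finsum M g S \<in> N"
  using assms(2)
proof (induction S rule: infinite_finite_induct)
  case (insert x F)
  then have "g \<in> F \<rightarrow> carrier M" "g x \<in> carrier M" using submoduleE(1)[OF assms(1)] by auto
  then show ?case using insert submoduleE(5)[OF assms(1)] by (simp add: Pi_def)
qed (auto simp: submodule_zero[OF assms(1)])

lemma finsum_comb_add:
  assumes "c \<in> S \<rightarrow> carrier R" "e \<in> S \<rightarrow> carrier R" "S \<subseteq> carrier M"
  shows "(\<Oplus>\<^bsub>M\<^esub>s\<in>S. (c s \<oplus> e s) \<odot>\<^bsub>M\<^esub> s) = (\<Oplus>\<^bsub>M\<^esub>s\<in>S. c s \<odot>\<^bsub>M\<^esub> s) \<oplus>\<^bsub>M\<^esub> (\<Oplus>\<^bsub>M\<^esub>s\<in>S. e s \<odot>\<^bsub>M\<^esub> s)"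
proof -
  have "(\<Oplus>\<^bsub>M\<^esub>s\<in>S. (c s \<oplus> e s) \<odot>\<^bsub>M\<^esub> s) = (\<Oplus>\<^bsub>M\<^esub>s\<in>S. c s \<odot>\<^bsub>M\<^esub> s \<oplus>\<^bsub>M\<^esub> e s \<odot>\<^bsub>M\<^esub> s)"
    by (rule M.finsum_cong') (use assms in \<open>auto simp: smult_l_distr Pi_def subset_iff\<close>)
  also have "\<dots> = (\<Oplus>\<^bsub>M\<^esub>s\<in>S. c s \<odot>\<^bsub>M\<^esub> s) \<oplus>\<^bsub>M\<^esub> (\<Oplus>\<^bsub>M\<^esub>s\<in>S. e s \<odot>\<^bsub>M\<^esub> s)"
    by (rule M.finsum_addf) (use assms in \<open>auto simp: Pi_def subset_iff\<close>)
  finally show ?thesis .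
qed

lemma finsum_comb_smult:
  assumes "finite S" "c \<in> S \<rightarrow> carrier R" "a \<in> carrier R" "S \<subseteq> carrier M"
  shows "(\<Oplus>\<^bsub>M\<^esub>s\<in>S. (a \<otimes> c s) \<odot>\<^bsub>M\<^esub> s) = a \<odot>\<^bsub>M\<^esub> (\<Oplus>\<^bsub>M\<^esub>s\<in>S. c s \<odot>\<^bsub>M\<^esub> s)"
proof -
  have "(\<Oplus>\<^bsub>M\<^esub>s\<in>S. (a \<otimes> c s) \<odot>\<^bsub>M\<^esub> s) = (\<Oplus>\<^bsub>M\<^esub>s\<in>S. a \<odot>\<^bsub>M\<^esub> (c s \<odot>\<^bsub>M\<^esub> s))"
    by (rule M.finsum_cong') (use assms in \<open>auto simp: smult_assoc1 Pi_def subset_iff\<close>)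
  also have "\<dots> = a \<odot>\<^bsub>M\<^esub> (\<Oplus>\<^bsub>M\<^esub>s\<in>S. c s \<odot>\<^bsub>M\<^esub> s)"
    by (rule finsum_smult_ldistr[symmetric]) (use assms in \<open>auto simp: Pi_def subset_iff\<close>)
  finally show ?thesis .
qed

lemma comb_closed: "\<lbrakk>c \<in> S \<rightarrow> carrier R; S \<subseteq> carrier M\<rbrakk> \<Longrightarrow> (\<Oplus>\<^bsub>M\<^esub>s\<in>S. c s \<odot>\<^bsub>M\<^esub> s) \<in> carrier M"
  by (rule M.finsum_closed) (auto simp: Pi_def subset_iff)

text \<open>With \<open>J\<close> the whole ring this describes the span of \<open>S\<close>; when
  \<open>S\<close> generates \<open>M\<close> it describes \<open>J M\<close> with one coefficient
  per generator.\<close>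

lemma ideal_comb_submodule:
  assumes S: "finite S" "S \<subseteq> carrier M" and J: "ideal J R"
  shows "submodule {\<Oplus>\<^bsub>M\<^esub>s\<in>S. c s \<odot>\<^bsub>M\<^esub> s | c. c \<in> S \<rightarrow> J} R M"
proof -
  interpret J: ideal J R by fact
  have JR: "c \<in> S \<rightarrow> carrier R" if "c \<in> S \<rightarrow> J" for c using that by (auto intro!: J.Icarr)
  have sm: "a \<odot>\<^bsub>M\<^esub> x \<in> {\<Oplus>\<^bsub>M\<^esub>s\<in>S. c s \<odot>\<^bsub>M\<^esub> s | c. c \<in> S \<rightarrow> J}"
    if a: "a \<in> carrier R" and x: "x \<in> {\<Oplus>\<^bsub>M\<^esub>s\<in>S. c s \<odot>\<^bsub>M\<^esub> s | c. c \<in> S \<rightarrow> J}" for a x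
  proof -
    obtain c where c: "c \<in> S \<rightarrow> J" "x = (\<Oplus>\<^bsub>M\<^esub>s\<in>S. c s \<odot>\<^bsub>M\<^esub> s)" using x by auto
    have "a \<odot>\<^bsub>M\<^esub> x = (\<Oplus>\<^bsub>M\<^esub>s\<in>S. (a \<otimes> c s) \<odot>\<^bsub>M\<^esub> s)"
      unfolding c(2) by (rule finsum_comb_smult[symmetric]) (use S a JR[OF c(1)] in auto)
    then show ?thesis using a c(1) J.I_l_closed by (intro CollectI exI[of _ "\<lambda>s. a \<otimes> c s"]) auto
  qed
  have car: "{\<Oplus>\<^bsub>M\<^esub>s\<in>S. c s \<odot>\<^bsub>M\<^esub> s | c. c \<in> S \<rightarrow> J} \<subseteq> carrier M"
    using comb_closed[OF JR S(2)] by auto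
  show ?thesis
  proof (rule submoduleI[OF car])
    have "(\<Oplus>\<^bsub>M\<^esub>s\<in>S. \<zero> \<odot>\<^bsub>M\<^esub> s) = \<zero>\<^bsub>M\<^esub>"
      by (rule M.add.finprod_one_eqI) (use S in auto)
    then show "\<zero>\<^bsub>M\<^esub> \<in> {\<Oplus>\<^bsub>M\<^esub>s\<in>S. c s \<odot>\<^bsub>M\<^esub> s | c. c \<in> S \<rightarrow> J}"
      using J.zero_closed by (intro CollectI exI[of _ "\<lambda>s. \<zero>"]) auto
    fix x y assume x: "x \<in> {\<Oplus>\<^bsub>M\<^esub>s\<in>S. c s \<odot>\<^bsub>M\<^esub> s | c. c \<in> S \<rightarrow> J}"
    have "\<ominus>\<^bsub>M\<^esub> x = (\<ominus> \<one>) \<odot>\<^bsub>M\<^esub> x" using x car by (auto simp: smult_l_minus)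
    then show "\<ominus>\<^bsub>M\<^esub> x \<in> {\<Oplus>\<^bsub>M\<^esub>s\<in>S. c s \<odot>\<^bsub>M\<^esub> s | c. c \<in> S \<rightarrow> J}"
      using sm[OF _ x, of "\<ominus> \<one>"] by simp
    assume y: "y \<in> {\<Oplus>\<^bsub>M\<^esub>s\<in>S. c s \<odot>\<^bsub>M\<^esub> s | c. c \<in> S \<rightarrow> J}"
    obtain c e where c: "c \<in> S \<rightarrow> J" "x = (\<Oplus>\<^bsub>M\<^esub>s\<in>S. c s \<odot>\<^bsub>M\<^esub> s)"
      and e: "e \<in> S \<rightarrow> J" "y = (\<Oplus>\<^bsub>M\<^esub>s\<in>S. e s \<odot>\<^bsub>M\<^esub> s)" using x y by blast
    have "x \<oplus>\<^bsub>M\<^esub> y = (\<Oplus>\<^bsub>M\<^esub>s\<in>S. (c s \<oplus> e s) \<odot>\<^bsub>M\<^esub> s)"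
      unfolding c(2) e(2) by (rule finsum_comb_add[symmetric]) (use S JR c(1) e(1) in auto)
    then show "x \<oplus>\<^bsub>M\<^esub> y \<in> {\<Oplus>\<^bsub>M\<^esub>s\<in>S. c s \<odot>\<^bsub>M\<^esub> s | c. c \<in> S \<rightarrow> J}"
      using c(1) e(1) J.a_closed by (intro CollectI exI[of _ "\<lambda>s. c s \<oplus> e s"]) auto
  qed (rule sm)
qed

lemma comb_single:
  assumes "finite S" "s \<in> S" "S \<subseteq> carrier M" "a \<in> carrier R"
  shows "(\<Oplus>\<^bsub>M\<^esub>t\<in>S. (if t = s then a else \<zero>) \<odot>\<^bsub>M\<^esub> t) = a \<odot>\<^bsub>M\<^esub> s"
proof -
  have "(\<Oplus>\<^bsub>M\<^esub>t\<in>S. (if t = s then a else \<zero>) \<odot>\<^bsub>M\<^esub> t) = (if s = s then a else \<zero>) \<odot>\<^bsub>M\<^esub> s"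
    by (rule M.finsum_eq_single) (use assms in auto)
  then show ?thesis by simp
qed

lemma module_span_finite:
  assumes S: "finite S" "S \<subseteq> carrier M"
  shows "module_span R M S = {\<Oplus>\<^bsub>M\<^esub>s\<in>S. c s \<odot>\<^bsub>M\<^esub> s | c. c \<in> S \<rightarrow> carrier R}" (is "_ = ?N")
proof
  have "S \<subseteq> ?N"
  proof
    fix s assume s: "s \<in> S"
    then show "s \<in> ?N"
      using comb_single[OF S(1) s S(2), of \<one>] S
      by (intro CollectI exI[of _ "\<lambda>t. if t = s then \<one> else \<zero>"]) auto
  qed
  then show "module_span R M S \<subseteq> ?N"
    by (rule module_span_minimal[OF ideal_comb_submodule[OF S R.oneideal]])
  have sub: "submodule (module_span R M S) R M" by (rule module_span_submodule[OF S(2)])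
  show "?N \<subseteq> module_span R M S"
    using module_span_superset[of S] by (auto intro!: submodule_finsum[OF sub] submoduleE(4)[OF sub])
qed

text \<open>The first syzygies of \<open>S\<close>. Values outside \<open>S\<close> are
  unconstrained, so only the restriction to \<open>S\<close> carries meaning.\<close>

definition relations :: "'c set \<Rightarrow> ('c \<Rightarrow> 'a) set"
  where "relations S = {c \<in> S \<rightarrow> carrier R. (\<Oplus>\<^bsub>M\<^esub>s\<in>S. c s \<odot>\<^bsub>M\<^esub> s) = \<zero>\<^bsub>M\<^esub>}"

lemma minimal_generators:
  assumes fg: "finitely_generated R M" and m: "ideal m R"
    and local: "\<And>a. \<lbrakk>a \<in> carrier R; a \<notin> m\<rbrakk> \<Longrightarrow> a \<in> Units R"
  shows "\<exists>S. finite S \<and> S \<subseteq> carrier M \<and> module_span R M S = carrier M \<and>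
    (\<forall>c\<in>relations S. \<forall>s\<in>S. c s \<in> m)"
proof -
  define gen where "gen = (\<lambda>S. finite S \<and> S \<subseteq> carrier M \<and> module_span R M S = carrier M)"
  obtain S0 where S0: "gen S0" using fg unfolding finitely_generated_def gen_def by blast
  obtain S where S: "gen S" and min: "\<And>T. gen T \<Longrightarrow> card S \<le> card T"
    using ex_has_least_nat[of gen S0 card, OF S0] by auto
  have fin: "finite S" "S \<subseteq> carrier M" "module_span R M S = carrier M" using S gen_def by auto
  have "c s \<in> m" if c: "c \<in> relations S" and s: "s \<in> S" for c s
  proof (rule ccontr)
    assume "c s \<notin> m"
    have cS: "c \<in> S \<rightarrow> carrier R" using c by (auto simp: relations_def)
    have u: "c s \<in> Units R" using local \<open>c s \<notin> m\<close> cS s by auto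
    let ?T = "S - {s}"
    have sub: "submodule (module_span R M ?T) R M" by (rule module_span_submodule) (use fin in auto)
    have inT: "t \<in> module_span R M ?T" if "t \<in> ?T" for t
      by (rule subsetD[OF module_span_superset that])
    let ?r = "\<Oplus>\<^bsub>M\<^esub>t\<in>?T. c t \<odot>\<^bsub>M\<^esub> t"
    have r: "?r \<in> module_span R M ?T"
      by (rule submodule_finsum[OF sub]) (use inT cS in \<open>auto intro!: submoduleE(4)[OF sub]\<close>)
    have rc: "?r \<in> carrier M" using r submoduleE(1)[OF sub] by auto
    have sc: "s \<in> carrier M" "c s \<in> carrier R" using s fin cS by auto
    have "(\<Oplus>\<^bsub>M\<^esub>t\<in>insert s ?T. c t \<odot>\<^bsub>M\<^esub> t) = c s \<odot>\<^bsub>M\<^esub> s \<oplus>\<^bsub>M\<^esub> ?r"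
      by (rule M.finsum_insert) (use fin sc cS in auto)
    then have "c s \<odot>\<^bsub>M\<^esub> s \<oplus>\<^bsub>M\<^esub> ?r = \<zero>\<^bsub>M\<^esub>" using c s by (simp add: relations_def insert_absorb)
    then have "c s \<odot>\<^bsub>M\<^esub> s = \<ominus>\<^bsub>M\<^esub> ?r" using sc rc by (simp add: M.minus_equality)
    then have "c s \<odot>\<^bsub>M\<^esub> s \<in> module_span R M ?T" using submoduleE(3)[OF sub r] by simp
    then have "inv (c s) \<odot>\<^bsub>M\<^esub> (c s \<odot>\<^bsub>M\<^esub> s) \<in> module_span R M ?T"
      by (rule submoduleE(4)[OF sub, rotated]) (use u in auto)
    moreover have "inv (c s) \<odot>\<^bsub>M\<^esub> (c s \<odot>\<^bsub>M\<^esub> s) = s"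
      using u sc by (simp add: smult_assoc1[symmetric])
    ultimately have "s \<in> module_span R M ?T" by simp
    then have "S \<subseteq> module_span R M ?T" using inT by blast
    then have "carrier M \<subseteq> module_span R M ?T" using module_span_minimal[OF sub] fin by blast
    then have "gen ?T" using submoduleE(1)[OF sub] fin unfolding gen_def by auto
    then show False using min s fin(1) by (metis card_Diff1_less not_le)
  qed
  then show ?thesis using fin by blast
qed

lemma smult_in_ideal_comb:
  assumes S: "finite S" "S \<subseteq> carrier M" "module_span R M S = carrier M"
    and J: "ideal J R" and j: "j \<in> J" and x: "x \<in> carrier M"
  shows "j \<odot>\<^bsub>M\<^esub> x \<in> {\<Oplus>\<^bsub>M\<^esub>s\<in>S. c s \<odot>\<^bsub>M\<^esub> s | c. c \<in> S \<rightarrow> J}"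
proof -
  interpret J: ideal J R by fact
  obtain c where c: "c \<in> S \<rightarrow> carrier R" "x = (\<Oplus>\<^bsub>M\<^esub>s\<in>S. c s \<odot>\<^bsub>M\<^esub> s)"
    using x S(3) unfolding module_span_finite[OF S(1,2)] by blast
  have "j \<odot>\<^bsub>M\<^esub> x = (\<Oplus>\<^bsub>M\<^esub>s\<in>S. (j \<otimes> c s) \<odot>\<^bsub>M\<^esub> s)"
    unfolding c(2) by (rule finsum_comb_smult[symmetric]) (use S c j J.Icarr in auto)
  then show ?thesis
    using c(1) j J.I_r_closed by (intro CollectI exI[of _ "\<lambda>s. j \<otimes> c s"]) auto
qed

text \<open>Differentiating a relation \<open>r\<close> along a connection yields an identity of
  this shape, with \<open>x\<close> the differentiated coefficients and \<open>u \<odot> w\<close>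
  an error term. It places the combination of \<open>S\<close> with coefficients \<open>x\<close> in
  \<open>J M\<close>, so subtracting coefficients from \<open>J\<close> turns \<open>x\<close> into
  a relation, whose coefficients are in \<open>J\<close> by assumption.\<close>

lemma relation_coeff_in_ideal:
  assumes S: "finite S" "S \<subseteq> carrier M" "module_span R M S = carrier M"
    and J: "ideal J R" and rel: "\<And>c s. \<lbrakk>c \<in> relations S; s \<in> S\<rbrakk> \<Longrightarrow> c s \<in> J"
    and r: "r \<in> S \<rightarrow> J" and u: "u \<in> J" and x: "x \<in> S \<rightarrow> carrier R" and y: "y \<in> S \<rightarrow> carrier M"
    and w: "w \<in> carrier M"
    and eq: "(\<Oplus>\<^bsub>M\<^esub>s\<in>S. x s \<odot>\<^bsub>M\<^esub> s \<oplus>\<^bsub>M\<^esub> r s \<odot>\<^bsub>M\<^esub> y s) = u \<odot>\<^bsub>M\<^esub> w" and s: "s \<in> S"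
  shows "x s \<in> J"
proof -
  interpret J: ideal J R by fact
  let ?N = "{\<Oplus>\<^bsub>M\<^esub>s\<in>S. c s \<odot>\<^bsub>M\<^esub> s | c. c \<in> S \<rightarrow> J}"
  have N: "submodule ?N R M" by (rule ideal_comb_submodule[OF S(1,2) J])
  have rc: "r \<in> S \<rightarrow> carrier R" using r by (auto intro!: J.Icarr)
  have xs: "(\<Oplus>\<^bsub>M\<^esub>s\<in>S. x s \<odot>\<^bsub>M\<^esub> s) \<in> carrier M" by (rule comb_closed[OF x S(2)])
  have rs: "(\<Oplus>\<^bsub>M\<^esub>s\<in>S. r s \<odot>\<^bsub>M\<^esub> y s) \<in> carrier M"
    by (rule M.finsum_closed) (use rc y in auto)
  have "(\<Oplus>\<^bsub>M\<^esub>s\<in>S. x s \<odot>\<^bsub>M\<^esub> s \<oplus>\<^bsub>M\<^esub> r s \<odot>\<^bsub>M\<^esub> y s) =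
     (\<Oplus>\<^bsub>M\<^esub>s\<in>S. x s \<odot>\<^bsub>M\<^esub> s) \<oplus>\<^bsub>M\<^esub> (\<Oplus>\<^bsub>M\<^esub>s\<in>S. r s \<odot>\<^bsub>M\<^esub> y s)"
    by (rule M.finsum_addf) (use x rc y S in \<open>auto simp: Pi_def subset_iff\<close>)
  then have "(\<Oplus>\<^bsub>M\<^esub>s\<in>S. x s \<odot>\<^bsub>M\<^esub> s) = u \<odot>\<^bsub>M\<^esub> w \<oplus>\<^bsub>M\<^esub> \<ominus>\<^bsub>M\<^esub> (\<Oplus>\<^bsub>M\<^esub>s\<in>S. r s \<odot>\<^bsub>M\<^esub> y s)"
    using xs rs unfolding eq[symmetric] by (simp add: M.a_assoc M.r_neg)
  moreover have "(\<Oplus>\<^bsub>M\<^esub>s\<in>S. r s \<odot>\<^bsub>M\<^esub> y s) \<in> ?N"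
  proof (rule submodule_finsum[OF N], rule Pi_I)
    fix s assume s: "s \<in> S"
    show "r s \<odot>\<^bsub>M\<^esub> y s \<in> ?N"
      by (rule smult_in_ideal_comb[OF S J]) (use r y s in auto)
  qed
  ultimately have "(\<Oplus>\<^bsub>M\<^esub>s\<in>S. x s \<odot>\<^bsub>M\<^esub> s) \<in> ?N"
    using submoduleE(5)[OF N smult_in_ideal_comb[OF S J u w] submoduleE(3)[OF N]] by simp
  then obtain c where c: "c \<in> S \<rightarrow> J" "(\<Oplus>\<^bsub>M\<^esub>s\<in>S. x s \<odot>\<^bsub>M\<^esub> s) = (\<Oplus>\<^bsub>M\<^esub>s\<in>S. c s \<odot>\<^bsub>M\<^esub> s)" by blast
  have cc: "c \<in> S \<rightarrow> carrier R" using c by (auto intro!: J.Icarr)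
  have "(\<Oplus>\<^bsub>M\<^esub>s\<in>S. (x s \<oplus> \<ominus> \<one> \<otimes> c s) \<odot>\<^bsub>M\<^esub> s) =
     (\<Oplus>\<^bsub>M\<^esub>s\<in>S. x s \<odot>\<^bsub>M\<^esub> s) \<oplus>\<^bsub>M\<^esub> \<ominus> \<one> \<odot>\<^bsub>M\<^esub> (\<Oplus>\<^bsub>M\<^esub>s\<in>S. c s \<odot>\<^bsub>M\<^esub> s)"
    using x cc S by (subst finsum_comb_add) (auto simp: finsum_comb_smult)
  also have "\<dots> = \<zero>\<^bsub>M\<^esub>" using c(2) xs by (simp add: smult_l_minus M.r_neg)
  finally have "(\<lambda>s. x s \<oplus> \<ominus> \<one> \<otimes> c s) \<in> relations S" using x cc by (auto simp: relations_def)
  then have "x s \<oplus> \<ominus> \<one> \<otimes> c s \<in> J" using rel s by blast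
  then have "(x s \<oplus> \<ominus> \<one> \<otimes> c s) \<oplus> c s \<in> J" using c s J.a_closed by auto
  moreover have "x s \<in> carrier R" "c s \<in> carrier R" using x cc s by auto
  then have "(x s \<oplus> \<ominus> \<one> \<otimes> c s) \<oplus> c s = x s" by (simp add: R.l_minus R.a_assoc R.l_neg)
  ultimately show ?thesis by simp
qed

end

subsection \<open>Regular sequences of length three\<close>

context module
begin

lemma diff_eqI:
  "\<lbrakk>x \<in> carrier M; y \<in> carrier M; z \<in> carrier M; w \<in> carrier M; x \<oplus>\<^bsub>M\<^esub> w = z \<oplus>\<^bsub>M\<^esub> y\<rbrakk>
    \<Longrightarrow> x \<ominus>\<^bsub>M\<^esub> y = z \<ominus>\<^bsub>M\<^esub> w"
proof -
  assume c: "x \<in> carrier M" "y \<in> carrier M" "z \<in> carrier M" "w \<in> carrier M"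
    and e: "x \<oplus>\<^bsub>M\<^esub> w = z \<oplus>\<^bsub>M\<^esub> y"
  have "x \<ominus>\<^bsub>M\<^esub> y = (x \<oplus>\<^bsub>M\<^esub> w) \<oplus>\<^bsub>M\<^esub> (\<ominus>\<^bsub>M\<^esub> w \<oplus>\<^bsub>M\<^esub> \<ominus>\<^bsub>M\<^esub> y)"
    using c by (simp add: M.minus_eq M.a_assoc M.r_neg2)
  also have "\<dots> = (z \<oplus>\<^bsub>M\<^esub> y) \<oplus>\<^bsub>M\<^esub> (\<ominus>\<^bsub>M\<^esub> y \<oplus>\<^bsub>M\<^esub> \<ominus>\<^bsub>M\<^esub> w)"
    using c unfolding e by (simp add: M.a_comm)
  also have "\<dots> = z \<ominus>\<^bsub>M\<^esub> w"
    using c by (simp add: M.minus_eq M.a_assoc M.r_neg2)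
  finally show ?thesis .
qed

lemma minus_solve:
  "\<lbrakk>x \<in> carrier M; y \<in> carrier M; x \<ominus>\<^bsub>M\<^esub> y = z\<rbrakk> \<Longrightarrow> x = y \<oplus>\<^bsub>M\<^esub> z"
  by (auto simp: M.minus_eq M.a_lcomm[of y x] M.r_neg)

lemma add_cancel_mid:
  "\<lbrakk>x \<in> carrier M; y \<in> carrier M; x \<oplus>\<^bsub>M\<^esub> y = z\<rbrakk> \<Longrightarrow> x = z \<ominus>\<^bsub>M\<^esub> y"
  by (auto simp: M.minus_eq M.a_assoc M.r_neg)

lemma smult_minus_distr:
  "\<lbrakk>a \<in> carrier R; x \<in> carrier M; y \<in> carrier M\<rbrakk> \<Longrightarrow> a \<odot>\<^bsub>M\<^esub> (x \<ominus>\<^bsub>M\<^esub> y) = a \<odot>\<^bsub>M\<^esub> x \<ominus>\<^bsub>M\<^esub> a \<odot>\<^bsub>M\<^esub> y"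
  by (simp add: M.minus_eq smult_r_distr smult_r_minus)

text \<open>A weakly regular sequence, written as three division rules for elements. Properness of
  the generated submodule is left out on purpose: this makes exponent 0 a valid start for the
  inductions on powers.\<close>

definition regular3 :: "'a \<Rightarrow> 'a \<Rightarrow> 'a \<Rightarrow> bool"
  where "regular3 a b c \<longleftrightarrow> a \<in> carrier R \<and> b \<in> carrier R \<and> c \<in> carrier R \<and>
    (\<forall>x\<in>carrier M. a \<odot>\<^bsub>M\<^esub> x = \<zero>\<^bsub>M\<^esub> \<longrightarrow> x = \<zero>\<^bsub>M\<^esub>) \<and>
    (\<forall>x\<in>carrier M. \<forall>y\<in>carrier M. b \<odot>\<^bsub>M\<^esub> x = a \<odot>\<^bsub>M\<^esub> y \<longrightarrow> (\<exists>z\<in>carrier M. x = a \<odot>\<^bsub>M\<^esub> z)) \<and>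
    (\<forall>x\<in>carrier M. \<forall>y\<in>carrier M. \<forall>z\<in>carrier M. c \<odot>\<^bsub>M\<^esub> x = a \<odot>\<^bsub>M\<^esub> y \<oplus>\<^bsub>M\<^esub> b \<odot>\<^bsub>M\<^esub> z \<longrightarrow>
      (\<exists>p\<in>carrier M. \<exists>q\<in>carrier M. x = a \<odot>\<^bsub>M\<^esub> p \<oplus>\<^bsub>M\<^esub> b \<odot>\<^bsub>M\<^esub> q))"

lemma regular3D:
  assumes "regular3 a b c"
  shows "a \<in> carrier R" "b \<in> carrier R" "c \<in> carrier R"
    "\<And>x y. \<lbrakk>x \<in> carrier M; y \<in> carrier M; b \<odot>\<^bsub>M\<^esub> x = a \<odot>\<^bsub>M\<^esub> y\<rbrakk> \<Longrightarrow> \<exists>z\<in>carrier M. x = a \<odot>\<^bsub>M\<^esub> z"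
    "\<And>x y z. \<lbrakk>x \<in> carrier M; y \<in> carrier M; z \<in> carrier M; c \<odot>\<^bsub>M\<^esub> x = a \<odot>\<^bsub>M\<^esub> y \<oplus>\<^bsub>M\<^esub> b \<odot>\<^bsub>M\<^esub> z\<rbrakk>
      \<Longrightarrow> \<exists>p\<in>carrier M. \<exists>q\<in>carrier M. x = a \<odot>\<^bsub>M\<^esub> p \<oplus>\<^bsub>M\<^esub> b \<odot>\<^bsub>M\<^esub> q"
  using assms unfolding regular3_def by blast+

lemma regular3_cancel:
  assumes "regular3 a b c" "x \<in> carrier M" "y \<in> carrier M" "a \<odot>\<^bsub>M\<^esub> x = a \<odot>\<^bsub>M\<^esub> y"
  shows "x = y"
proof -
  have a: "a \<in> carrier R" using assms unfolding regular3_def by auto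
  have "a \<odot>\<^bsub>M\<^esub> (x \<ominus>\<^bsub>M\<^esub> y) = \<zero>\<^bsub>M\<^esub>"
    using a assms by (simp add: smult_minus_distr) (simp add: M.minus_eq M.r_neg)
  then have "x \<ominus>\<^bsub>M\<^esub> y = \<zero>\<^bsub>M\<^esub>" using assms unfolding regular3_def by auto
  then show ?thesis using minus_solve[of x y "\<zero>\<^bsub>M\<^esub>"] assms by simp
qed

lemma regular3I:
  assumes "a \<in> carrier R" "b \<in> carrier R" "c \<in> carrier R"
    "\<And>x. \<lbrakk>x \<in> carrier M; a \<odot>\<^bsub>M\<^esub> x = \<zero>\<^bsub>M\<^esub>\<rbrakk> \<Longrightarrow> x = \<zero>\<^bsub>M\<^esub>"
    "\<And>x y. \<lbrakk>x \<in> carrier M; y \<in> carrier M; b \<odot>\<^bsub>M\<^esub> x = a \<odot>\<^bsub>M\<^esub> y\<rbrakk> \<Longrightarrow> \<exists>z\<in>carrier M. x = a \<odot>\<^bsub>M\<^esub> z"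
    "\<And>x y z. \<lbrakk>x \<in> carrier M; y \<in> carrier M; z \<in> carrier M; c \<odot>\<^bsub>M\<^esub> x = a \<odot>\<^bsub>M\<^esub> y \<oplus>\<^bsub>M\<^esub> b \<odot>\<^bsub>M\<^esub> z\<rbrakk>
      \<Longrightarrow> \<exists>p\<in>carrier M. \<exists>q\<in>carrier M. x = a \<odot>\<^bsub>M\<^esub> p \<oplus>\<^bsub>M\<^esub> b \<odot>\<^bsub>M\<^esub> q"
  shows "regular3 a b c"
  using assms unfolding regular3_def by blast

lemma smult_pow_Suc:
  "\<lbrakk>a \<in> carrier R; x \<in> carrier M\<rbrakk> \<Longrightarrow> (a [^] Suc n) \<odot>\<^bsub>M\<^esub> x = a \<odot>\<^bsub>M\<^esub> ((a [^] n) \<odot>\<^bsub>M\<^esub> x)"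
  by (simp add: smult_assoc1 smult_lcomm[of "a [^] n" a])

lemma regular3_pow3:
  assumes r: "regular3 a b c"
  shows "regular3 a b (c [^] (n::nat))"
proof (induction n)
  case 0
  show ?case
    by (rule regular3I) (use r regular3D[OF r] in \<open>auto simp: regular3_def\<close>)
next
  case (Suc n)
  note rD = regular3D[OF r]
  show ?case
  proof (rule regular3I)
    fix x y z assume x: "x \<in> carrier M" and y: "y \<in> carrier M" and z: "z \<in> carrier M"
      and e: "c [^] Suc n \<odot>\<^bsub>M\<^esub> x = a \<odot>\<^bsub>M\<^esub> y \<oplus>\<^bsub>M\<^esub> b \<odot>\<^bsub>M\<^esub> z"
    have "c \<odot>\<^bsub>M\<^esub> (c [^] n \<odot>\<^bsub>M\<^esub> x) = a \<odot>\<^bsub>M\<^esub> y \<oplus>\<^bsub>M\<^esub> b \<odot>\<^bsub>M\<^esub> z"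
      using e smult_pow_Suc[OF rD(3) x] by simp
    then obtain p q where p: "p \<in> carrier M" and q: "q \<in> carrier M"
      and "c [^] n \<odot>\<^bsub>M\<^esub> x = a \<odot>\<^bsub>M\<^esub> p \<oplus>\<^bsub>M\<^esub> b \<odot>\<^bsub>M\<^esub> q"
      using rD(5)[OF _ y z, of "c [^] n \<odot>\<^bsub>M\<^esub> x"] rD(3) x by auto
    then show "\<exists>p\<in>carrier M. \<exists>q\<in>carrier M. x = a \<odot>\<^bsub>M\<^esub> p \<oplus>\<^bsub>M\<^esub> b \<odot>\<^bsub>M\<^esub> q"
      using regular3D(5)[OF Suc x p q] by simp
  qed (use r rD in \<open>auto simp: regular3_def\<close>)
qed

text \<open>For the last condition let \<open>c x = a y + b^(n+1) z\<close>. The given sequence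
  yields \<open>x = a p + b q\<close>; cancelling \<open>b\<close> modulo \<open>a\<close> leaves
  \<open>c q = a t + b^n z\<close>, and the induction hypothesis splits \<open>q\<close>.\<close>

lemma regular3_pow2:
  assumes r: "regular3 a b c"
  shows "regular3 a (b [^] (n::nat)) c"
proof (induction n)
  case 0
  note rD = regular3D[OF r]
  show ?case
  proof (rule regular3I)
    fix x y z assume x: "x \<in> carrier M"
    have "x = a \<odot>\<^bsub>M\<^esub> \<zero>\<^bsub>M\<^esub> \<oplus>\<^bsub>M\<^esub> b [^] (0::nat) \<odot>\<^bsub>M\<^esub> x" using x rD by simp
    then show "\<exists>p\<in>carrier M. \<exists>q\<in>carrier M. x = a \<odot>\<^bsub>M\<^esub> p \<oplus>\<^bsub>M\<^esub> b [^] (0::nat) \<odot>\<^bsub>M\<^esub> q"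
      using x by blast
  qed (use r rD in \<open>auto simp: regular3_def\<close>)
next
  case (Suc n)
  note rD = regular3D[OF r] and SD = regular3D[OF Suc]
  show ?case
  proof (rule regular3I)
    fix x y assume x: "x \<in> carrier M" and y: "y \<in> carrier M"
      and e: "b [^] Suc n \<odot>\<^bsub>M\<^esub> x = a \<odot>\<^bsub>M\<^esub> y"
    have "b \<odot>\<^bsub>M\<^esub> (b [^] n \<odot>\<^bsub>M\<^esub> x) = a \<odot>\<^bsub>M\<^esub> y" using e smult_pow_Suc[OF rD(2) x] by simp
    then obtain z where "z \<in> carrier M" "b [^] n \<odot>\<^bsub>M\<^esub> x = a \<odot>\<^bsub>M\<^esub> z"
      using rD(4)[OF _ y, of "b [^] n \<odot>\<^bsub>M\<^esub> x"] rD(2) x by auto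
    then show "\<exists>z\<in>carrier M. x = a \<odot>\<^bsub>M\<^esub> z" using SD(4)[OF x] by blast
  next
    fix x y z assume x: "x \<in> carrier M" and y: "y \<in> carrier M" and z: "z \<in> carrier M"
      and e: "c \<odot>\<^bsub>M\<^esub> x = a \<odot>\<^bsub>M\<^esub> y \<oplus>\<^bsub>M\<^esub> b [^] Suc n \<odot>\<^bsub>M\<^esub> z"
    have bz: "b [^] n \<odot>\<^bsub>M\<^esub> z \<in> carrier M" using rD z by simp
    have e': "c \<odot>\<^bsub>M\<^esub> x = a \<odot>\<^bsub>M\<^esub> y \<oplus>\<^bsub>M\<^esub> b \<odot>\<^bsub>M\<^esub> (b [^] n \<odot>\<^bsub>M\<^esub> z)"
      using e smult_pow_Suc[OF rD(2) z] by simp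
    obtain p q where p: "p \<in> carrier M" and q: "q \<in> carrier M"
      and xpq: "x = a \<odot>\<^bsub>M\<^esub> p \<oplus>\<^bsub>M\<^esub> b \<odot>\<^bsub>M\<^esub> q"
      using rD(5)[OF x y bz e'] by auto
    have "b \<odot>\<^bsub>M\<^esub> (c \<odot>\<^bsub>M\<^esub> q) \<oplus>\<^bsub>M\<^esub> a \<odot>\<^bsub>M\<^esub> (c \<odot>\<^bsub>M\<^esub> p) = c \<odot>\<^bsub>M\<^esub> x"
      using rD p q by (simp add: xpq smult_r_distr smult_lcomm[of c] M.a_comm)
    then have "b \<odot>\<^bsub>M\<^esub> (c \<odot>\<^bsub>M\<^esub> q) \<ominus>\<^bsub>M\<^esub> b \<odot>\<^bsub>M\<^esub> (b [^] n \<odot>\<^bsub>M\<^esub> z) = a \<odot>\<^bsub>M\<^esub> y \<ominus>\<^bsub>M\<^esub> a \<odot>\<^bsub>M\<^esub> (c \<odot>\<^bsub>M\<^esub> p)"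
      using rD p q y bz e' by (intro diff_eqI) auto
    then have "b \<odot>\<^bsub>M\<^esub> (c \<odot>\<^bsub>M\<^esub> q \<ominus>\<^bsub>M\<^esub> b [^] n \<odot>\<^bsub>M\<^esub> z) = a \<odot>\<^bsub>M\<^esub> (y \<ominus>\<^bsub>M\<^esub> c \<odot>\<^bsub>M\<^esub> p)"
      using rD p q y bz by (simp add: smult_minus_distr)
    then obtain t where t: "t \<in> carrier M" "c \<odot>\<^bsub>M\<^esub> q \<ominus>\<^bsub>M\<^esub> b [^] n \<odot>\<^bsub>M\<^esub> z = a \<odot>\<^bsub>M\<^esub> t"
      using rD(4)[of "c \<odot>\<^bsub>M\<^esub> q \<ominus>\<^bsub>M\<^esub> b [^] n \<odot>\<^bsub>M\<^esub> z" "y \<ominus>\<^bsub>M\<^esub> c \<odot>\<^bsub>M\<^esub> p"] rD p q y bz by auto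
    have "c \<odot>\<^bsub>M\<^esub> q = a \<odot>\<^bsub>M\<^esub> t \<oplus>\<^bsub>M\<^esub> b [^] n \<odot>\<^bsub>M\<^esub> z"
      using rD q bz unfolding t(2)[symmetric] by (simp add: M.minus_eq M.a_assoc M.l_neg)
    then obtain p' q' where p': "p' \<in> carrier M" and q': "q' \<in> carrier M"
      and qq: "q = a \<odot>\<^bsub>M\<^esub> p' \<oplus>\<^bsub>M\<^esub> b [^] n \<odot>\<^bsub>M\<^esub> q'" using SD(5)[OF q t(1) z] by auto
    have "x = a \<odot>\<^bsub>M\<^esub> (p \<oplus>\<^bsub>M\<^esub> b \<odot>\<^bsub>M\<^esub> p') \<oplus>\<^bsub>M\<^esub> b [^] Suc n \<odot>\<^bsub>M\<^esub> q'"
      using rD p p' q' unfolding smult_pow_Suc[OF rD(2) q']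
      by (simp add: xpq qq smult_r_distr smult_lcomm[of b a] M.a_assoc)
    then show "\<exists>p\<in>carrier M. \<exists>q\<in>carrier M. x = a \<odot>\<^bsub>M\<^esub> p \<oplus>\<^bsub>M\<^esub> b [^] Suc n \<odot>\<^bsub>M\<^esub> q"
      using rD p p' q' by (intro bexI[of _ "p \<oplus>\<^bsub>M\<^esub> b \<odot>\<^bsub>M\<^esub> p'"] bexI[of _ q']) auto
  qed (use r rD in \<open>auto simp: regular3_def\<close>)
qed

text \<open>For the last condition let \<open>c x = a^(n+1) y + b z\<close>, so that
  \<open>x = a p + b q\<close>. Cancelling \<open>b\<close> modulo \<open>a\<close> gives
  \<open>z - c q = a t\<close>; cancelling \<open>a\<close> then gives
  \<open>c p = a^n y + b t\<close>, and the induction hypothesis splits \<open>p\<close>.\<close>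

lemma regular3_pow1:
  assumes r: "regular3 a b c"
  shows "regular3 (a [^] (n::nat)) b c"
proof (induction n)
  case 0
  note rD = regular3D[OF r]
  show ?case
  proof (rule regular3I)
    fix x y z assume x: "x \<in> carrier M"
    have "x = a [^] (0::nat) \<odot>\<^bsub>M\<^esub> x" using x by simp
    then show "\<exists>z\<in>carrier M. x = a [^] (0::nat) \<odot>\<^bsub>M\<^esub> z" using x by blast
    have "x = a [^] (0::nat) \<odot>\<^bsub>M\<^esub> x \<oplus>\<^bsub>M\<^esub> b \<odot>\<^bsub>M\<^esub> \<zero>\<^bsub>M\<^esub>" using x rD by simp
    then show "\<exists>p\<in>carrier M. \<exists>q\<in>carrier M. x = a [^] (0::nat) \<odot>\<^bsub>M\<^esub> p \<oplus>\<^bsub>M\<^esub> b \<odot>\<^bsub>M\<^esub> q"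
      using x by blast
  qed (use r rD in auto)
next
  case (Suc n)
  note rD = regular3D[OF r] and SD = regular3D[OF Suc]
  show ?case
  proof (rule regular3I)
    fix x assume x: "x \<in> carrier M" "a [^] Suc n \<odot>\<^bsub>M\<^esub> x = \<zero>\<^bsub>M\<^esub>"
    then have "a \<odot>\<^bsub>M\<^esub> (a [^] n \<odot>\<^bsub>M\<^esub> x) = \<zero>\<^bsub>M\<^esub>" using smult_pow_Suc[OF rD(1)] by simp
    then have "a [^] n \<odot>\<^bsub>M\<^esub> x = \<zero>\<^bsub>M\<^esub>" using r x rD(1) by (auto simp: regular3_def)
    then show "x = \<zero>\<^bsub>M\<^esub>" using Suc x by (auto simp: regular3_def)
  next
    fix x y assume x: "x \<in> carrier M" and y: "y \<in> carrier M"
      and e: "b \<odot>\<^bsub>M\<^esub> x = a [^] Suc n \<odot>\<^bsub>M\<^esub> y"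
    have ay: "a [^] n \<odot>\<^bsub>M\<^esub> y \<in> carrier M" using rD y by simp
    have e': "b \<odot>\<^bsub>M\<^esub> x = a \<odot>\<^bsub>M\<^esub> (a [^] n \<odot>\<^bsub>M\<^esub> y)" using e smult_pow_Suc[OF rD(1) y] by simp
    obtain z where z: "z \<in> carrier M" "x = a \<odot>\<^bsub>M\<^esub> z" using rD(4)[OF x ay e'] by auto
    have "a \<odot>\<^bsub>M\<^esub> (b \<odot>\<^bsub>M\<^esub> z) = a \<odot>\<^bsub>M\<^esub> (a [^] n \<odot>\<^bsub>M\<^esub> y)"
      using e' z rD by (simp add: smult_lcomm[of a b])
    then have "b \<odot>\<^bsub>M\<^esub> z = a [^] n \<odot>\<^bsub>M\<^esub> y"
      using regular3_cancel[OF r] z rD ay by simp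
    then obtain t where "t \<in> carrier M" "z = a [^] n \<odot>\<^bsub>M\<^esub> t" using SD(4)[OF z(1) y] by auto
    then show "\<exists>z\<in>carrier M. x = a [^] Suc n \<odot>\<^bsub>M\<^esub> z"
      using z smult_pow_Suc[OF rD(1)] by (intro bexI[of _ t]) auto
  next
    fix x y z assume x: "x \<in> carrier M" and y: "y \<in> carrier M" and z: "z \<in> carrier M"
      and e: "c \<odot>\<^bsub>M\<^esub> x = a [^] Suc n \<odot>\<^bsub>M\<^esub> y \<oplus>\<^bsub>M\<^esub> b \<odot>\<^bsub>M\<^esub> z"
    define Y where "Y = a [^] n \<odot>\<^bsub>M\<^esub> y"
    have Y: "Y \<in> carrier M" using rD y by (simp add: Y_def)
    have e': "c \<odot>\<^bsub>M\<^esub> x = a \<odot>\<^bsub>M\<^esub> Y \<oplus>\<^bsub>M\<^esub> b \<odot>\<^bsub>M\<^esub> z"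
      using e smult_pow_Suc[OF rD(1) y] by (simp add: Y_def)
    obtain p q where p: "p \<in> carrier M" and q: "q \<in> carrier M"
      and xpq: "x = a \<odot>\<^bsub>M\<^esub> p \<oplus>\<^bsub>M\<^esub> b \<odot>\<^bsub>M\<^esub> q"
      using rD(5)[OF x Y z e'] by auto
    have cx: "c \<odot>\<^bsub>M\<^esub> x = a \<odot>\<^bsub>M\<^esub> (c \<odot>\<^bsub>M\<^esub> p) \<oplus>\<^bsub>M\<^esub> b \<odot>\<^bsub>M\<^esub> (c \<odot>\<^bsub>M\<^esub> q)"
      using rD p q by (simp add: xpq smult_r_distr smult_lcomm[of c])
    have "b \<odot>\<^bsub>M\<^esub> z \<ominus>\<^bsub>M\<^esub> b \<odot>\<^bsub>M\<^esub> (c \<odot>\<^bsub>M\<^esub> q) = a \<odot>\<^bsub>M\<^esub> (c \<odot>\<^bsub>M\<^esub> p) \<ominus>\<^bsub>M\<^esub> a \<odot>\<^bsub>M\<^esub> Y"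
      using rD p q Y z cx e' by (intro diff_eqI) (auto simp: M.a_comm)
    then have e2: "b \<odot>\<^bsub>M\<^esub> (z \<ominus>\<^bsub>M\<^esub> c \<odot>\<^bsub>M\<^esub> q) = a \<odot>\<^bsub>M\<^esub> (c \<odot>\<^bsub>M\<^esub> p \<ominus>\<^bsub>M\<^esub> Y)"
      using rD p q Y z by (simp add: smult_minus_distr)
    then obtain t where t: "t \<in> carrier M" "z \<ominus>\<^bsub>M\<^esub> c \<odot>\<^bsub>M\<^esub> q = a \<odot>\<^bsub>M\<^esub> t"
      using rD(4)[of "z \<ominus>\<^bsub>M\<^esub> c \<odot>\<^bsub>M\<^esub> q" "c \<odot>\<^bsub>M\<^esub> p \<ominus>\<^bsub>M\<^esub> Y"] rD p q Y z by auto
    have "a \<odot>\<^bsub>M\<^esub> (c \<odot>\<^bsub>M\<^esub> p \<ominus>\<^bsub>M\<^esub> Y) = a \<odot>\<^bsub>M\<^esub> (b \<odot>\<^bsub>M\<^esub> t)"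
      using e2 t rD by (simp add: smult_lcomm[of a b])
    then have e3: "c \<odot>\<^bsub>M\<^esub> p \<ominus>\<^bsub>M\<^esub> Y = b \<odot>\<^bsub>M\<^esub> t"
      using regular3_cancel[OF r] rD p Y t by simp
    have "c \<odot>\<^bsub>M\<^esub> p = Y \<oplus>\<^bsub>M\<^esub> b \<odot>\<^bsub>M\<^esub> t"
      using rD p Y by (intro minus_solve e3) auto
    then obtain p' q' where p': "p' \<in> carrier M" and q': "q' \<in> carrier M"
      and pp: "p = a [^] n \<odot>\<^bsub>M\<^esub> p' \<oplus>\<^bsub>M\<^esub> b \<odot>\<^bsub>M\<^esub> q'" using SD(5)[OF p y t(1)] Y_def by auto
    have "x = a [^] Suc n \<odot>\<^bsub>M\<^esub> p' \<oplus>\<^bsub>M\<^esub> b \<odot>\<^bsub>M\<^esub> (a \<odot>\<^bsub>M\<^esub> q' \<oplus>\<^bsub>M\<^esub> q)"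
      using rD p' q' q unfolding smult_pow_Suc[OF rD(1) p']
      by (simp add: xpq pp smult_r_distr smult_lcomm[of a b] M.a_assoc)
    then show "\<exists>p\<in>carrier M. \<exists>q\<in>carrier M. x = a [^] Suc n \<odot>\<^bsub>M\<^esub> p \<oplus>\<^bsub>M\<^esub> b \<odot>\<^bsub>M\<^esub> q"
      using rD p' q' q by (intro bexI[of _ p'] bexI[of _ "a \<odot>\<^bsub>M\<^esub> q' \<oplus>\<^bsub>M\<^esub> q"]) auto
  qed (use r rD in auto)
qed

lemma set_smult_empty: "set_smult R M {} = {\<zero>\<^bsub>M\<^esub>}"
proof -
  have "module_span R M {} = {\<zero>\<^bsub>M\<^esub>}" by (subst module_span_finite) auto
  then show ?thesis unfolding set_smult_def by simp
qed

lemma set_smult_insert: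
  assumes "a \<in> carrier R" "set_smult R M T = N" "submodule N R M"
    "{b \<odot>\<^bsub>M\<^esub> x | b x. b \<in> T \<and> x \<in> carrier M} \<subseteq> N"
  shows "set_smult R M (insert a T) = {a \<odot>\<^bsub>M\<^esub> x \<oplus>\<^bsub>M\<^esub> y | x y. x \<in> carrier M \<and> y \<in> N}" (is "_ = ?L")
proof
  note N = submoduleE[OF assms(3)] submodule_zero[OF assms(3)]
  have L: "submodule ?L R M"
  proof (rule submoduleI)
    show "?L \<subseteq> carrier M" using assms(1) N(1) by auto
    show "\<zero>\<^bsub>M\<^esub> \<in> ?L" using assms(1) N(7) by (intro CollectI exI[of _ "\<zero>\<^bsub>M\<^esub>"]) auto
    fix v assume "v \<in> ?L"
    then obtain x y where v: "x \<in> carrier M" "y \<in> N" "v = a \<odot>\<^bsub>M\<^esub> x \<oplus>\<^bsub>M\<^esub> y" by auto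
    have yc: "y \<in> carrier M" using v N(1) by auto
    have "\<ominus>\<^bsub>M\<^esub> v = a \<odot>\<^bsub>M\<^esub> (\<ominus>\<^bsub>M\<^esub> x) \<oplus>\<^bsub>M\<^esub> \<ominus>\<^bsub>M\<^esub> y"
      using v yc assms(1) by (simp add: M.minus_add smult_r_minus)
    then show "\<ominus>\<^bsub>M\<^esub> v \<in> ?L" using v N(3) by blast
    { fix r assume r: "r \<in> carrier R"
      have "r \<odot>\<^bsub>M\<^esub> v = a \<odot>\<^bsub>M\<^esub> (r \<odot>\<^bsub>M\<^esub> x) \<oplus>\<^bsub>M\<^esub> r \<odot>\<^bsub>M\<^esub> y"
        using v yc r assms(1) by (simp add: smult_r_distr smult_lcomm[of r])
      then show "r \<odot>\<^bsub>M\<^esub> v \<in> ?L" using v N(4) r by blast }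
    fix w assume "w \<in> ?L"
    then obtain x' y' where w: "x' \<in> carrier M" "y' \<in> N" "w = a \<odot>\<^bsub>M\<^esub> x' \<oplus>\<^bsub>M\<^esub> y'" by auto
    have yc': "y' \<in> carrier M" using w N(1) by auto
    have "v \<oplus>\<^bsub>M\<^esub> w = a \<odot>\<^bsub>M\<^esub> (x \<oplus>\<^bsub>M\<^esub> x') \<oplus>\<^bsub>M\<^esub> (y \<oplus>\<^bsub>M\<^esub> y')"
      using v w yc yc' assms(1) by (simp add: smult_r_distr M.a_ac)
    then show "v \<oplus>\<^bsub>M\<^esub> w \<in> ?L" using v w N(5) by blast
  qed
  show "set_smult R M (insert a T) \<subseteq> ?L"
    unfolding set_smult_def
  proof (rule module_span_minimal[OF L], rule subsetI)
    fix v assume "v \<in> {b \<odot>\<^bsub>M\<^esub> x | b x. b \<in> insert a T \<and> x \<in> carrier M}"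
    then obtain b x where v: "b = a \<or> b \<in> T" "x \<in> carrier M" "v = b \<odot>\<^bsub>M\<^esub> x" by auto
    show "v \<in> ?L"
    proof (cases "b = a")
      case True
      then have "v = a \<odot>\<^bsub>M\<^esub> x \<oplus>\<^bsub>M\<^esub> \<zero>\<^bsub>M\<^esub>" using v assms(1) by simp
      then show ?thesis using v N(7) by blast
    next
      case False
      then have vN: "v \<in> N" using v assms(4) by blast
      then have "v = a \<odot>\<^bsub>M\<^esub> \<zero>\<^bsub>M\<^esub> \<oplus>\<^bsub>M\<^esub> v" using assms(1) N(1) by auto
      then show ?thesis using vN by blast
    qed
  qed
  let ?G = "{b \<odot>\<^bsub>M\<^esub> x | b x. b \<in> insert a T \<and> x \<in> carrier M}"
  have "N \<subseteq> module_span R M ?G"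
    unfolding assms(2)[symmetric] set_smult_def module_span_def by blast
  moreover have "?G \<subseteq> carrier M" using assms(1,4) N(1) by auto
  then have sub: "submodule (module_span R M ?G) R M" by (rule module_span_submodule)
  moreover have "a \<odot>\<^bsub>M\<^esub> x \<in> module_span R M ?G" if "x \<in> carrier M" for x
    by (rule subsetD[OF module_span_superset]) (use that in blast)
  ultimately show "?L \<subseteq> set_smult R M (insert a T)"
    unfolding set_smult_def using submoduleE(5)[OF sub] by blast
qed

lemma set_smult_single:
  assumes "a \<in> carrier R"
  shows "set_smult R M {a} = {a \<odot>\<^bsub>M\<^esub> x | x. x \<in> carrier M}"
proof -
  have "submodule {\<zero>\<^bsub>M\<^esub>} R M" by (rule submoduleI) auto
  then have "set_smult R M {a} = {a \<odot>\<^bsub>M\<^esub> x \<oplus>\<^bsub>M\<^esub> y | x y. x \<in> carrier M \<and> y \<in> {\<zero>\<^bsub>M\<^esub>}}"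
    by (intro set_smult_insert assms set_smult_empty) auto
  also have "\<dots> = {a \<odot>\<^bsub>M\<^esub> x | x. x \<in> carrier M}" using assms by force
  finally show ?thesis .
qed

lemma set_smult_submodule: "T \<subseteq> carrier R \<Longrightarrow> submodule (set_smult R M T) R M"
  unfolding set_smult_def by (rule module_span_submodule) auto

lemma set_smult_pair:
  assumes "a \<in> carrier R" "b \<in> carrier R"
  shows "set_smult R M {a, b} = {a \<odot>\<^bsub>M\<^esub> x \<oplus>\<^bsub>M\<^esub> b \<odot>\<^bsub>M\<^esub> y | x y. x \<in> carrier M \<and> y \<in> carrier M}"
proof -
  have "set_smult R M {a, b} = {a \<odot>\<^bsub>M\<^esub> x \<oplus>\<^bsub>M\<^esub> y | x y. x \<in> carrier M \<and> y \<in> set_smult R M {b}}"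
    by (intro set_smult_insert assms set_smult_submodule) (use assms set_smult_single in auto)
  also have "\<dots> = {a \<odot>\<^bsub>M\<^esub> x \<oplus>\<^bsub>M\<^esub> b \<odot>\<^bsub>M\<^esub> y | x y. x \<in> carrier M \<and> y \<in> carrier M}"
    unfolding set_smult_single[OF assms(2)] by blast
  finally show ?thesis .
qed

lemma regular_sequence_regular3:
  assumes r: "regular_sequence R M xs" and n: "3 \<le> length xs"
  shows "regular3 (xs ! 0) (xs ! 1) (xs ! 2)"
proof -
  have c: "xs ! i \<in> carrier R" if "i < 3" for i
    using r n that nth_mem[of i xs] unfolding regular_sequence_def by (meson less_le_trans subsetD)
  have reg: "x \<in> set_smult R M (set (take i xs))"
    if "i < 3" "x \<in> carrier M" "xs ! i \<odot>\<^bsub>M\<^esub> x \<in> set_smult R M (set (take i xs))" for i x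
    using r n that unfolding regular_sequence_def by auto
  have t: "set (take 1 xs) = {xs ! 0}" "set (take 2 xs) = {xs ! 0, xs ! 1}"
  proof -
    have "xs \<noteq> []" using n by auto
    then show "set (take 1 xs) = {xs ! 0}" "set (take 2 xs) = {xs ! 0, xs ! 1}"
      using n take_Suc_conv_app_nth[of 0 xs] take_Suc_conv_app_nth[of 1 xs]
      by (auto simp: numeral_2_eq_2)
  qed
  show ?thesis
  proof (rule regular3I)
    fix x assume "x \<in> carrier M" "xs ! 0 \<odot>\<^bsub>M\<^esub> x = \<zero>\<^bsub>M\<^esub>"
    then show "x = \<zero>\<^bsub>M\<^esub>" using reg[of 0 x] by (simp add: set_smult_empty)
  next
    fix x y assume "x \<in> carrier M" "y \<in> carrier M" "xs ! 1 \<odot>\<^bsub>M\<^esub> x = xs ! 0 \<odot>\<^bsub>M\<^esub> y"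
    then have "x \<in> set_smult R M {xs ! 0}"
      using reg[of 1 x] c[of 0] unfolding t by (auto simp: set_smult_single)
    then show "\<exists>z\<in>carrier M. x = xs ! 0 \<odot>\<^bsub>M\<^esub> z" using c[of 0] by (auto simp: set_smult_single)
  next
    fix x y z assume "x \<in> carrier M" "y \<in> carrier M" "z \<in> carrier M"
      "xs ! 2 \<odot>\<^bsub>M\<^esub> x = xs ! 0 \<odot>\<^bsub>M\<^esub> y \<oplus>\<^bsub>M\<^esub> xs ! 1 \<odot>\<^bsub>M\<^esub> z"
    then have "x \<in> set_smult R M {xs ! 0, xs ! 1}"
      using reg[of 2 x] c[of 0] c[of 1] unfolding t by (auto simp: set_smult_pair)
    then show "\<exists>p\<in>carrier M. \<exists>q\<in>carrier M. x = xs ! 0 \<odot>\<^bsub>M\<^esub> p \<oplus>\<^bsub>M\<^esub> xs ! 1 \<odot>\<^bsub>M\<^esub> q"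
      using c[of 0] c[of 1] by (auto simp: set_smult_pair)
  qed (use c in auto)
qed

end

section \<open>Connections and coefficients of relations\<close>

text \<open>In the application \<open>R\<close> is the ring of power series, \<open>f\<close> is the equation of the hypersurface, and
  \<open>nab D\<close> comes from the derivation that \<open>D\<close> induces on the quotient by \<open>f\<close>.\<close>

locale tangential_connection = module R M for R (structure) and M (structure) +
  fixes Der :: "('a \<Rightarrow> 'a) set" and f :: 'a and nab :: "('a \<Rightarrow> 'a) \<Rightarrow> 'c \<Rightarrow> 'c"
  assumes f_closed [simp]: "f \<in> carrier R"
    and Der_derivation: "D \<in> Der \<Longrightarrow> ring_derivation R D"
    and Der_comb: "\<lbrakk>D \<in> Der; E \<in> Der; a \<in> carrier R; b \<in> carrier R\<rbrakk> \<Longrightarrow> (\<lambda>x. a \<otimes>\<^bsub>R\<^esub> D x \<oplus>\<^bsub>R\<^esub> b \<otimes>\<^bsub>R\<^esub> E x) \<in> Der"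
    and nab_closed: "\<lbrakk>D \<in> Der; D f = \<zero>\<^bsub>R\<^esub>; x \<in> carrier M\<rbrakk> \<Longrightarrow> nab D x \<in> carrier M"
    and nab_add: "\<lbrakk>D \<in> Der; D f = \<zero>\<^bsub>R\<^esub>; x \<in> carrier M; y \<in> carrier M\<rbrakk> \<Longrightarrow>
      nab D (x \<oplus>\<^bsub>M\<^esub> y) = nab D x \<oplus>\<^bsub>M\<^esub> nab D y"
    and nab_smult: "\<lbrakk>D \<in> Der; D f = \<zero>\<^bsub>R\<^esub>; a \<in> carrier R; x \<in> carrier M\<rbrakk> \<Longrightarrow>
      nab D (a \<odot>\<^bsub>M\<^esub> x) = D a \<odot>\<^bsub>M\<^esub> x \<oplus>\<^bsub>M\<^esub> a \<odot>\<^bsub>M\<^esub> nab D x"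
    and nab_comb: "\<lbrakk>D \<in> Der; D f = \<zero>\<^bsub>R\<^esub>; E \<in> Der; E f = \<zero>\<^bsub>R\<^esub>; a \<in> carrier R; b \<in> carrier R; x \<in> carrier M\<rbrakk>
      \<Longrightarrow> nab (\<lambda>x. a \<otimes>\<^bsub>R\<^esub> D x \<oplus>\<^bsub>R\<^esub> b \<otimes>\<^bsub>R\<^esub> E x) x = a \<odot>\<^bsub>M\<^esub> nab D x \<oplus>\<^bsub>M\<^esub> b \<odot>\<^bsub>M\<^esub> nab E x"
    and nab_cong: "\<lbrakk>D \<in> Der; E \<in> Der; D f = \<zero>\<^bsub>R\<^esub>; \<And>a. a \<in> carrier R \<Longrightarrow> D a = E a; x \<in> carrier M\<rbrakk>
      \<Longrightarrow> nab D x = nab E x"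
begin

lemma Der_closed: "\<lbrakk>D \<in> Der; a \<in> carrier R\<rbrakk> \<Longrightarrow> D a \<in> carrier R"
  using ring_derivation.D_closed[OF Der_derivation] .

text \<open>The Koszul syzygy between \<open>D f\<close> and \<open>E f\<close>, read as a
  derivation. It kills \<open>f\<close>, so the connection is defined on it even when it is not
  defined on \<open>D\<close> and \<open>E\<close>. The sign is put into the coefficient to fit
  \<open>Der_comb\<close> and \<open>nab_comb\<close>.\<close>

definition koszul :: "('a \<Rightarrow> 'a) \<Rightarrow> ('a \<Rightarrow> 'a) \<Rightarrow> 'a \<Rightarrow> 'a"
  where "koszul D E = (\<lambda>x. E f \<otimes>\<^bsub>R\<^esub> D x \<oplus>\<^bsub>R\<^esub> (\<ominus>\<^bsub>R\<^esub> D f) \<otimes>\<^bsub>R\<^esub> E x)"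

lemma koszul_Der: "\<lbrakk>D \<in> Der; E \<in> Der\<rbrakk> \<Longrightarrow> koszul D E \<in> Der"
  unfolding koszul_def by (rule Der_comb) (auto simp: Der_closed)

lemma koszul_f: "\<lbrakk>D \<in> Der; E \<in> Der\<rbrakk> \<Longrightarrow> koszul D E f = \<zero>\<^bsub>R\<^esub>"
  unfolding koszul_def using Der_closed[of D f] Der_closed[of E f]
  by (simp add: R.l_minus R.m_comm[of "E f" "D f"] R.r_neg)

text \<open>The derivations themselves satisfy this identity, and \<open>nab\<close> is linear over
  \<open>R\<close> on those killing \<open>f\<close>. It is the cocycle condition on which the
  extension argument rests.\<close>

lemma koszul_relation:
  assumes DEF: "D \<in> Der" "E \<in> Der" "F \<in> Der" and x: "x \<in> carrier M"
  shows "F f \<odot>\<^bsub>M\<^esub> nab (koszul D E) x \<oplus>\<^bsub>M\<^esub> D f \<odot>\<^bsub>M\<^esub> nab (koszul E F) x =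
    E f \<odot>\<^bsub>M\<^esub> nab (koszul D F) x"
proof -
  have k: "koszul A B \<in> Der" "koszul A B f = \<zero>\<^bsub>R\<^esub>" if "A \<in> {D, E, F}" "B \<in> {D, E, F}" for A B
    using DEF that koszul_Der koszul_f by auto
  have c: "D f \<in> carrier R" "E f \<in> carrier R" "F f \<in> carrier R" using DEF Der_closed by auto
  have "F f \<odot>\<^bsub>M\<^esub> nab (koszul D E) x \<oplus>\<^bsub>M\<^esub> D f \<odot>\<^bsub>M\<^esub> nab (koszul E F) x =
     nab (\<lambda>x. F f \<otimes>\<^bsub>R\<^esub> koszul D E x \<oplus>\<^bsub>R\<^esub> D f \<otimes>\<^bsub>R\<^esub> koszul E F x) x"
    by (rule nab_comb[symmetric]) (use k c x in auto)
  \<comment> \<open>The summand with coefficient zero only brings the right-hand side into the shape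
    of \<open>nab_comb\<close>.\<close>
  also have "\<dots> = nab (\<lambda>x. E f \<otimes>\<^bsub>R\<^esub> koszul D F x \<oplus>\<^bsub>R\<^esub> \<zero>\<^bsub>R\<^esub> \<otimes>\<^bsub>R\<^esub> koszul D F x) x"
  proof (rule nab_cong)
    fix a assume a: "a \<in> carrier R"
    have ca: "D a \<in> carrier R" "E a \<in> carrier R" "F a \<in> carrier R" using DEF a Der_closed by auto
    show "F f \<otimes>\<^bsub>R\<^esub> koszul D E a \<oplus>\<^bsub>R\<^esub> D f \<otimes>\<^bsub>R\<^esub> koszul E F a =
        E f \<otimes>\<^bsub>R\<^esub> koszul D F a \<oplus>\<^bsub>R\<^esub> \<zero>\<^bsub>R\<^esub> \<otimes>\<^bsub>R\<^esub> koszul D F a"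
      unfolding koszul_def using c ca
      by (simp add: R.r_distr R.l_minus R.r_minus R.a_ac R.m_ac R.r_neg1 R.r_neg2)
  qed (use k c x in \<open>auto intro!: Der_comb simp: koszul_f\<close>)
  also have "\<dots> = E f \<odot>\<^bsub>M\<^esub> nab (koszul D F) x \<oplus>\<^bsub>M\<^esub> \<zero>\<^bsub>R\<^esub> \<odot>\<^bsub>M\<^esub> nab (koszul D F) x"
    by (rule nab_comb) (use k c x in auto)
  also have "\<dots> = E f \<odot>\<^bsub>M\<^esub> nab (koszul D F) x"
    using k[of D F] c x nab_closed by simp
  finally show ?thesis .
qed

lemma nab_zero: "\<lbrakk>D \<in> Der; D f = \<zero>\<^bsub>R\<^esub>\<rbrakk> \<Longrightarrow> nab D \<zero>\<^bsub>M\<^esub> = \<zero>\<^bsub>M\<^esub>"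
  using nab_smult[of D "\<zero>\<^bsub>R\<^esub>" "\<zero>\<^bsub>M\<^esub>"] nab_closed[of D "\<zero>\<^bsub>M\<^esub>"]
    ring_derivation.D_zero[OF Der_derivation[of D]] by simp

lemma nab_finsum:
  assumes "D \<in> Der" "D f = \<zero>\<^bsub>R\<^esub>" "g \<in> S \<rightarrow> carrier M"
  shows "nab D (finsum M g S) = (\<Oplus>\<^bsub>M\<^esub>s\<in>S. nab D (g s))"
  using assms(3)
proof (induction S rule: infinite_finite_induct)
  case (insert x F)
  then have "g \<in> F \<rightarrow> carrier M" "g x \<in> carrier M" "(\<lambda>s. nab D (g s)) \<in> F \<rightarrow> carrier M"
    using nab_closed assms by auto
  then show ?case using insert assms nab_closed by (simp add: nab_add)
qed (auto simp: nab_zero assms)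

lemma relation_D_closed: "\<lbrakk>r \<in> relations S; D \<in> Der; s \<in> S\<rbrakk> \<Longrightarrow> D (r s) \<in> carrier R"
  by (rule Der_closed) (auto simp: relations_def)

lemma nab_relation:
  assumes D: "D \<in> Der" "D f = \<zero>\<^bsub>R\<^esub>" and S: "S \<subseteq> carrier M" and r: "r \<in> relations S"
  shows "(\<Oplus>\<^bsub>M\<^esub>s\<in>S. D (r s) \<odot>\<^bsub>M\<^esub> s \<oplus>\<^bsub>M\<^esub> r s \<odot>\<^bsub>M\<^esub> nab D s) = \<zero>\<^bsub>M\<^esub>"
proof -
  have rc: "r s \<in> carrier R" "s \<in> carrier M" if "s \<in> S" for s
    using r S that by (auto simp: relations_def)
  have "(\<Oplus>\<^bsub>M\<^esub>s\<in>S. D (r s) \<odot>\<^bsub>M\<^esub> s \<oplus>\<^bsub>M\<^esub> r s \<odot>\<^bsub>M\<^esub> nab D s) = (\<Oplus>\<^bsub>M\<^esub>s\<in>S. nab D (r s \<odot>\<^bsub>M\<^esub> s))"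
    by (rule M.finsum_cong') (use rc D nab_closed Der_closed[OF D(1)] nab_smult in auto)
  also have "\<dots> = nab D (\<Oplus>\<^bsub>M\<^esub>s\<in>S. r s \<odot>\<^bsub>M\<^esub> s)"
    by (rule nab_finsum[symmetric]) (use rc D in auto)
  also have "\<dots> = \<zero>\<^bsub>M\<^esub>" using r D by (simp add: relations_def nab_zero)
  finally show ?thesis .
qed

text \<open>Applying \<open>nab D\<close> to a relation gives the identity of
  \<open>relation_coeff_in_ideal\<close> without an error term.\<close>

lemma tangential_stable:
  assumes S: "finite S" "S \<subseteq> carrier M" "module_span R M S = carrier M"
    and J: "ideal J R" and rel: "\<And>c s. \<lbrakk>c \<in> relations S; s \<in> S\<rbrakk> \<Longrightarrow> c s \<in> J"
    and D: "D \<in> Der" "D f = \<zero>\<^bsub>R\<^esub>" and r: "r \<in> relations S" and s: "s \<in> S"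
  shows "D (r s) \<in> J"
proof -
  interpret J: ideal J R by fact
  show ?thesis
  proof (rule relation_coeff_in_ideal[where S = S and J = J and x = "\<lambda>s. D (r s)" and r = r
        and u = "\<zero>\<^bsub>R\<^esub>" and y = "nab D" and w = "\<zero>\<^bsub>M\<^esub>"])
    show "(\<Oplus>\<^bsub>M\<^esub>s\<in>S. D (r s) \<odot>\<^bsub>M\<^esub> s \<oplus>\<^bsub>M\<^esub> r s \<odot>\<^bsub>M\<^esub> nab D s) = \<zero>\<^bsub>R\<^esub> \<odot>\<^bsub>M\<^esub> \<zero>\<^bsub>M\<^esub>"
      using nab_relation[OF D S(2) r] by simp
  qed (use S J r rel D s nab_closed relation_D_closed[OF r D(1)] J.zero_closed in auto)
qed

text \<open>The obstruction to extending the connection to \<open>D\<close> on \<open>M / D(f) M\<close> is a Koszul cocycle;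
  depth at least three makes it a coboundary.\<close>

lemma extension_vector:
  assumes D0: "D0 \<in> Der" and Da: "Da \<in> Der" and Db: "Db \<in> Der" and Dc: "Dc \<in> Der"
    and reg: "regular3 (Da f) (Db f) (Dc f)" and n: "n \<in> carrier M"
  shows "\<exists>\<nu>\<in>carrier M. \<exists>p\<in>carrier M. \<exists>q\<in>carrier M.
    nab (koszul D0 Da) n \<oplus>\<^bsub>M\<^esub> D0 f \<odot>\<^bsub>M\<^esub> q = Da f \<odot>\<^bsub>M\<^esub> \<nu> \<and>
    nab (koszul D0 Db) n \<oplus>\<^bsub>M\<^esub> D0 f \<odot>\<^bsub>M\<^esub> (\<ominus>\<^bsub>M\<^esub> p) = Db f \<odot>\<^bsub>M\<^esub> \<nu> \<and>
    nab (koszul Da Db) n = Da f \<odot>\<^bsub>M\<^esub> p \<oplus>\<^bsub>M\<^esub> Db f \<odot>\<^bsub>M\<^esub> q"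
proof -
  define a b c u where "a = Da f" and "b = Db f" and "c = Dc f" and "u = D0 f"
  have abc: "a \<in> carrier R" "b \<in> carrier R" "c \<in> carrier R" "u \<in> carrier R"
    using assms Der_closed by (auto simp: a_def b_def c_def u_def)
  have reg': "regular3 a b c" using reg by (simp add: a_def b_def c_def)
  define A B L where "A = nab (koszul D0 Da) n" and "B = nab (koszul D0 Db) n" and "L = nab (koszul Da Db) n"
  define Lac Lbc where "Lac = nab (koszul Da Dc) n" and "Lbc = nab (koszul Db Dc) n"
  have cl: "A \<in> carrier M" "B \<in> carrier M" "L \<in> carrier M" "Lac \<in> carrier M" "Lbc \<in> carrier M"
    unfolding A_def B_def L_def Lac_def Lbc_def
    by (intro nab_closed koszul_Der koszul_f assms)+
  have 1: "b \<odot>\<^bsub>M\<^esub> A \<oplus>\<^bsub>M\<^esub> u \<odot>\<^bsub>M\<^esub> L = a \<odot>\<^bsub>M\<^esub> B"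
    using koszul_relation[OF D0 Da Db n] by (simp add: A_def B_def L_def a_def b_def u_def)
  have 2: "c \<odot>\<^bsub>M\<^esub> L \<oplus>\<^bsub>M\<^esub> a \<odot>\<^bsub>M\<^esub> Lbc = b \<odot>\<^bsub>M\<^esub> Lac"
    using koszul_relation[OF Da Db Dc n] by (simp add: Lac_def Lbc_def L_def a_def b_def c_def)
  have "c \<odot>\<^bsub>M\<^esub> L = b \<odot>\<^bsub>M\<^esub> Lac \<ominus>\<^bsub>M\<^esub> a \<odot>\<^bsub>M\<^esub> Lbc"
    by (rule add_cancel_mid[OF _ _ 2]) (use abc cl in auto)
  then have "c \<odot>\<^bsub>M\<^esub> L = a \<odot>\<^bsub>M\<^esub> (\<ominus>\<^bsub>M\<^esub> Lbc) \<oplus>\<^bsub>M\<^esub> b \<odot>\<^bsub>M\<^esub> Lac"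
    using abc cl by (simp add: M.minus_eq smult_r_minus M.a_comm)
  \<comment> \<open>If \<open>nab\<close> extended to all derivations, it would send
    \<open>koszul D0 Da\<close> to \<open>a (nab D0) - u (nab Da)\<close>, and similarly for the
    other pairs. Here \<open>q\<close> plays the part of \<open>nab Da n\<close> and
    \<open>- p\<close> that of \<open>nab Db n\<close>; the vector found below plays the part of
    \<open>nab D0 n\<close>.\<close>
  then obtain p q where p: "p \<in> carrier M" and q: "q \<in> carrier M"
    and L: "L = a \<odot>\<^bsub>M\<^esub> p \<oplus>\<^bsub>M\<^esub> b \<odot>\<^bsub>M\<^esub> q"
    using regular3D(5)[OF reg' cl(3) _ cl(4), of "\<ominus>\<^bsub>M\<^esub> Lbc"] cl by auto
  have "b \<odot>\<^bsub>M\<^esub> A \<oplus>\<^bsub>M\<^esub> b \<odot>\<^bsub>M\<^esub> (u \<odot>\<^bsub>M\<^esub> q) \<oplus>\<^bsub>M\<^esub> a \<odot>\<^bsub>M\<^esub> (u \<odot>\<^bsub>M\<^esub> p) = a \<odot>\<^bsub>M\<^esub> B"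
    using 1 abc cl p q by (simp add: L smult_r_distr smult_lcomm[of u] M.a_ac)
  then have "b \<odot>\<^bsub>M\<^esub> A \<oplus>\<^bsub>M\<^esub> b \<odot>\<^bsub>M\<^esub> (u \<odot>\<^bsub>M\<^esub> q) = a \<odot>\<^bsub>M\<^esub> B \<ominus>\<^bsub>M\<^esub> a \<odot>\<^bsub>M\<^esub> (u \<odot>\<^bsub>M\<^esub> p)"
    using abc cl p q by (intro add_cancel_mid) auto
  then have 3: "b \<odot>\<^bsub>M\<^esub> (A \<oplus>\<^bsub>M\<^esub> u \<odot>\<^bsub>M\<^esub> q) = a \<odot>\<^bsub>M\<^esub> (B \<ominus>\<^bsub>M\<^esub> u \<odot>\<^bsub>M\<^esub> p)"
    using abc cl p q by (simp add: smult_r_distr smult_minus_distr)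
  obtain \<nu> where nu: "\<nu> \<in> carrier M" "A \<oplus>\<^bsub>M\<^esub> u \<odot>\<^bsub>M\<^esub> q = a \<odot>\<^bsub>M\<^esub> \<nu>"
    using regular3D(4)[OF reg' _ _ 3] abc cl p q by auto
  have "a \<odot>\<^bsub>M\<^esub> (b \<odot>\<^bsub>M\<^esub> \<nu>) = a \<odot>\<^bsub>M\<^esub> (B \<ominus>\<^bsub>M\<^esub> u \<odot>\<^bsub>M\<^esub> p)"
    using 3 nu abc by (simp add: smult_lcomm[of a b])
  then have "b \<odot>\<^bsub>M\<^esub> \<nu> = B \<ominus>\<^bsub>M\<^esub> u \<odot>\<^bsub>M\<^esub> p"
    using regular3_cancel[OF reg'] abc cl p nu by simp
  then have "B \<oplus>\<^bsub>M\<^esub> u \<odot>\<^bsub>M\<^esub> (\<ominus>\<^bsub>M\<^esub> p) = b \<odot>\<^bsub>M\<^esub> \<nu>"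
    using abc p by (simp add: M.minus_eq smult_r_minus)
  then show ?thesis
    using nu L p q unfolding A_def B_def L_def a_def b_def u_def by blast
qed

lemma transversal_stable:
  assumes S: "finite S" "S \<subseteq> carrier M" "module_span R M S = carrier M"
    and J: "ideal J R" and rel: "\<And>c s. \<lbrakk>c \<in> relations S; s \<in> S\<rbrakk> \<Longrightarrow> c s \<in> J"
    and D0: "D0 \<in> Der" "D0 f \<in> J"
    and Da: "Da \<in> Der" and Db: "Db \<in> Der" and Dc: "Dc \<in> Der"
    and reg: "regular3 (Da f) (Db f) (Dc f)" and r: "r \<in> relations S" and s: "s \<in> S"
  shows "D0 (r s) \<in> J"
proof -
  define a b c u where "a = Da f" and "b = Db f" and "c = Dc f" and "u = D0 f"
  have abc: "a \<in> carrier R" "b \<in> carrier R" "c \<in> carrier R" "u \<in> carrier R"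
    using assms Der_closed by (auto simp: a_def b_def c_def u_def)
  have reg': "regular3 a b c" using reg by (simp add: a_def b_def c_def)
  define A B L where "A = nab (koszul D0 Da)" and "B = nab (koszul D0 Db)" and "L = nab (koszul Da Db)"
  have ex: "\<forall>n\<in>S. \<exists>w. fst w \<in> carrier M \<and> fst (snd w) \<in> carrier M \<and> snd (snd w) \<in> carrier M \<and>
    A n \<oplus>\<^bsub>M\<^esub> u \<odot>\<^bsub>M\<^esub> snd (snd w) = a \<odot>\<^bsub>M\<^esub> fst w \<and>
    B n \<oplus>\<^bsub>M\<^esub> u \<odot>\<^bsub>M\<^esub> (\<ominus>\<^bsub>M\<^esub> fst (snd w)) = b \<odot>\<^bsub>M\<^esub> fst w \<and>
    L n = a \<odot>\<^bsub>M\<^esub> fst (snd w) \<oplus>\<^bsub>M\<^esub> b \<odot>\<^bsub>M\<^esub> snd (snd w)"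
  proof
    fix n assume "n \<in> S"
    then obtain v p q where "v \<in> carrier M" "p \<in> carrier M" "q \<in> carrier M"
      "A n \<oplus>\<^bsub>M\<^esub> u \<odot>\<^bsub>M\<^esub> q = a \<odot>\<^bsub>M\<^esub> v"
      "B n \<oplus>\<^bsub>M\<^esub> u \<odot>\<^bsub>M\<^esub> (\<ominus>\<^bsub>M\<^esub> p) = b \<odot>\<^bsub>M\<^esub> v"
      "L n = a \<odot>\<^bsub>M\<^esub> p \<oplus>\<^bsub>M\<^esub> b \<odot>\<^bsub>M\<^esub> q"
      using extension_vector[OF D0(1) Da Db Dc reg, of n] S(2)
      unfolding A_def B_def L_def a_def b_def u_def by blast
    then show "\<exists>w. fst w \<in> carrier M \<and> fst (snd w) \<in> carrier M \<and> snd (snd w) \<in> carrier M \<and>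
      A n \<oplus>\<^bsub>M\<^esub> u \<odot>\<^bsub>M\<^esub> snd (snd w) = a \<odot>\<^bsub>M\<^esub> fst w \<and>
      B n \<oplus>\<^bsub>M\<^esub> u \<odot>\<^bsub>M\<^esub> (\<ominus>\<^bsub>M\<^esub> fst (snd w)) = b \<odot>\<^bsub>M\<^esub> fst w \<and>
      L n = a \<odot>\<^bsub>M\<^esub> fst (snd w) \<oplus>\<^bsub>M\<^esub> b \<odot>\<^bsub>M\<^esub> snd (snd w)"
      by (intro exI[of _ "(v, p, q)"]) simp
  qed
  obtain W where W: "\<forall>n\<in>S. fst (W n) \<in> carrier M \<and> fst (snd (W n)) \<in> carrier M \<and> snd (snd (W n)) \<in> carrier M \<and>
    A n \<oplus>\<^bsub>M\<^esub> u \<odot>\<^bsub>M\<^esub> snd (snd (W n)) = a \<odot>\<^bsub>M\<^esub> fst (W n) \<and>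
    B n \<oplus>\<^bsub>M\<^esub> u \<odot>\<^bsub>M\<^esub> (\<ominus>\<^bsub>M\<^esub> fst (snd (W n))) = b \<odot>\<^bsub>M\<^esub> fst (W n) \<and>
    L n = a \<odot>\<^bsub>M\<^esub> fst (snd (W n)) \<oplus>\<^bsub>M\<^esub> b \<odot>\<^bsub>M\<^esub> snd (snd (W n))"
    using bchoice[OF ex] by (elim exE)
  \<comment> \<open>The sign change makes \<open>v\<close>, \<open>q\<close>, \<open>p\<close> stand
    uniformly for the values of \<open>nab\<close> on \<open>D0\<close>, \<open>Da\<close>,
    \<open>Db\<close>.\<close>
  define v p q where "v = (\<lambda>n. fst (W n))" and "p = (\<lambda>n. \<ominus>\<^bsub>M\<^esub> fst (snd (W n)))" and "q = (\<lambda>n. snd (snd (W n)))"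
  have vpq: "v n \<in> carrier M" "p n \<in> carrier M" "q n \<in> carrier M"
    "A n \<oplus>\<^bsub>M\<^esub> u \<odot>\<^bsub>M\<^esub> q n = a \<odot>\<^bsub>M\<^esub> v n" "B n \<oplus>\<^bsub>M\<^esub> u \<odot>\<^bsub>M\<^esub> p n = b \<odot>\<^bsub>M\<^esub> v n"
    "L n \<oplus>\<^bsub>M\<^esub> a \<odot>\<^bsub>M\<^esub> p n = b \<odot>\<^bsub>M\<^esub> q n" if n: "n \<in> S" for n
  proof -
    note W' = bspec[OF W n]
    show "v n \<in> carrier M" "p n \<in> carrier M" "q n \<in> carrier M"
      "A n \<oplus>\<^bsub>M\<^esub> u \<odot>\<^bsub>M\<^esub> q n = a \<odot>\<^bsub>M\<^esub> v n" "B n \<oplus>\<^bsub>M\<^esub> u \<odot>\<^bsub>M\<^esub> p n = b \<odot>\<^bsub>M\<^esub> v n"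
      using W' by (auto simp: v_def p_def q_def)
    show "L n \<oplus>\<^bsub>M\<^esub> a \<odot>\<^bsub>M\<^esub> p n = b \<odot>\<^bsub>M\<^esub> q n"
      using W' abc M.a_comm[of "a \<odot>\<^bsub>M\<^esub> fst (snd (W n))" "b \<odot>\<^bsub>M\<^esub> snd (snd (W n))"]
      by (simp add: p_def q_def smult_r_minus M.a_assoc M.r_neg)
  qed
  have rc: "r n \<in> carrier R" "n \<in> carrier M" if "n \<in> S" for n
    using r S that by (auto simp: relations_def)
  \<comment> \<open>The formal derivative of the relation \<open>r\<close>: \<open>x\<close> stands
    for the differentiated coefficients, \<open>y\<close> for the differentiated generators. It
    vanishes whenever both come from a genuine \<open>nab\<close>.\<close>
  define \<Phi> where "\<Phi> = (\<lambda>x y. \<Oplus>\<^bsub>M\<^esub>n\<in>S. x n \<odot>\<^bsub>M\<^esub> n \<oplus>\<^bsub>M\<^esub> r n \<odot>\<^bsub>M\<^esub> y n)"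
  have \<Phi>_closed: "\<Phi> x y \<in> carrier M" if "x \<in> S \<rightarrow> carrier R" "y \<in> S \<rightarrow> carrier M" for x y
    unfolding \<Phi>_def by (rule M.finsum_closed) (use that rc in \<open>auto simp: Pi_iff\<close>)
  have \<Phi>_smult: "e \<odot>\<^bsub>M\<^esub> \<Phi> x y = \<Phi> (\<lambda>n. e \<otimes>\<^bsub>R\<^esub> x n) (\<lambda>n. e \<odot>\<^bsub>M\<^esub> y n)"
    if "e \<in> carrier R" "x \<in> S \<rightarrow> carrier R" "y \<in> S \<rightarrow> carrier M" for e x y
  proof -
    have "e \<odot>\<^bsub>M\<^esub> \<Phi> x y = (\<Oplus>\<^bsub>M\<^esub>n\<in>S. e \<odot>\<^bsub>M\<^esub> (x n \<odot>\<^bsub>M\<^esub> n \<oplus>\<^bsub>M\<^esub> r n \<odot>\<^bsub>M\<^esub> y n))"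
      unfolding \<Phi>_def by (rule finsum_smult_ldistr) (use that rc S in \<open>auto simp: Pi_iff\<close>)
    also have "\<dots> = \<Phi> (\<lambda>n. e \<otimes>\<^bsub>R\<^esub> x n) (\<lambda>n. e \<odot>\<^bsub>M\<^esub> y n)"
      unfolding \<Phi>_def
      by (rule M.finsum_cong') (use that rc in \<open>auto simp: smult_r_distr smult_assoc1 Pi_iff smult_lcomm[of e]\<close>)
    finally show ?thesis .
  qed
  have \<Phi>_add: "\<Phi> x y \<oplus>\<^bsub>M\<^esub> \<Phi> x' y' = \<Phi> x'' y''"
    if "x \<in> S \<rightarrow> carrier R" "y \<in> S \<rightarrow> carrier M" "x' \<in> S \<rightarrow> carrier R" "y' \<in> S \<rightarrow> carrier M"
      "\<And>n. n \<in> S \<Longrightarrow> x'' n = x n \<oplus>\<^bsub>R\<^esub> x' n" "\<And>n. n \<in> S \<Longrightarrow> y'' n = y n \<oplus>\<^bsub>M\<^esub> y' n" for x y x' y' x'' y''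
  proof -
    have "\<Phi> x y \<oplus>\<^bsub>M\<^esub> \<Phi> x' y' =
      (\<Oplus>\<^bsub>M\<^esub>n\<in>S. (x n \<odot>\<^bsub>M\<^esub> n \<oplus>\<^bsub>M\<^esub> r n \<odot>\<^bsub>M\<^esub> y n) \<oplus>\<^bsub>M\<^esub> (x' n \<odot>\<^bsub>M\<^esub> n \<oplus>\<^bsub>M\<^esub> r n \<odot>\<^bsub>M\<^esub> y' n))"
      unfolding \<Phi>_def by (rule M.finsum_addf[symmetric]) (use that rc in \<open>auto simp: Pi_iff\<close>)
    also have "\<dots> = \<Phi> x'' y''"
      unfolding \<Phi>_def
      by (rule M.finsum_cong')
        (use that rc in \<open>auto simp: smult_r_distr smult_l_distr Pi_iff M.a_ac\<close>)
    finally show ?thesis .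
  qed
  have K: "\<Phi> (\<lambda>n. koszul D E (r n)) (\<lambda>n. nab (koszul D E) n) = \<zero>\<^bsub>M\<^esub>" if "D \<in> Der" "E \<in> Der" for D E
    unfolding \<Phi>_def by (rule nab_relation) (use that koszul_Der koszul_f S r in auto)
  have Dr: "D (r n) \<in> carrier R" if "D \<in> Der" "n \<in> S" for D n
    by (rule Der_closed) (use rc that in auto)
  have kr: "koszul D E (r n) \<in> carrier R" "nab (koszul D E) n \<in> carrier M"
    if "D \<in> Der" "E \<in> Der" "n \<in> S" for D E n
    using Dr[OF koszul_Der[OF that(1,2)] that(3)]
      nab_closed[OF koszul_Der[OF that(1,2)] koszul_f[OF that(1,2)]] rc(2)[OF that(3)] by auto
  \<comment> \<open>The defects of the three substitutes on \<open>r\<close>. The next two equations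
    hold because the corresponding Koszul combinations have a genuine \<open>nab\<close> and hence
    no defect.\<close>
  define \<omega> w1 w2 where "\<omega> = \<Phi> (\<lambda>n. D0 (r n)) v" and "w1 = \<Phi> (\<lambda>n. Da (r n)) q" and "w2 = \<Phi> (\<lambda>n. Db (r n)) p"
  have cl: "\<omega> \<in> carrier M" "w1 \<in> carrier M" "w2 \<in> carrier M"
    unfolding \<omega>_def w1_def w2_def by (intro \<Phi>_closed; use Dr D0 Da Db vpq in auto)+
  have aw: "a \<odot>\<^bsub>M\<^esub> \<omega> = u \<odot>\<^bsub>M\<^esub> w1"
  proof -
    have "\<Phi> (\<lambda>n. koszul D0 Da (r n)) A \<oplus>\<^bsub>M\<^esub> \<Phi> (\<lambda>n. u \<otimes>\<^bsub>R\<^esub> Da (r n)) (\<lambda>n. u \<odot>\<^bsub>M\<^esub> q n) =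
       \<Phi> (\<lambda>n. a \<otimes>\<^bsub>R\<^esub> D0 (r n)) (\<lambda>n. a \<odot>\<^bsub>M\<^esub> v n)"
      by (rule \<Phi>_add)
        (use abc Dr D0 Da kr(1) kr(2)[OF D0(1) Da, folded A_def] vpq in
          \<open>auto simp: koszul_def[THEN fun_cong] a_def[symmetric] u_def[symmetric]
            R.l_minus R.a_assoc R.l_neg\<close>)
    then show ?thesis
      using K[OF D0(1) Da] abc Dr D0 Da vpq cl
      by (simp add: A_def \<omega>_def w1_def \<Phi>_smult Pi_def \<Phi>_closed)
  qed
  have bw: "b \<odot>\<^bsub>M\<^esub> w1 = a \<odot>\<^bsub>M\<^esub> w2"
  proof -
    have "\<Phi> (\<lambda>n. koszul Da Db (r n)) L \<oplus>\<^bsub>M\<^esub> \<Phi> (\<lambda>n. a \<otimes>\<^bsub>R\<^esub> Db (r n)) (\<lambda>n. a \<odot>\<^bsub>M\<^esub> p n) =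
       \<Phi> (\<lambda>n. b \<otimes>\<^bsub>R\<^esub> Da (r n)) (\<lambda>n. b \<odot>\<^bsub>M\<^esub> q n)"
      by (rule \<Phi>_add)
        (use abc Dr Da Db kr(1) kr(2)[OF Da Db, folded L_def] vpq in
          \<open>auto simp: koszul_def[THEN fun_cong] a_def[symmetric] b_def[symmetric]
            R.l_minus R.a_assoc R.l_neg\<close>)
    then show ?thesis
      using K[OF Da Db] abc Dr Da Db vpq cl
      by (simp add: L_def w1_def w2_def \<Phi>_smult Pi_def \<Phi>_closed)
  qed
  \<comment> \<open>Regularity of \<open>b\<close> modulo \<open>a\<close> divides \<open>w1\<close>
    by \<open>a\<close>; cancelling \<open>a\<close> in the first equation then puts the defect in
    \<open>u M\<close>.\<close>
  obtain w3 where w3: "w3 \<in> carrier M" "w1 = a \<odot>\<^bsub>M\<^esub> w3"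
    using regular3D(4)[OF reg' cl(2,3) bw] by auto
  have "a \<odot>\<^bsub>M\<^esub> \<omega> = a \<odot>\<^bsub>M\<^esub> (u \<odot>\<^bsub>M\<^esub> w3)"
    using aw w3 abc by (simp add: smult_lcomm[of a u])
  then have "\<omega> = u \<odot>\<^bsub>M\<^esub> w3" using regular3_cancel[OF reg' cl(1)] w3 abc by simp
  then have eq: "(\<Oplus>\<^bsub>M\<^esub>n\<in>S. D0 (r n) \<odot>\<^bsub>M\<^esub> n \<oplus>\<^bsub>M\<^esub> r n \<odot>\<^bsub>M\<^esub> v n) = D0 f \<odot>\<^bsub>M\<^esub> w3"
    by (simp add: \<omega>_def \<Phi>_def u_def)
  show ?thesis
    by (rule relation_coeff_in_ideal[where S = S and J = J and x = "\<lambda>s. D0 (r s)" and r = r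
          and u = "D0 f" and y = v and w = w3, OF S J])
      (use r rel Dr D0 vpq w3 eq s in auto)
qed

end

section \<open>Series of bounded degree in one variable and division\<close>

lemma (in abelian_group) neg_cancel_outer:
  "\<lbrakk>x \<in> carrier G; y \<in> carrier G\<rbrakk> \<Longrightarrow> x \<oplus> (y \<oplus> \<ominus> x) = y"
  by (simp add: a_lcomm[of x y] r_neg)

context power_series_ring
begin

definition deg_le :: "nat \<Rightarrow> nat \<Rightarrow> ((nat \<Rightarrow> nat) \<Rightarrow> 'a) set"
  where "deg_le i k = {g \<in> carrier P. \<forall>m\<in>monomials d. k < m i \<longrightarrow> g m = \<zero>}"

lemma deg_leI: "\<lbrakk>g \<in> carrier P; \<And>m. \<lbrakk>m \<in> monomials d; k < m i\<rbrakk> \<Longrightarrow> g m = \<zero>\<rbrakk> \<Longrightarrow> g \<in> deg_le i k"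
  unfolding deg_le_def by auto

lemma deg_leD: "\<lbrakk>g \<in> deg_le i k; m \<in> monomials d; k < m i\<rbrakk> \<Longrightarrow> g m = \<zero>"
  unfolding deg_le_def by auto

lemma deg_le_carrier: "g \<in> deg_le i k \<Longrightarrow> g \<in> carrier P"
  unfolding deg_le_def by auto

lemma deg_le_zero: "\<zero>\<^bsub>P\<^esub> \<in> deg_le i k"
  by (rule deg_leI) auto

lemma deg_le_add: "\<lbrakk>g \<in> deg_le i k; h \<in> deg_le i k\<rbrakk> \<Longrightarrow> g \<oplus>\<^bsub>P\<^esub> h \<in> deg_le i k"
  by (rule deg_leI) (auto simp: deg_leD deg_le_carrier)

lemma deg_le_uminus: "g \<in> deg_le i k \<Longrightarrow> \<ominus>\<^bsub>P\<^esub> g \<in> deg_le i k"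
  by (rule deg_leI) (auto simp: deg_leD deg_le_carrier coeff_uminus)

lemma deg_le_mult:
  assumes g: "g \<in> deg_le i k" and h: "h \<in> deg_le i l"
  shows "g \<otimes>\<^bsub>P\<^esub> h \<in> deg_le i (k + l)"
proof (rule deg_leI)
  note gh = deg_le_carrier[OF g] deg_le_carrier[OF h]
  then show "g \<otimes>\<^bsub>P\<^esub> h \<in> carrier P" by simp
  fix m assume m: "m \<in> monomials d" and w: "k + l < m i"
  show "(g \<otimes>\<^bsub>P\<^esub> h) m = \<zero>"
    unfolding coeff_mult[OF m]
  proof (rule finsum_all_zero)
    fix a assume a: "a \<in> below m"
    have c: "a \<in> monomials d" "(\<lambda>i. m i - a i) \<in> monomials d"
      using monomials_below[OF m a] monomials_diff[OF m] by auto
    have "k < a i \<or> l < m i - a i" using w by arith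
    then show "g a \<otimes> h (\<lambda>i. m i - a i) = \<zero>"
      using deg_leD[OF g c(1)] deg_leD[OF h c(2)] c gh by auto
  qed
qed

lemma deg_le_one: "\<one>\<^bsub>P\<^esub> \<in> deg_le i k"
  by (rule deg_leI) (auto simp: coeff_one ps_one_closed)

lemma deg_le_pow: "g \<in> deg_le i 0 \<Longrightarrow> g [^]\<^bsub>P\<^esub> (n::nat) \<in> deg_le i 0"
proof (induction n)
  case (Suc n)
  then show ?case using deg_le_mult[of "g [^]\<^bsub>P\<^esub> n" i 0 g 0] by simp
qed (simp add: deg_le_one)

lemma deg_le_var: "i \<noteq> j \<Longrightarrow> ps_var K d j \<in> deg_le i 0"
  by (rule deg_leI) (auto simp: ps_var_monom coeff_monom)

lemma deg_le_finsum: "(\<And>x. x \<in> B \<Longrightarrow> g x \<in> deg_le i k) \<Longrightarrow> finsum P g B \<in> deg_le i k"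
proof (induction B rule: infinite_finite_induct)
  case (insert x F)
  then have "g \<in> F \<rightarrow> carrier P" "g x \<in> carrier P" using deg_le_carrier by auto
  then show ?case using insert by (simp add: deg_le_add)
qed (auto simp: deg_le_zero)

lemma deg_le_deriv: "\<lbrakk>g \<in> deg_le i k; j \<le> d\<rbrakk> \<Longrightarrow> ps_deriv j g \<in> deg_le i k"
  by (rule deg_leI) (auto simp: deg_le_carrier coeff_deriv deg_leD monomials_add_unit)

lemma deg_le_0_deriv: "\<lbrakk>g \<in> deg_le i 0; i \<le> d\<rbrakk> \<Longrightarrow> ps_deriv i g = \<zero>\<^bsub>P\<^esub>"
  by (rule ps_eqI) (auto simp: deg_le_carrier coeff_deriv deg_leD monomials_add_unit)

lemma deg_le_1_deriv: "\<lbrakk>g \<in> deg_le i 1; i \<le> d\<rbrakk> \<Longrightarrow> ps_deriv i (ps_deriv i g) = \<zero>\<^bsub>P\<^esub>"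
  by (rule ps_eqI) (auto simp: deg_le_carrier coeff_deriv deg_leD monomials_add_unit)

lemma square_quotient:
  assumes g: "g \<in> carrier P" and i: "i \<le> d"
  shows "\<exists>q\<in>carrier P. \<exists>r\<in>deg_le i 1. g = ps_var K d i [^]\<^bsub>P\<^esub> (2::nat) \<otimes>\<^bsub>P\<^esub> q \<oplus>\<^bsub>P\<^esub> r"
proof -
  define e where "e = (\<lambda>j. if j = i then 2 else (0::nat))"
  have e: "e \<in> monomials d" unfolding e_def by (rule monomials_single[OF i])
  define q where "q = (\<lambda>m\<in>monomials d. g (\<lambda>j. m j + e j))"
  define r where "r = (\<lambda>m\<in>monomials d. if m i \<le> 1 then g m else \<zero>)"
  have q: "q \<in> carrier P" unfolding q_def by (rule ps_memI) (use g monomials_add[OF _ e] in auto)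
  have rP: "r \<in> carrier P" unfolding r_def by (rule ps_memI) (use g in auto)
  then have r: "r \<in> deg_le i 1" by (rule deg_leI) (auto simp: r_def)
  have "g = ps_var K d i [^]\<^bsub>P\<^esub> (2::nat) \<otimes>\<^bsub>P\<^esub> q \<oplus>\<^bsub>P\<^esub> r"
  proof (rule ps_eqI)
    fix m assume m: "m \<in> monomials d"
    have b: "e \<in> below m \<longleftrightarrow> 2 \<le> m i" unfolding below_def e_def by (auto dest: spec[of _ i])
    have vp: "ps_var K d i [^]\<^bsub>P\<^esub> (2::nat) = ps_monom e" unfolding ps_var_pow[OF i] e_def ..
    have "q (\<lambda>j. m j - e j) = g m" if "2 \<le> m i"
    proof -
      have "(\<lambda>j. m j - e j + e j) = m" using that by (auto simp: e_def)
      then show ?thesis using monomials_diff[OF m, of e] by (simp add: q_def)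
    qed
    then show "g m = (ps_var K d i [^]\<^bsub>P\<^esub> (2::nat) \<otimes>\<^bsub>P\<^esub> q \<oplus>\<^bsub>P\<^esub> r) m"
      unfolding vp using coeff_monom_mult[OF q m, of e] b m g by (auto simp: r_def)
  qed (use g q rP i in auto)
  then show ?thesis using q r by blast
qed

text \<open>Weierstrass division by \<open>z\<^sub>i\<^sup>2 + h\<close>, where \<open>h\<close> is free of \<open>z\<^sub>i\<close>: replacing
  \<open>z\<^sub>i\<^sup>2\<close> by \<open>-h\<close> repeatedly gives the quotient as the series \<open>\<Sum> (-h)\<^sup>n a\<^sub>n\<^sub>+\<^sub>1\<close>.\<close>

lemma division:
  assumes a: "a \<in> carrier P" and i: "i \<le> d" and h: "h \<in> max_ps" "h \<in> deg_le i 0"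
  shows "\<exists>q\<in>carrier P. a \<ominus>\<^bsub>P\<^esub> q \<otimes>\<^bsub>P\<^esub> (ps_var K d i [^]\<^bsub>P\<^esub> (2::nat) \<oplus>\<^bsub>P\<^esub> h) \<in> deg_le i 1"
proof -
  define s where "s = ps_var K d i [^]\<^bsub>P\<^esub> (2::nat)"
  have s: "s \<in> carrier P" by (simp add: s_def)
  have "\<forall>g\<in>carrier P. \<exists>q. q \<in> carrier P \<and> (\<exists>r\<in>deg_le i 1. g = s \<otimes>\<^bsub>P\<^esub> q \<oplus>\<^bsub>P\<^esub> r)"
    using square_quotient[OF _ i] unfolding s_def by blast
  from bchoice[OF this] obtain \<tau> where
    tau: "\<forall>g\<in>carrier P. \<tau> g \<in> carrier P \<and> (\<exists>r\<in>deg_le i 1. g = s \<otimes>\<^bsub>P\<^esub> \<tau> g \<oplus>\<^bsub>P\<^esub> r)"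
    by (elim exE)
  \<comment> \<open>The coefficients of the quotient series: iterated quotients of \<open>a\<close>
    by the square of the variable, each step leaving a remainder of degree at most one.\<close>
  define b where "b n = (\<tau> ^^ n) a" for n
  have b: "b n \<in> carrier P" for n unfolding b_def using a tau by (induction n) auto
  have b_step: "\<exists>r\<in>deg_le i 1. b n = s \<otimes>\<^bsub>P\<^esub> b (Suc n) \<oplus>\<^bsub>P\<^esub> r" for n
    using bspec[OF tau b[of n]] by (simp add: b_def)
  have hP: "h \<in> carrier P" using h max_ps_carrier by auto
  define e where "e = \<ominus>\<^bsub>P\<^esub> h"
  have e: "e \<in> carrier P" "e \<in> ord_ge (\<lambda>_. 1) 1" "e \<in> deg_le i 0"
    using h hP unfolding e_def max_ps_def by (auto intro: ord_ge_uminus deg_le_uminus)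
  have en: "e [^]\<^bsub>P\<^esub> n \<otimes>\<^bsub>P\<^esub> x \<in> ord_ge (\<lambda>_. 1) n" if "x \<in> carrier P" for n :: nat and x
    using ord_ge_mult[OF ord_ge_pow[OF e(2), of n], of x 0] that by (simp add: ord_ge_0)
  define c where "c n = e [^]\<^bsub>P\<^esub> n \<otimes>\<^bsub>P\<^esub> b (Suc n)" for n
  have c: "c n \<in> carrier P" "c n \<in> ord_ge (\<lambda>_. 1) n" for n
    using e b en unfolding c_def by auto
  obtain q where q: "q \<in> carrier P"
    "\<And>N. q \<ominus>\<^bsub>P\<^esub> (\<Oplus>\<^bsub>P\<^esub>n\<in>{..<N}. c n) \<in> ord_ge (\<lambda>_. 1) N"
    using ord_ge_complete[OF c(2)] by blast
  let ?f = "s \<oplus>\<^bsub>P\<^esub> h"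
  \<comment> \<open>Exact division after \<open>N\<close> steps, with an unreduced tail of order at
    least \<open>N\<close>. The remainders keep degree at most one because powers of
    \<open>e\<close> are free of the variable.\<close>
  have partial: "\<exists>r\<in>deg_le i 1. a = (\<Oplus>\<^bsub>P\<^esub>n\<in>{..<N}. c n) \<otimes>\<^bsub>P\<^esub> ?f \<oplus>\<^bsub>P\<^esub> r \<oplus>\<^bsub>P\<^esub> e [^]\<^bsub>P\<^esub> N \<otimes>\<^bsub>P\<^esub> b N" for N
  proof (induction N)
    case 0
    show ?case using a s hP by (intro bexI[of _ "\<zero>\<^bsub>P\<^esub>"]) (auto simp: b_def deg_le_zero)
  next
    case (Suc N)
    then obtain r where r: "r \<in> deg_le i 1"
      "a = (\<Oplus>\<^bsub>P\<^esub>n\<in>{..<N}. c n) \<otimes>\<^bsub>P\<^esub> ?f \<oplus>\<^bsub>P\<^esub> r \<oplus>\<^bsub>P\<^esub> e [^]\<^bsub>P\<^esub> N \<otimes>\<^bsub>P\<^esub> b N" by auto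
    obtain r' where r': "r' \<in> deg_le i 1" "b N = s \<otimes>\<^bsub>P\<^esub> b (Suc N) \<oplus>\<^bsub>P\<^esub> r'" using b_step by auto
    define S V where "S = (\<Oplus>\<^bsub>P\<^esub>n\<in>{..<N}. c n)" and "V = e [^]\<^bsub>P\<^esub> N"
    define Y where "Y = b (Suc N)"
    have cl: "S \<in> carrier P" "V \<in> carrier P" "Y \<in> carrier P" "r \<in> carrier P" "r' \<in> carrier P"
      using c e b r(1) r'(1) deg_le_carrier by (auto simp: S_def V_def Y_def)
    have sum: "(\<Oplus>\<^bsub>P\<^esub>n\<in>{..<Suc N}. c n) = V \<otimes>\<^bsub>P\<^esub> Y \<oplus>\<^bsub>P\<^esub> S"
      using c by (simp add: lessThan_Suc Pi_def S_def V_def Y_def c_def)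
    have ee: "e [^]\<^bsub>P\<^esub> Suc N \<otimes>\<^bsub>P\<^esub> b (Suc N) = \<ominus>\<^bsub>P\<^esub> (V \<otimes>\<^bsub>P\<^esub> h \<otimes>\<^bsub>P\<^esub> Y)"
      using cl hP by (simp add: V_def Y_def e_def P.r_minus P.l_minus)
    have "a = S \<otimes>\<^bsub>P\<^esub> ?f \<oplus>\<^bsub>P\<^esub> r \<oplus>\<^bsub>P\<^esub> V \<otimes>\<^bsub>P\<^esub> (s \<otimes>\<^bsub>P\<^esub> Y \<oplus>\<^bsub>P\<^esub> r')"
      using r(2) r'(2) by (simp add: S_def V_def Y_def)
    also have "\<dots> = (V \<otimes>\<^bsub>P\<^esub> Y \<oplus>\<^bsub>P\<^esub> S) \<otimes>\<^bsub>P\<^esub> ?f \<oplus>\<^bsub>P\<^esub> (r \<oplus>\<^bsub>P\<^esub> V \<otimes>\<^bsub>P\<^esub> r') \<oplus>\<^bsub>P\<^esub>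
        \<ominus>\<^bsub>P\<^esub> (V \<otimes>\<^bsub>P\<^esub> h \<otimes>\<^bsub>P\<^esub> Y)"
      using cl s hP by (simp add: P.r_distr P.l_distr P.a_ac P.m_ac P.r_neg1 P.r_neg2 P.neg_cancel_outer)
    finally have "a = (\<Oplus>\<^bsub>P\<^esub>n\<in>{..<Suc N}. c n) \<otimes>\<^bsub>P\<^esub> ?f \<oplus>\<^bsub>P\<^esub> (r \<oplus>\<^bsub>P\<^esub> V \<otimes>\<^bsub>P\<^esub> r') \<oplus>\<^bsub>P\<^esub>
        e [^]\<^bsub>P\<^esub> Suc N \<otimes>\<^bsub>P\<^esub> b (Suc N)"
      unfolding sum ee .
    moreover have "r \<oplus>\<^bsub>P\<^esub> V \<otimes>\<^bsub>P\<^esub> r' \<in> deg_le i 1"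
      using deg_le_add[OF r(1)] deg_le_mult[OF deg_le_pow[OF e(3), of N] r'(1)] by (simp add: V_def)
    ultimately show ?case by blast
  qed
  have "a \<ominus>\<^bsub>P\<^esub> q \<otimes>\<^bsub>P\<^esub> ?f \<in> deg_le i 1"
  proof (rule deg_leI)
    fix m assume m: "m \<in> monomials d" and mi: "1 < m i"
    \<comment> \<open>Beyond the weight of \<open>m\<close>, so that neither the tail nor the
      truncation error of \<open>q\<close> reaches the coefficient at \<open>m\<close>.\<close>
    define N where "N = Suc (weight (\<lambda>_. 1) m)"
    obtain r where r: "r \<in> deg_le i 1"
      "a = (\<Oplus>\<^bsub>P\<^esub>n\<in>{..<N}. c n) \<otimes>\<^bsub>P\<^esub> ?f \<oplus>\<^bsub>P\<^esub> r \<oplus>\<^bsub>P\<^esub> e [^]\<^bsub>P\<^esub> N \<otimes>\<^bsub>P\<^esub> b N" using partial by blast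
    define S Z where "S = (\<Oplus>\<^bsub>P\<^esub>n\<in>{..<N}. c n)" and "Z = e [^]\<^bsub>P\<^esub> N \<otimes>\<^bsub>P\<^esub> b N"
    have cl: "S \<in> carrier P" "Z \<in> carrier P" "r \<in> carrier P" "?f \<in> carrier P"
      using c e b r(1) s hP deg_le_carrier by (auto simp: S_def Z_def)
    have "(q \<ominus>\<^bsub>P\<^esub> S) \<otimes>\<^bsub>P\<^esub> ?f \<in> ord_ge (\<lambda>_. 1) N"
      using ord_ge_mult[OF q(2)[of N], of ?f 0] cl by (simp add: ord_ge_0 S_def)
    then have z1: "((q \<ominus>\<^bsub>P\<^esub> S) \<otimes>\<^bsub>P\<^esub> ?f) m = \<zero>" by (rule ord_geD[OF _ m]) (simp add: N_def)
    have "Z \<in> ord_ge (\<lambda>_. 1) N" unfolding Z_def by (rule en[OF b])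
    then have z2: "Z m = \<zero>" by (rule ord_geD[OF _ m]) (simp add: N_def)
    have z3: "r m = \<zero>" using deg_leD[OF r(1) m mi] .
    define F where "F = ?f"
    have F: "F \<in> carrier P" using cl by (simp add: F_def)
    have aSF: "a = S \<otimes>\<^bsub>P\<^esub> F \<oplus>\<^bsub>P\<^esub> r \<oplus>\<^bsub>P\<^esub> Z" using r(2) by (simp add: S_def Z_def F_def)
    have "a \<ominus>\<^bsub>P\<^esub> q \<otimes>\<^bsub>P\<^esub> F = r \<oplus>\<^bsub>P\<^esub> Z \<ominus>\<^bsub>P\<^esub> (q \<ominus>\<^bsub>P\<^esub> S) \<otimes>\<^bsub>P\<^esub> F"
      using cl q(1) F
      by (simp add: aSF P.minus_eq P.l_distr P.l_minus P.minus_add P.a_ac)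
    then show "(a \<ominus>\<^bsub>P\<^esub> q \<otimes>\<^bsub>P\<^esub> ?f) m = \<zero>"
      using z1 z2 z3 cl q(1) F m by (simp add: F_def[symmetric] K.minus_eq)
  qed (use a q(1) s hP in auto)
  then show ?thesis using q(1) unfolding s_def by blast
qed

end

section \<open>Double suspensions\<close>

locale double_suspension = power_series_field K d for K (structure) and d +
  fixes g
  assumes dim: "3 \<le> d" and g_max: "g \<in> max_ps"
    and g_free: "g \<in> deg_le (d - 1) 0" "g \<in> deg_le d 0"
begin

abbreviation w where "w \<equiv> ps_var K d (d - 1)"
abbreviation t where "t \<equiv> ps_var K d d"

definition f where "f = t [^]\<^bsub>P\<^esub> (2::nat) \<oplus>\<^bsub>P\<^esub> (w [^]\<^bsub>P\<^esub> (2::nat) \<oplus>\<^bsub>P\<^esub> g)"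

text \<open>\<open>\<partial>\<^sub>w + e \<partial>\<^sub>t\<close>; for \<open>e\<^sup>2 = -1\<close> this is, up to scaling, the derivative in one of the two
  coordinates \<open>w \<plusminus> e t\<close>, in which \<open>f = g + (w + e t) (w - e t)\<close>.\<close>

definition isotropic :: "'a \<Rightarrow> ((nat \<Rightarrow> nat) \<Rightarrow> 'a) \<Rightarrow> (nat \<Rightarrow> nat) \<Rightarrow> 'a"
  where "isotropic e = (\<lambda>x. \<one>\<^bsub>P\<^esub> \<otimes>\<^bsub>P\<^esub> ps_deriv (d - 1) x \<oplus>\<^bsub>P\<^esub> ps_const e \<otimes>\<^bsub>P\<^esub> ps_deriv d x)"

definition iso_coord :: "'a \<Rightarrow> (nat \<Rightarrow> nat) \<Rightarrow> 'a"
  where "iso_coord e = w \<oplus>\<^bsub>P\<^esub> ps_const e \<otimes>\<^bsub>P\<^esub> t"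

text \<open>For \<open>e\<close> a square root of -1 this is the prime
  \<open>(z_0, ..., z_(d-2), w + e t)\<close>, the series vanishing on an isotropic axis. As a core
  it is prime at once and contains every stable ideal inside the maximal ideal.\<close>

definition iso_prime :: "'a \<Rightarrow> ((nat \<Rightarrow> nat) \<Rightarrow> 'a) set"
  where "iso_prime e = stable_core (isotropic e) P max_ps"

definition horizontal_weight :: "nat \<Rightarrow> nat"
  where "horizontal_weight = (\<lambda>i. if i < d - 1 then 1 else 0)"

abbreviation hor where "hor n \<equiv> ord_ge horizontal_weight n"

lemma g_closed [simp]: "g \<in> carrier P" using g_max max_ps_carrier by auto
lemma f_closed [simp]: "f \<in> carrier P" unfolding f_def by simp

lemma var_max: "i \<le> d \<Longrightarrow> ps_var K d i \<in> max_ps"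
  unfolding max_ps_def using ord_ge_var[of i "\<lambda>_. 1"] by simp

lemma f_max: "f \<in> max_ps"
proof -
  interpret m: ideal max_ps P by (rule max_ps_ideal)
  have "w [^]\<^bsub>P\<^esub> (2::nat) \<in> max_ps" "t [^]\<^bsub>P\<^esub> (2::nat) \<in> max_ps"
    using var_max by (simp_all add: numeral_2_eq_2 m.I_l_closed)
  then show ?thesis unfolding f_def using g_max m.a_closed by auto
qed

lemma isotropic_derivation: "e \<in> carrier K \<Longrightarrow> ring_derivation P (isotropic e)"
  unfolding isotropic_def
  by (rule P.ring_derivation_comb) (auto intro: ps_deriv_derivation)

lemma deriv_square:
  assumes "i \<le> d" "x \<in> carrier P"
  shows "ps_deriv i (x [^]\<^bsub>P\<^esub> (2::nat)) = x \<otimes>\<^bsub>P\<^esub> ps_deriv i x \<oplus>\<^bsub>P\<^esub> x \<otimes>\<^bsub>P\<^esub> ps_deriv i x"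
  using assms by (simp add: numeral_2_eq_2 ps_deriv_mult)

lemma deriv_add:
  "\<lbrakk>i \<le> d; x \<in> carrier P; y \<in> carrier P\<rbrakk> \<Longrightarrow> ps_deriv i (x \<oplus>\<^bsub>P\<^esub> y) = ps_deriv i x \<oplus>\<^bsub>P\<^esub> ps_deriv i y"
  using ring_derivation.D_add[OF ps_deriv_derivation] .

lemma d_ne: "d - 1 \<noteq> d" "d \<noteq> d - 1" using dim by auto

lemma deriv_w_f: "ps_deriv (d - 1) f = w \<oplus>\<^bsub>P\<^esub> w"
  unfolding f_def using d_ne g_free(1)
  by (simp add: deriv_add deriv_square ps_deriv_var deg_le_0_deriv)

lemma deriv_t_f: "ps_deriv d f = t \<oplus>\<^bsub>P\<^esub> t"
  unfolding f_def using d_ne g_free(2)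
  by (simp add: deriv_add deriv_square ps_deriv_var deg_le_0_deriv)

lemma iso_coord_closed [simp]: "e \<in> carrier K \<Longrightarrow> iso_coord e \<in> carrier P"
  unfolding iso_coord_def by simp

lemma isotropic_f: "e \<in> carrier K \<Longrightarrow> isotropic e f = iso_coord e \<oplus>\<^bsub>P\<^esub> iso_coord e"
  unfolding isotropic_def iso_coord_def by (simp add: deriv_w_f deriv_t_f P.r_distr P.a_ac del: One_nat_def)

lemma deriv_const_mult:
  "\<lbrakk>i \<le> d; c \<in> carrier K; x \<in> carrier P\<rbrakk> \<Longrightarrow> ps_deriv i (ps_const c \<otimes>\<^bsub>P\<^esub> x) = ps_const c \<otimes>\<^bsub>P\<^esub> ps_deriv i x"
  by (simp add: ps_deriv_mult ps_deriv_const)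

lemma isotropic_coord:
  "\<lbrakk>e \<in> carrier K; c \<in> carrier K\<rbrakk> \<Longrightarrow> isotropic e (iso_coord c) = ps_const (\<one> \<oplus> e \<otimes> c)"
  unfolding isotropic_def iso_coord_def using d_ne
  by (simp add: deriv_add deriv_const_mult ps_deriv_var ps_const_mult ps_const_add ps_const_one)

lemma isotropic_max_kernel:
  assumes e: "e \<in> carrier K" "e \<otimes> e = \<ominus> \<one>"
  shows "isotropic e (iso_coord e) = \<zero>\<^bsub>P\<^esub>"
  using isotropic_coord[OF e(1) e(1)] e by (simp add: r_neg ps_const_zero)

lemma iso_coord_max: "e \<in> carrier K \<Longrightarrow> iso_coord e \<in> max_ps"
proof -
  interpret m: ideal max_ps P by (rule max_ps_ideal)
  show "e \<in> carrier K \<Longrightarrow> iso_coord e \<in> max_ps"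
    unfolding iso_coord_def by (intro m.a_closed m.I_l_closed var_max) auto
qed

lemma iso_prime_subset: "e \<in> carrier K \<Longrightarrow> iso_prime e \<subseteq> max_ps"
  unfolding iso_prime_def using ring_derivation.stable_core_subset[OF isotropic_derivation] .

lemma iso_prime_prime: "e \<in> carrier K \<Longrightarrow> primeideal (iso_prime e) P"
  unfolding iso_prime_def
  by (rule ring_derivation.stable_core_prime[OF isotropic_derivation])
    (auto simp: max_ps_prime nat_multiple_one_notin_max_ps)

text \<open>Adjoin \<open>iso_coord e\<close> to \<open>G\<close>. The derivative of
  \<open>f\<close> is twice that coordinate and the coordinate itself is killed, so the enlarged
  ideal is stable and lies in the core. The hypothesis quantifies over \<open>J\<close> because the
  derivative of a generator is controlled only modulo that of \<open>f\<close>, and the enlarged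
  ideal has to be a valid choice.\<close>

lemma iso_prime_contains:
  assumes e: "e \<in> carrier K" "e \<otimes> e = \<ominus> \<one>" and G: "G \<subseteq> max_ps"
    and D: "\<And>x J. \<lbrakk>x \<in> G; ideal J P; G \<subseteq> J; isotropic e f \<in> J\<rbrakk> \<Longrightarrow> isotropic e x \<in> J"
  shows "Idl\<^bsub>P\<^esub> G \<subseteq> iso_prime e"
proof -
  interpret E: ring_derivation P "isotropic e" by (rule isotropic_derivation[OF e(1)])
  let ?G = "insert (iso_coord e) G"
  have Gm: "?G \<subseteq> max_ps" using G iso_coord_max e by auto
  then have GP: "?G \<subseteq> carrier P" using max_ps_carrier by auto
  interpret J: ideal "Idl\<^bsub>P\<^esub> ?G" P by (rule P.genideal_ideal[OF GP])
  have self: "?G \<subseteq> Idl\<^bsub>P\<^esub> ?G" by (rule P.genideal_self[OF GP])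
  have "isotropic e f \<in> Idl\<^bsub>P\<^esub> ?G" using isotropic_f[OF e(1)] self J.a_closed by auto
  then have "isotropic e ` ?G \<subseteq> Idl\<^bsub>P\<^esub> ?G"
    using D[OF _ J.is_ideal] self isotropic_max_kernel[OF e] J.zero_closed by auto
  then have stab: "isotropic e a \<in> Idl\<^bsub>P\<^esub> ?G" if "a \<in> Idl\<^bsub>P\<^esub> ?G" for a
    using that by (rule E.genideal_stable[OF GP])
  have car: "Idl\<^bsub>P\<^esub> ?G \<subseteq> carrier P" by (rule subsetI) (rule J.Icarr)
  have "Idl\<^bsub>P\<^esub> ?G \<subseteq> iso_prime e"
    unfolding iso_prime_def
    by (rule E.stable_core_greatest[OF P.genideal_minimal[OF max_ps_ideal Gm] car stab])
  moreover have "Idl\<^bsub>P\<^esub> G \<subseteq> Idl\<^bsub>P\<^esub> ?G"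
    by (rule P.genideal_minimal[OF J.is_ideal]) (use self in auto)
  ultimately show ?thesis by auto
qed

text \<open>The isotropic field differentiates only along the two variables of weight zero, so it
  preserves the horizontal order.\<close>

lemma hor_subset_iso_prime:
  assumes e: "e \<in> carrier K"
  shows "hor 1 \<subseteq> iso_prime e"
proof -
  interpret E: ring_derivation P "isotropic e" by (rule isotropic_derivation[OF e])
  interpret h: ideal "hor 1" P by (rule ord_ge_ideal)
  show ?thesis
    unfolding iso_prime_def
  proof (rule E.stable_core_greatest)
    show "hor 1 \<subseteq> max_ps"
    proof
      fix x assume x: "x \<in> hor 1"
      then have "x (\<lambda>_. 0) = \<zero>" by (rule ord_geD) auto
      then show "x \<in> max_ps" using x ord_ge_carrier by (simp add: max_ps_iff)
    qed
    fix a assume a: "a \<in> hor 1"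
    have "ps_deriv i a \<in> hor 1" if "i = d - 1 \<or> i = d" for i
      by (rule ord_ge_deriv) (use that a in \<open>auto simp: horizontal_weight_def\<close>)
    then show "isotropic e a \<in> hor 1"
      unfolding isotropic_def using e by (intro h.a_closed h.I_l_closed) auto
  qed (use ord_ge_carrier in auto)
qed

lemma isotropic_hor: "\<lbrakk>e \<in> carrier K; a \<in> hor n\<rbrakk> \<Longrightarrow> isotropic e a \<in> hor n"
proof -
  assume e: "e \<in> carrier K" and a: "a \<in> hor n"
  interpret h: ideal "hor n" P by (rule ord_ge_ideal)
  have "ps_deriv i a \<in> hor n" if "i = d - 1 \<or> i = d" for i
    by (rule ord_ge_deriv) (use that a in \<open>auto simp: horizontal_weight_def\<close>)
  then show "isotropic e a \<in> hor n"
    unfolding isotropic_def using e by (intro h.a_closed h.I_l_closed) auto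
qed

text \<open>The Koszul derivation of the \<open>j\<close>-th partial and the isotropic field of the
  opposite sign. The sign is chosen so that the coefficient of the \<open>j\<close>-th partial is
  \<open>2 (w - e t)\<close>, which lies outside \<open>iso_prime e\<close>.\<close>

definition hamiltonian :: "'a \<Rightarrow> nat \<Rightarrow> ((nat \<Rightarrow> nat) \<Rightarrow> 'a) \<Rightarrow> (nat \<Rightarrow> nat) \<Rightarrow> 'a"
  where "hamiltonian e j = (\<lambda>x. isotropic (\<ominus> e) f \<otimes>\<^bsub>P\<^esub> ps_deriv j x \<oplus>\<^bsub>P\<^esub>
    (\<ominus>\<^bsub>P\<^esub> ps_deriv j f) \<otimes>\<^bsub>P\<^esub> isotropic (\<ominus> e) x)"

context
  fixes e
  assumes e: "e \<in> carrier K" "e \<otimes> e = \<ominus> \<one>"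
begin

lemma neg_sqrt_minus_one: "\<ominus> e \<in> carrier K" "\<ominus> e \<otimes> \<ominus> e = \<ominus> \<one>"
  using e by (auto simp: l_minus r_minus)

lemma iso_closed [simp]: "x \<in> carrier P \<Longrightarrow> isotropic (\<ominus> e) x \<in> carrier P"
  using ring_derivation.D_closed[OF isotropic_derivation[OF neg_sqrt_minus_one(1)]] .

lemma hamiltonian_derivation: "j \<le> d \<Longrightarrow> ring_derivation P (hamiltonian e j)"
  unfolding hamiltonian_def
  by (rule P.ring_derivation_comb) (auto intro: ps_deriv_derivation isotropic_derivation neg_sqrt_minus_one)

lemma hamiltonian_f: "j \<le> d \<Longrightarrow> hamiltonian e j f = \<zero>\<^bsub>P\<^esub>"
  unfolding hamiltonian_def
  by (simp add: P.l_minus P.m_comm[of "isotropic (\<ominus> e) f"] P.r_neg)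

lemma deriv_iso_coord: "\<lbrakk>j < d - 1; c \<in> carrier K\<rbrakk> \<Longrightarrow> ps_deriv j (iso_coord c) = \<zero>\<^bsub>P\<^esub>"
proof -
  assume a: "j < d - 1" "c \<in> carrier K"
  then have "j \<noteq> d" "j \<noteq> d - 1" "j \<le> d" by auto
  then show ?thesis
    unfolding iso_coord_def using a by (simp add: deriv_add deriv_const_mult ps_deriv_var del: One_nat_def)
qed

text \<open>The coefficient is twice an isotropic coordinate: free of \<open>z_j\<close> and killed
  by the isotropic field it belongs to. Its powers therefore pass through repeated Hamiltonian
  derivations as constants.\<close>

lemma hamiltonian_coeff: "j < d - 1 \<Longrightarrow> hamiltonian e j (isotropic (\<ominus> e) f) = \<zero>\<^bsub>P\<^esub>"
proof -
  assume j: "j < d - 1"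
  interpret D: ring_derivation P "hamiltonian e j" by (rule hamiltonian_derivation) (use j in auto)
  have "hamiltonian e j (iso_coord (\<ominus> e)) = \<zero>\<^bsub>P\<^esub>"
    unfolding hamiltonian_def using j neg_sqrt_minus_one by (simp add: deriv_iso_coord isotropic_max_kernel)
  then show ?thesis using neg_sqrt_minus_one by (simp add: isotropic_f[OF neg_sqrt_minus_one(1)] D.D_add)
qed

text \<open>Its derivative along \<open>isotropic e\<close> is the constant
  \<open>2 (1 - e^2) = 4\<close>, a nonzero element of \<open>K\<close>.\<close>

lemma coeff_notin_iso_prime: "isotropic (\<ominus> e) f \<notin> iso_prime e"
proof
  interpret E: ring_derivation P "isotropic e" by (rule isotropic_derivation[OF e(1)])
  assume "isotropic (\<ominus> e) f \<in> iso_prime e"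
  then have "isotropic e (isotropic (\<ominus> e) f) \<in> max_ps"
    using E.stable_core_stable E.stable_core_subset unfolding iso_prime_def by blast
  moreover have "\<one> \<oplus> e \<otimes> \<ominus> e = \<one> \<oplus> \<one>" using e by (simp add: r_minus)
  then have "isotropic e (isotropic (\<ominus> e) f) = ps_const ((\<one> \<oplus> \<one>) \<oplus> (\<one> \<oplus> \<one>))"
    using e neg_sqrt_minus_one by (simp add: isotropic_f E.D_add isotropic_coord ps_const_add)
  moreover have "(\<one> \<oplus> \<one>) \<oplus> (\<one> \<oplus> \<one>) = [(4::nat)] \<cdot>\<^bsub>K\<^esub> \<one>"
    by (simp add: numeral_eq_Suc a_assoc)
  ultimately show False using char_zero[of 4] by (auto simp: max_ps_iff coeff_const)
qed

text \<open>Think of \<open>c\<close> as a leading part of horizontal order \<open>length js\<close>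
  and of \<open>c'\<close> as higher terms. Each Hamiltonian derivation lowers the order by one,
  differentiates the leading part and adds one factor \<open>V\<close>, which \<open>l\<close>
  counts. When \<open>js\<close> is used up, the higher terms lie in \<open>hor 1\<close> and hence
  in the prime, and the power of \<open>V\<close> is divided out by primality.\<close>

lemma fold_deriv_in_iso_prime:
  assumes I: "ideal I P" "I \<subseteq> iso_prime e"
    and stable: "\<And>j x. \<lbrakk>j < d - 1; x \<in> I\<rbrakk> \<Longrightarrow> hamiltonian e j x \<in> I"
  shows "\<lbrakk>set js \<subseteq> {..<d - 1}; isotropic (\<ominus> e) f [^]\<^bsub>P\<^esub> (l::nat) \<otimes>\<^bsub>P\<^esub> c \<oplus>\<^bsub>P\<^esub> c' \<in> I;
    c \<in> hor (length js); c' \<in> hor (Suc (length js))\<rbrakk> \<Longrightarrow> fold ps_deriv js c \<in> iso_prime e"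
proof (induction js arbitrary: c c' l)
  interpret p: primeideal "iso_prime e" P by (rule iso_prime_prime[OF e(1)])
  define V where "V = isotropic (\<ominus> e) f"
  have V: "V \<in> carrier P" "V \<notin> iso_prime e" using coeff_notin_iso_prime by (auto simp: V_def)
  have Vl: "V [^]\<^bsub>P\<^esub> l \<notin> iso_prime e" for l :: nat
  proof (induction l)
    case 0
    show ?case using p.I_notcarr p.one_imp_carrier by auto
  next
    case (Suc l)
    then show ?case using p.I_prime[of "V [^]\<^bsub>P\<^esub> l" V] V by auto
  qed
  case Nil
  have c: "c \<in> carrier P" "c' \<in> iso_prime e"
    using Nil ord_ge_carrier hor_subset_iso_prime[OF e(1)] by auto
  have "V [^]\<^bsub>P\<^esub> l \<otimes>\<^bsub>P\<^esub> c \<oplus>\<^bsub>P\<^esub> c' \<in> iso_prime e" using Nil I by (auto simp: V_def)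
  then have "V [^]\<^bsub>P\<^esub> l \<otimes>\<^bsub>P\<^esub> c \<oplus>\<^bsub>P\<^esub> c' \<ominus>\<^bsub>P\<^esub> c' \<in> iso_prime e"
    using c(2) p.a_closed p.a_inv_closed by (simp add: P.minus_eq)
  then have "V [^]\<^bsub>P\<^esub> l \<otimes>\<^bsub>P\<^esub> c \<in> iso_prime e"
    using c V p.Icarr by (simp add: P.minus_eq P.a_assoc P.r_neg)
  then show ?case using p.I_prime[of "V [^]\<^bsub>P\<^esub> l" c] Vl V c by auto
next
  case (Cons j js)
  define V where "V = isotropic (\<ominus> e) f"
  have V: "V \<in> carrier P" by (simp add: V_def)
  have j: "j < d - 1" "j \<le> d" using Cons.prems by auto
  interpret D: ring_derivation P "hamiltonian e j" by (rule hamiltonian_derivation[OF j(2)])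
  define n where "n = Suc (length js)"
  interpret h: ideal "hor n" P by (rule ord_ge_ideal)
  have c: "c \<in> carrier P" "c' \<in> carrier P" "c \<in> hor n" "c' \<in> hor (Suc n)"
    using Cons.prems ord_ge_carrier by (auto simp: n_def)
  have DV: "hamiltonian e j (V [^]\<^bsub>P\<^esub> l) = \<zero>\<^bsub>P\<^esub>"
    by (induction l) (use V hamiltonian_coeff[OF j(1)] in \<open>auto simp: D.D_mult V_def\<close>)
  define x where "x = V [^]\<^bsub>P\<^esub> l \<otimes>\<^bsub>P\<^esub> ((\<ominus>\<^bsub>P\<^esub> ps_deriv j f) \<otimes>\<^bsub>P\<^esub> isotropic (\<ominus> e) c)"
  define y where "y = hamiltonian e j c'"
  have xy: "x \<in> carrier P" "y \<in> carrier P" using V c j by (auto simp: x_def y_def)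
  have eq: "hamiltonian e j (V [^]\<^bsub>P\<^esub> l \<otimes>\<^bsub>P\<^esub> c \<oplus>\<^bsub>P\<^esub> c') = V [^]\<^bsub>P\<^esub> Suc l \<otimes>\<^bsub>P\<^esub> ps_deriv j c \<oplus>\<^bsub>P\<^esub> (x \<oplus>\<^bsub>P\<^esub> y)"
  proof -
    have "hamiltonian e j (V [^]\<^bsub>P\<^esub> l \<otimes>\<^bsub>P\<^esub> c \<oplus>\<^bsub>P\<^esub> c') = V [^]\<^bsub>P\<^esub> l \<otimes>\<^bsub>P\<^esub> hamiltonian e j c \<oplus>\<^bsub>P\<^esub> y"
      using V c DV by (simp add: D.D_add D.D_mult y_def)
    also have "hamiltonian e j c = V \<otimes>\<^bsub>P\<^esub> ps_deriv j c \<oplus>\<^bsub>P\<^esub> (\<ominus>\<^bsub>P\<^esub> ps_deriv j f) \<otimes>\<^bsub>P\<^esub> isotropic (\<ominus> e) c"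
      by (simp add: hamiltonian_def V_def)
    finally show ?thesis using V c j xy by (simp add: x_def P.r_distr P.m_assoc P.a_assoc)
  qed
  \<comment> \<open>The isotropic half of the Hamiltonian does not lower the order of
    \<open>c\<close>, so its contribution joins the higher terms.\<close>
  have "x \<in> hor n" unfolding x_def
    by (intro h.I_l_closed isotropic_hor) (use V c j neg_sqrt_minus_one in auto)
  moreover have "ps_deriv j c' \<in> hor n"
    by (rule ord_ge_deriv) (use c j in \<open>auto simp: horizontal_weight_def\<close>)
  then have "y \<in> hor n" unfolding y_def hamiltonian_def
    using c ord_ge_antimono[of n "Suc n"] j neg_sqrt_minus_one
    by (intro h.a_closed h.I_l_closed isotropic_hor) auto
  ultimately have "x \<oplus>\<^bsub>P\<^esub> y \<in> hor n" by (rule h.a_closed)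
  moreover have "ps_deriv j c \<in> hor (length js)"
    by (rule ord_ge_deriv) (use c j in \<open>auto simp: horizontal_weight_def n_def\<close>)
  moreover have "V [^]\<^bsub>P\<^esub> Suc l \<otimes>\<^bsub>P\<^esub> ps_deriv j c \<oplus>\<^bsub>P\<^esub> (x \<oplus>\<^bsub>P\<^esub> y) \<in> I"
    unfolding eq[symmetric] using stable[OF j(1) Cons.prems(2)] by (simp only: V_def)
  ultimately show ?case
    using Cons.IH[of "Suc l" "ps_deriv j c" "x \<oplus>\<^bsub>P\<^esub> y"] Cons.prems(1) by (simp add: V_def n_def)
qed

end

section \<open>Reading off orders from derivatives and the two isotropic axes\<close>

context
  notes One_nat_def [simp del]
begin

lemma fold_deriv_deg_le:
  "\<lbrakk>set js \<subseteq> {..d}; x \<in> deg_le i k\<rbrakk> \<Longrightarrow> fold ps_deriv js x \<in> deg_le i k"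
  by (induction js arbitrary: x) (auto intro: deg_le_deriv)

text \<open>If all \<open>n\<close>-fold horizontal derivatives vanish where the horizontal
  variables do, the part of order \<open>n\<close> vanishes. Induction passes to the first
  derivatives; a coefficient of positive horizontal weight is recovered from one of them up to a
  positive integer.\<close>

lemma hor_Suc:
  "\<lbrakk>c \<in> hor n; \<And>js. \<lbrakk>length js = n; set js \<subseteq> {..<d - 1}\<rbrakk> \<Longrightarrow> fold ps_deriv js c \<in> hor 1\<rbrakk>
    \<Longrightarrow> c \<in> hor (Suc n)"
proof (induction n arbitrary: c)
  case 0
  show ?case using 0(2)[of "[]"] by (simp add: One_nat_def)
next
  case (Suc n)
  have cP: "c \<in> carrier P" by (rule ord_ge_carrier[OF Suc.prems(1)])
  have D: "ps_deriv j c \<in> hor (Suc n)" if j: "j < d - 1" for j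
  proof (rule Suc.IH)
    show "ps_deriv j c \<in> hor n"
      by (rule ord_ge_deriv) (use j Suc.prems(1) in \<open>auto simp: horizontal_weight_def Suc_eq_plus1\<close>)
    fix js assume "length js = n" "set js \<subseteq> {..<d - 1}"
    then show "fold ps_deriv js (ps_deriv j c) \<in> hor 1"
      using Suc.prems(2)[of "j # js"] j by simp
  qed
  show ?case
  proof (rule ord_geI[OF cP])
    fix m assume m: "m \<in> monomials d" and wt: "weight horizontal_weight m < Suc (Suc n)"
    show "c m = \<zero>"
    proof (cases "weight horizontal_weight m < Suc n")
      case True
      then show ?thesis using ord_geD[OF Suc.prems(1) m] by simp
    next
      case False
      then have wn: "weight horizontal_weight m = Suc n" using wt by simp
      then have "(\<Sum>j\<le>d. horizontal_weight j * m j) \<noteq> 0" unfolding weight_def by simp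
      then obtain j where j: "j \<le> d" "horizontal_weight j * m j \<noteq> 0"
        by (auto simp: sum_eq_0_iff)
      then have jd: "j < d - 1" "m j > 0" by (auto simp: horizontal_weight_def split: if_splits)
      define m' where "m' = (\<lambda>k. m k - unit_exp j k)"
      have m': "m' \<in> monomials d" unfolding m'_def by (rule monomials_diff[OF m])
      have mm: "(\<lambda>k. m' k + unit_exp j k) = m" unfolding m'_def by (rule exp_diff_unit[of m j, OF jd(2)])
      have "weight horizontal_weight m = weight horizontal_weight m' + 1"
        unfolding mm[symmetric] weight_add using j(1) jd(1)
        by (simp add: weight_unit horizontal_weight_def)
      then have "ps_deriv j c m' = \<zero>" using wn by (intro ord_geD[OF D[OF jd(1)] m']) simp
      then have "[Suc (m' j)] \<cdot>\<^bsub>K\<^esub> c m = \<zero>" using m' mm by (simp add: coeff_deriv)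
      from nat_multiple_eq_zero[OF _ _ this] show ?thesis using cP m by simp
    qed
  qed
qed

lemma funpow_deriv_closed: "\<lbrakk>i \<le> d; x \<in> carrier P\<rbrakk> \<Longrightarrow> (ps_deriv i ^^ k) x \<in> carrier P"
  by (induction k) auto

text \<open>The factor is the rising factorial \<open>(m i + 1) ... (m i + k)\<close>; only its
  positivity matters.\<close>

lemma coeff_funpow_deriv:
  assumes i: "i \<le> d" and x: "x \<in> carrier P" and m: "m \<in> monomials d"
  shows "\<exists>c::nat. c > 0 \<and> (ps_deriv i ^^ k) x m = [c] \<cdot>\<^bsub>K\<^esub> x (\<lambda>j. m j + (if j = i then k else 0))"
  using m
proof (induction k arbitrary: m)
  case 0
  have "(\<lambda>j. m j + (if j = i then 0 else 0)) = m" by auto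
  then show ?case using 0 x by (intro exI[of _ 1]) simp
next
  case (Suc k)
  have m': "(\<lambda>j. m j + unit_exp i j) \<in> monomials d" by (rule monomials_add_unit[OF Suc.prems i])
  then obtain c :: nat where c: "c > 0" "(ps_deriv i ^^ k) x (\<lambda>j. m j + unit_exp i j) =
      [c] \<cdot>\<^bsub>K\<^esub> x (\<lambda>j. m j + unit_exp i j + (if j = i then k else 0))"
    using Suc.IH by blast
  have eq: "(\<lambda>j. m j + unit_exp i j + (if j = i then k else 0)) = (\<lambda>j. m j + (if j = i then Suc k else 0))"
    by auto
  have "(\<lambda>j. m j + (if j = i then Suc k else 0)) \<in> monomials d"
    by (rule monomials_add[OF Suc.prems monomials_single[OF i]])
  then have "(ps_deriv i ^^ Suc k) x m = [(c * Suc (m i))] \<cdot>\<^bsub>K\<^esub> x (\<lambda>j. m j + (if j = i then Suc k else 0))"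
    using c(2) eq Suc.prems x by (simp add: coeff_deriv add.nat_pow_pow del: add.nat_pow_Suc)
  moreover have "c * Suc (m i) > 0" using c by simp
  ultimately show ?case by blast
qed

text \<open>The partials commute and the second \<open>t\<close>-derivative of \<open>s\<close> is
  zero, so the binomial expansion of the power stops after two terms. At \<open>k = 0\<close> the
  truncated exponent is harmless, its term having factor 0.\<close>

lemma isotropic_funpow:
  assumes e: "e \<in> carrier K" and s: "s \<in> deg_le d 1"
  shows "(isotropic e ^^ k) s = (ps_deriv (d - 1) ^^ k) s \<oplus>\<^bsub>P\<^esub>
    ps_const e \<otimes>\<^bsub>P\<^esub> ([k] \<cdot>\<^bsub>P\<^esub> (ps_deriv (d - 1) ^^ (k - 1)) (ps_deriv d s))"
proof (induction k)
  case 0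
  then show ?case using e deg_le_carrier[OF s] by simp
next
  case (Suc k)
  interpret E: ring_derivation P "isotropic e" by (rule isotropic_derivation[OF e])
  interpret W: ring_derivation P "ps_deriv (d - 1)" by (rule ps_deriv_derivation) simp
  interpret T: ring_derivation P "ps_deriv d" by (rule ps_deriv_derivation) simp
  have sP: "s \<in> carrier P" by (rule deg_le_carrier[OF s])
  define B where "B = (ps_deriv (d - 1) ^^ k) (ps_deriv d s)"
  have B: "B \<in> carrier P" using sP by (simp add: B_def)
  have comm: "ps_deriv d ((ps_deriv (d - 1) ^^ l) x) = (ps_deriv (d - 1) ^^ l) (ps_deriv d x)"
    if "x \<in> carrier P" for l x
    using that by (induction l) (auto simp: ps_deriv_comm[of d "d - 1"])
  have nm: "D ([(n::nat)] \<cdot>\<^bsub>P\<^esub> x) = [n] \<cdot>\<^bsub>P\<^esub> D x" if "ring_derivation P D" "x \<in> carrier P" for D n x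
  proof -
    interpret D: ring_derivation P D by fact
    show ?thesis using that(2) by (induction n) (auto simp: D.D_add)
  qed
  define y where "y = [k] \<cdot>\<^bsub>P\<^esub> (ps_deriv (d - 1) ^^ (k - 1)) (ps_deriv d s)"
  have y: "y \<in> carrier P" using sP by (simp add: y_def)
  have Wy: "ps_deriv (d - 1) y = [k] \<cdot>\<^bsub>P\<^esub> B"
    using sP by (cases k) (auto simp: y_def B_def nm[OF W.ring_derivation] simp del: P.add.nat_pow_Suc)
  have Ty: "ps_deriv d y = \<zero>\<^bsub>P\<^esub>"
    using sP deg_le_1_deriv[OF s] by (simp add: y_def nm[OF T.ring_derivation] comm)
  have "(isotropic e ^^ Suc k) s = isotropic e ((ps_deriv (d - 1) ^^ k) s \<oplus>\<^bsub>P\<^esub> ps_const e \<otimes>\<^bsub>P\<^esub> y)"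
    using Suc by (simp add: y_def)
  also have "\<dots> = (ps_deriv (d - 1) ^^ Suc k) s \<oplus>\<^bsub>P\<^esub> ps_const e \<otimes>\<^bsub>P\<^esub> B \<oplus>\<^bsub>P\<^esub> ps_const e \<otimes>\<^bsub>P\<^esub> ([k] \<cdot>\<^bsub>P\<^esub> B)"
    unfolding isotropic_def using e sP y B Wy Ty
    by (simp add: deriv_add deriv_const_mult comm B_def[symmetric] P.a_ac del: One_nat_def)
  also have "\<dots> = (ps_deriv (d - 1) ^^ Suc k) s \<oplus>\<^bsub>P\<^esub> ps_const e \<otimes>\<^bsub>P\<^esub> ([Suc k] \<cdot>\<^bsub>P\<^esub> B)"
    using e sP B by (simp add: P.r_distr P.a_ac)
  finally show ?case by (simp add: B_def)
qed

text \<open>Setting the horizontal variables to zero leaves \<open>alpha(w) + beta(w) t\<close>.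
  Membership in the two primes gives two equations differing only in the sign of \<open>e\<close>;
  their sum and difference kill all Taylor coefficients of \<open>alpha\<close> and
  \<open>beta\<close>.\<close>

lemma deg_le_1_in_both_primes:
  assumes e: "e \<in> carrier K" "e \<otimes> e = \<ominus> \<one>" and s: "s \<in> deg_le d 1"
    and p: "s \<in> iso_prime e" "s \<in> iso_prime (\<ominus> e)"
  shows "s \<in> hor 1"
proof (rule ord_geI)
  show sP: "s \<in> carrier P" by (rule deg_le_carrier[OF s])
  \<comment> \<open>Up to positive integer factors, \<open>A k\<close> is the coefficient of
    \<open>w^k\<close> in \<open>s\<close> and \<open>B k\<close> that of
    \<open>w^k t\<close>.\<close>
  define A where "A k = (ps_deriv (d - 1) ^^ k) s (\<lambda>_. 0)" for k
  define B where "B k = (ps_deriv (d - 1) ^^ k) (ps_deriv d s) (\<lambda>_. 0)" for k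
  have AB: "A k \<in> carrier K" "B k \<in> carrier K" for k
    using funpow_deriv_closed[of "d - 1" _ k] sP by (auto simp: A_def B_def)
  have eq: "A k \<oplus> c \<otimes> ([k] \<cdot>\<^bsub>K\<^esub> B (k - 1)) = \<zero>" if c: "c \<in> carrier K" "s \<in> iso_prime c" for c k
  proof -
    have "(isotropic c ^^ k) s \<in> max_ps" using c(2) unfolding iso_prime_def stable_core_def by blast
    then have "(isotropic c ^^ k) s (\<lambda>_. 0) = \<zero>" by (simp add: max_ps_iff)
    moreover have "(ps_deriv (d - 1) ^^ l) x \<in> carrier P" if "x \<in> carrier P" for l x
      using funpow_deriv_closed[of "d - 1" x l] that by simp
    ultimately show ?thesis
      unfolding isotropic_funpow[OF c(1) s] A_def B_def using c(1) sP
      by (simp add: coeff_mult_0 coeff_const coeff_nat_multiple del: One_nat_def)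
  qed
  have zero: "A k = \<zero>" "e \<otimes> ([k] \<cdot>\<^bsub>K\<^esub> B (k - 1)) = \<zero>" for k
  proof -
    define y where "y = e \<otimes> ([k] \<cdot>\<^bsub>K\<^esub> B (k - 1))"
    have y: "y \<in> carrier K" using e AB by (simp add: y_def)
    have 1: "A k \<oplus> y = \<zero>" using eq[OF e(1) p(1)] by (simp add: y_def)
    have 2: "A k \<oplus> \<ominus> y = \<zero>" using eq[OF _ p(2), of k] e AB by (simp add: y_def l_minus)
    have "A k = \<ominus> y" using 1 AB y by (simp add: sum_zero_eq_neg)
    moreover have "A k = y" using 2 AB y sum_zero_eq_neg[of "A k" "\<ominus> y"] by simp
    ultimately have "A k \<oplus> A k = \<zero>" using y by (metis r_neg)
    then have "[(2::nat)] \<cdot>\<^bsub>K\<^esub> A k = \<zero>" using AB by (simp add: numeral_2_eq_2)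
    from nat_multiple_eq_zero[OF _ _ this] show A: "A k = \<zero>" using AB by simp
    show "e \<otimes> ([k] \<cdot>\<^bsub>K\<^esub> B (k - 1)) = \<zero>" using \<open>A k = y\<close> A by (simp add: y_def)
  qed
  have "\<ominus> (\<ominus> \<one>) \<noteq> \<ominus> \<zero>" by simp
  then have e0: "e \<noteq> \<zero>" using e(2) by (metis l_null zero_closed)
  have Bz: "B k = \<zero>" for k
  proof -
    have "[Suc k] \<cdot>\<^bsub>K\<^esub> B k = \<zero>"
      using zero(2)[of "Suc k"] integral[of e "[Suc k] \<cdot>\<^bsub>K\<^esub> B k"] e e0 AB
      by (simp del: add.nat_pow_Suc)
    from nat_multiple_eq_zero[OF _ _ this] show ?thesis using AB by simp
  qed
  fix m assume m: "m \<in> monomials d" and wt: "weight horizontal_weight m < 1"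
  have mj: "m j = 0" if "j < d - 1" for j
  proof -
    have "\<forall>a\<in>{..d}. horizontal_weight a * m a = 0" using wt unfolding weight_def by (simp add: sum_eq_0_iff)
    then have "horizontal_weight j * m j = 0" using that by auto
    then show ?thesis using that by (simp add: horizontal_weight_def)
  qed
  have mj': "m j = 0" if "j \<noteq> d - 1" "j \<noteq> d" for j
  proof -
    have "j < d - 1 \<or> j > d" using that by arith
    then show ?thesis using mj m by (auto simp: monomials_def)
  qed
  consider "m d = 0" | "m d = 1" | "m d > 1" by linarith
  then show "s m = \<zero>"
  proof cases
    case 1
    then have mm: "(\<lambda>j. 0 + (if j = d - 1 then m (d - 1) else 0)) = m" using mj' by fastforce
    obtain c :: nat where c: "c > 0" "A (m (d - 1)) = [c] \<cdot>\<^bsub>K\<^esub> s m"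
      using coeff_funpow_deriv[of "d - 1" s "\<lambda>_. 0" "m (d - 1)"] sP unfolding mm A_def by auto
    then have "[c] \<cdot>\<^bsub>K\<^esub> s m = \<zero>" using zero(1) by simp
    from nat_multiple_eq_zero[OF c(1) _ this] show ?thesis using sP m by simp
  next
    case 2
    let ?a = "\<lambda>j. 0 + (if j = d - 1 then m (d - 1) else 0)"
    have mm: "(\<lambda>j. ?a j + unit_exp d j) = m" using 2 mj' d_ne by (fastforce simp: fun_eq_iff)
    have a: "?a \<in> monomials d" by (auto simp: monomials_def)
    obtain c :: nat where c: "c > 0" "B (m (d - 1)) = [c] \<cdot>\<^bsub>K\<^esub> ps_deriv d s ?a"
      using coeff_funpow_deriv[of "d - 1" "ps_deriv d s" "\<lambda>_. 0" "m (d - 1)"] sP unfolding B_def by auto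
    moreover have "ps_deriv d s ?a = s m"
      using coeff_deriv[OF a, of d s] d_ne sP m unfolding mm by simp
    ultimately have "[c] \<cdot>\<^bsub>K\<^esub> s m = \<zero>" using Bz by simp
    from nat_multiple_eq_zero[OF c(1) _ this] show ?thesis using sP m by simp
  next
    case 3
    then show ?thesis using deg_leD[OF s m] by simp
  qed
qed

text \<open>Division by \<open>f\<close> as a quadratic in \<open>t\<close> leaves a remainder in
  \<open>I\<close> of degree at most one in \<open>t\<close>. If it has horizontal order
  \<open>n\<close>, its \<open>n\<close>-fold horizontal derivatives lie in both primes and still
  have degree at most one in \<open>t\<close>, hence lie in \<open>hor 1\<close>; so the order is at
  least \<open>n + 1\<close>.\<close>

lemma stable_ideal_eq:
  assumes e: "e \<in> carrier K" "e \<otimes> e = \<ominus> \<one>" and I: "ideal I P" "f \<in> I"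
    and sub: "I \<subseteq> iso_prime e" "I \<subseteq> iso_prime (\<ominus> e)"
    and stable: "\<And>c j x. \<lbrakk>c = e \<or> c = \<ominus> e; j < d - 1; x \<in> I\<rbrakk> \<Longrightarrow> hamiltonian c j x \<in> I"
    and a: "a \<in> I"
  shows "\<exists>q\<in>carrier P. a = q \<otimes>\<^bsub>P\<^esub> f"
proof -
  interpret I: ideal I P by fact
  have aP: "a \<in> carrier P" using a I.Icarr by auto
  interpret m: ideal max_ps P by (rule max_ps_ideal)
  have wmax: "w [^]\<^bsub>P\<^esub> (2::nat) \<in> max_ps" using var_max[of "d - 1"] by (simp add: numeral_2_eq_2 m.I_l_closed)
  have h: "w [^]\<^bsub>P\<^esub> (2::nat) \<oplus>\<^bsub>P\<^esub> g \<in> max_ps" "w [^]\<^bsub>P\<^esub> (2::nat) \<oplus>\<^bsub>P\<^esub> g \<in> deg_le d 0"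
    using wmax g_max m.a_closed deg_le_add[OF deg_le_pow[OF deg_le_var[OF d_ne(2)]] g_free(2)] by auto
  obtain q where q: "q \<in> carrier P" "a \<ominus>\<^bsub>P\<^esub> q \<otimes>\<^bsub>P\<^esub> f \<in> deg_le d 1"
    using division[OF aP order_refl h] unfolding f_def by auto
  define r where "r = a \<ominus>\<^bsub>P\<^esub> q \<otimes>\<^bsub>P\<^esub> f"
  have rI: "r \<in> I" unfolding r_def P.minus_eq
    using a q(1) I(2) by (intro I.a_closed I.a_inv_closed I.I_l_closed) auto
  have rP: "r \<in> carrier P" using rI I.Icarr by auto
  have "r \<in> hor n" for n
  proof (induction n)
    case 0
    show ?case using rP by (simp add: ord_ge_0)
  next
    case (Suc n)
    show ?case
    proof (rule hor_Suc[OF Suc])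
      fix js :: "nat list" assume js: "length js = n" "set js \<subseteq> {..<d - 1}"
      have p: "fold ps_deriv js r \<in> iso_prime c" if c: "c = e \<or> c = \<ominus> e" for c
      proof (rule fold_deriv_in_iso_prime[where I = I and l = 0 and c' = "\<zero>\<^bsub>P\<^esub>"])
        show "c \<in> carrier K" "c \<otimes> c = \<ominus> \<one>" using c e by (auto simp: l_minus r_minus)
        show "isotropic (\<ominus> c) f [^]\<^bsub>P\<^esub> (0::nat) \<otimes>\<^bsub>P\<^esub> r \<oplus>\<^bsub>P\<^esub> \<zero>\<^bsub>P\<^esub> \<in> I" using rI rP by simp
      qed (use c I sub stable js Suc ord_ge_zero in auto)
      have "set js \<subseteq> {..d}" using js by auto
      then have "fold ps_deriv js r \<in> deg_le d 1"
        using fold_deriv_deg_le q(2) by (auto simp: r_def)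
      then show "fold ps_deriv js r \<in> hor 1"
        using deg_le_1_in_both_primes[OF e] p by auto
    qed
  qed
  then have "r = \<zero>\<^bsub>P\<^esub>" by (rule ord_ge_all_zero)
  moreover have "a = r \<oplus>\<^bsub>P\<^esub> q \<otimes>\<^bsub>P\<^esub> f"
    using aP q(1) by (simp add: r_def P.minus_eq P.a_assoc P.l_neg)
  ultimately have "a = q \<otimes>\<^bsub>P\<^esub> f" using q(1) by simp
  then show ?thesis using q(1) by blast
qed

text \<open>A chain of primes containing \<open>f\<close>: the maximal ideal, the prime \<open>(z\<^sub>0, \<dots>, z\<^sub>d\<^sub>-\<^sub>2, w + e t)\<close>, and
  two successive stable cores.\<close>

lemma prime_chain:
  assumes e: "e \<in> carrier K" "e \<otimes> e = \<ominus> \<one>"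
  shows "\<exists>Q. (\<forall>i\<le>3. primeideal (Q i) P \<and> f \<in> Q i) \<and> (\<forall>i<3. Q i \<subset> Q (Suc (i::nat)))"
proof -
  let ?p = "iso_prime e"
  interpret D0: ring_derivation P "hamiltonian e 0" by (rule hamiltonian_derivation[OF e]) simp
  interpret D1: ring_derivation P "hamiltonian e 1" by (rule hamiltonian_derivation[OF e]) (use dim in simp)
  define Q1 where "Q1 = stable_core (hamiltonian e 0) P ?p"
  define Q0 where "Q0 = stable_core (hamiltonian e 1) P Q1"
  define V where "V = isotropic (\<ominus> e) f"
  have me: "\<ominus> e \<in> carrier K" using e by simp
  have V: "V \<in> carrier P" "V \<notin> ?p" using coeff_notin_iso_prime[OF e] iso_closed[OF e] by (auto simp: V_def)
  have sub: "Q0 \<subseteq> Q1" "Q1 \<subseteq> ?p" "?p \<subseteq> max_ps"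
    using D0.stable_core_subset D1.stable_core_subset iso_prime_subset[OF e(1)] by (auto simp: Q0_def Q1_def)
  note pp = iso_prime_prime[OF e(1)]
  have pQ1: "primeideal Q1 P" unfolding Q1_def
    by (rule D0.stable_core_prime[OF pp]) (use sub nat_multiple_one_notin_max_ps in auto)
  have pQ0: "primeideal Q0 P" unfolding Q0_def
    by (rule D1.stable_core_prime[OF pQ1]) (use sub nat_multiple_one_notin_max_ps in auto)
  have id: "ideal ?p P" "ideal Q1 P" using pp pQ1 primeideal.axioms(1) by auto
  have "Idl\<^bsub>P\<^esub> {f} \<subseteq> ?p" by (rule iso_prime_contains[OF e]) (use f_max in auto)
  then have fp: "f \<in> ?p" using P.genideal_self'[of f] by auto
  have fQ1: "f \<in> Q1" unfolding Q1_def
    by (rule D0.stable_coreI_kernel[OF fp _ _ id(1)]) (use hamiltonian_f[OF e, of 0] in auto)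
  have fQ0: "f \<in> Q0" unfolding Q0_def
    by (rule D1.stable_coreI_kernel[OF fQ1 _ _ id(2)]) (use hamiltonian_f[OF e, of 1] dim in auto)
  have iv: "isotropic c (ps_var K d j) = \<zero>\<^bsub>P\<^esub>" if "c \<in> carrier K" "j < d - 1" for c j
  proof -
    have "j \<noteq> d" "j \<noteq> d - 1" "j \<le> d" using that by auto
    then show ?thesis using that(1) unfolding isotropic_def by (auto simp: ps_deriv_var)
  qed
  \<comment> \<open>Source of strictness: \<open>hamiltonian e i\<close> sends \<open>z_i\<close> to
    \<open>V\<close>, outside the prime, so \<open>z_0\<close> is lost in the first core and
    \<open>z_1\<close> in the second. The first core still contains \<open>z_1\<close>, which
    \<open>hamiltonian e 0\<close> kills.\<close>
  have Dv: "hamiltonian e i (ps_var K d j) = (if i = j then V else \<zero>\<^bsub>P\<^esub>)" if "i < d - 1" "j < d - 1" for i j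
    unfolding hamiltonian_def V_def[symmetric] using that me V(1) iv by (simp add: ps_deriv_var)
  have vp: "ps_var K d j \<in> ?p" if "j < d - 1" for j
    using ord_ge_var[of j horizontal_weight] that hor_subset_iso_prime[OF e(1)]
    by (auto simp: horizontal_weight_def)
  \<comment> \<open>The chain has length three because \<open>3 \<le> d\<close> leaves two variables
    besides \<open>w\<close> and \<open>t\<close>.\<close>
  have d01: "0 < d - 1" "1 < d - 1" using dim by auto
  have "ps_var K d 0 \<notin> Q1"
  proof
    assume "ps_var K d 0 \<in> Q1"
    then have "hamiltonian e 0 (ps_var K d 0) \<in> ?p"
      using D0.stable_core_stable sub(2) unfolding Q1_def by blast
    then show False using V Dv[OF d01(1) d01(1)] by simp
  qed
  then have s1: "Q1 \<subset> ?p" using sub(2) vp[OF d01(1)] by blast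
  have x1: "ps_var K d 1 \<in> Q1" unfolding Q1_def
    by (rule D0.stable_coreI_kernel[OF vp[OF d01(2)] _ _ id(1)]) (use Dv[OF d01] in auto)
  have "ps_var K d 1 \<notin> Q0"
  proof
    assume "ps_var K d 1 \<in> Q0"
    then have "hamiltonian e 1 (ps_var K d 1) \<in> Q1"
      using D1.stable_core_stable D1.stable_core_subset unfolding Q0_def by blast
    then show False using V Dv[OF d01(2) d01(2)] sub(2) by auto
  qed
  then have s0: "Q0 \<subset> Q1" using sub(1) x1 by blast
  interpret m: ideal max_ps P by (rule max_ps_ideal)
  have "V \<in> max_ps" unfolding V_def isotropic_f[OF me] by (intro m.a_closed iso_coord_max me)
  then have s2: "?p \<subset> max_ps" using sub(3) V by blast
  define Q where "Q i = (if i = 0 then Q0 else if i = 1 then Q1 else if i = 2 then ?p else max_ps)" for i :: nat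
  have "\<forall>i\<le>3. primeideal (Q i) P \<and> f \<in> Q i"
    using pQ0 pQ1 pp max_ps_prime fQ0 fQ1 fp f_max by (simp add: Q_def)
  moreover have "\<forall>i<3. Q i \<subset> Q (Suc i)"
    using s0 s1 s2 by (auto simp: Q_def less_Suc_eq numeral_3_eq_3)
  ultimately show ?thesis by blast
qed

end

end

section \<open>Modules with a connection over a double suspension\<close>

context power_series_ring
begin

text \<open>The functions are not restricted to the carrier, unlike those in
  \<open>derivations\<close>. Hence \<open>nab_cong\<close> is a condition on \<open>nab\<close>,
  and restriction takes place only when passing to the quotient.\<close>

definition K_derivations where
  "K_derivations = {D. ring_derivation P D \<and> (\<forall>c\<in>carrier K. D (ps_const c) = \<zero>\<^bsub>P\<^esub>)}"

lemma K_derivations_comb: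
  assumes "D \<in> K_derivations" "E \<in> K_derivations" "a \<in> carrier P" "b \<in> carrier P"
  shows "(\<lambda>x. a \<otimes>\<^bsub>P\<^esub> D x \<oplus>\<^bsub>P\<^esub> b \<otimes>\<^bsub>P\<^esub> E x) \<in> K_derivations"
  using assms P.ring_derivation_comb[of D E a b] unfolding K_derivations_def by auto

lemma ps_deriv_K_derivation: "i \<le> d \<Longrightarrow> ps_deriv i \<in> K_derivations"
  unfolding K_derivations_def by (auto simp: ps_deriv_derivation ps_deriv_const)

end

context double_suspension
begin

lemma isotropic_K_derivation: "e \<in> carrier K \<Longrightarrow> isotropic e \<in> K_derivations"
  unfolding isotropic_def by (rule K_derivations_comb) (auto simp: ps_deriv_K_derivation)

lemma hamiltonian_K_derivation:
  "\<lbrakk>e \<in> carrier K; e \<otimes> e = \<ominus> \<one>; j \<le> d\<rbrakk> \<Longrightarrow> hamiltonian e j \<in> K_derivations"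
  unfolding hamiltonian_def
  by (rule K_derivations_comb) (auto simp: ps_deriv_K_derivation isotropic_K_derivation)

lemma relations_trivial:
  fixes M (structure)
  assumes T: "tangential_connection P M K_derivations f nab"
    and fg: "finitely_generated P M" and fM: "\<And>x. x \<in> carrier M \<Longrightarrow> f \<odot>\<^bsub>M\<^esub> x = \<zero>\<^bsub>M\<^esub>"
    and e: "e \<in> carrier K" "e \<otimes>\<^bsub>K\<^esub> e = \<ominus>\<^bsub>K\<^esub> \<one>\<^bsub>K\<^esub>"
    and jac: "\<And>a. a \<in> ord_ge (\<lambda>_. 1) N \<Longrightarrow> \<exists>D\<in>K_derivations. D f = a"
    and reg: "module.regular3 P M a b c" "a \<in> max_ps" "b \<in> max_ps" "c \<in> max_ps"
  shows "\<exists>S. finite S \<and> S \<subseteq> carrier M \<and> module_span P M S = carrier M \<and>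
    (\<forall>r\<in>module.relations P M S. \<forall>s\<in>S. \<exists>q\<in>carrier P. r s = q \<otimes>\<^bsub>P\<^esub> f)"
proof -
  interpret T: tangential_connection P M K_derivations f nab by (rule T)
  have units: "x \<in> Units P" if "x \<in> carrier P" "x \<notin> max_ps" for x
    using unit_outside_max_ps[OF that] that(1) P.m_comm unfolding Units_def by force
  obtain S where S: "finite S" "S \<subseteq> carrier M" "module_span P M S = carrier M"
    and min: "\<forall>r\<in>T.relations S. \<forall>s\<in>S. r s \<in> max_ps"
    using T.minimal_generators[OF fg max_ps_ideal units] by auto
  define G where "G = {r s | r s. r \<in> T.relations S \<and> s \<in> S}"
  have Gmax: "G \<subseteq> max_ps" using min by (auto simp: G_def)
  then have GP: "G \<subseteq> carrier P" using max_ps_carrier by auto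
  define I where "I = Idl\<^bsub>P\<^esub> G"
  have I: "ideal I P" unfolding I_def by (rule P.genideal_ideal[OF GP])
  have GI: "G \<subseteq> I" unfolding I_def by (rule P.genideal_self[OF GP])
  have relI: "r s \<in> J" if "G \<subseteq> J" "r \<in> T.relations S" "s \<in> S" for r s J using that by (auto simp: G_def)
  \<comment> \<open>Isolatedness of the singularity makes high powers of \<open>a\<close>,
    \<open>b\<close>, \<open>c\<close> values of derivations at \<open>f\<close>, and powers of a
    regular sequence remain regular.\<close>
  have powN: "\<exists>D\<in>K_derivations. D f = x [^]\<^bsub>P\<^esub> N" if "x \<in> max_ps" for x
    using jac[of "x [^]\<^bsub>P\<^esub> N"] ord_ge_pow[of x "\<lambda>_. 1" 1 N] that by (simp add: max_ps_def)
  obtain Da Db Dc where D: "Da \<in> K_derivations" "Db \<in> K_derivations" "Dc \<in> K_derivations"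
    "Da f = a [^]\<^bsub>P\<^esub> N" "Db f = b [^]\<^bsub>P\<^esub> N" "Dc f = c [^]\<^bsub>P\<^esub> N"
    using powN reg by metis
  have reg': "T.regular3 (Da f) (Db f) (Dc f)"
    unfolding D by (intro T.regular3_pow1 T.regular3_pow2 T.regular3_pow3 reg)
  have sub: "I \<subseteq> iso_prime c" if c: "c \<in> carrier K" "c \<otimes>\<^bsub>K\<^esub> c = \<ominus>\<^bsub>K\<^esub> \<one>\<^bsub>K\<^esub>" for c
    unfolding I_def
  proof (rule iso_prime_contains[OF c Gmax])
    fix x J assume x: "x \<in> G" and J: "ideal J P" "G \<subseteq> J" "isotropic c f \<in> J"
    obtain r s where rs: "x = r s" "r \<in> T.relations S" "s \<in> S" using x by (auto simp: G_def)
    show "isotropic c x \<in> J"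
      unfolding rs(1)
      by (rule T.transversal_stable[where S = S and J = J, OF S J(1) _ isotropic_K_derivation[OF c(1)]
            J(3) D(1-3) reg' rs(2,3)]) (rule relI[OF J(2)])
  qed
  have stable: "hamiltonian c j x \<in> I"
    if c: "c \<in> carrier K" "c \<otimes>\<^bsub>K\<^esub> c = \<ominus>\<^bsub>K\<^esub> \<one>\<^bsub>K\<^esub>" and j: "j < d - 1" and x: "x \<in> I" for c j x
  proof -
    have jd: "j \<le> d" using j by simp
    interpret H: ring_derivation P "hamiltonian c j" by (rule hamiltonian_derivation[OF c jd])
    have "hamiltonian c j y \<in> I" if y: "y \<in> G" for y
    proof -
      obtain r s where rs: "y = r s" "r \<in> T.relations S" "s \<in> S" using y by (auto simp: G_def)
      show ?thesis
        unfolding rs(1)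
        by (rule T.tangential_stable[where S = S and J = I, OF S I _ hamiltonian_K_derivation[OF c jd]
              hamiltonian_f[OF c jd] rs(2,3)]) (rule relI[OF GI])
    qed
    then have "hamiltonian c j ` G \<subseteq> Idl\<^bsub>P\<^esub> G" unfolding I_def by auto
    then show ?thesis using H.genideal_stable[OF GP _ x[unfolded I_def]] by (simp add: I_def)
  qed
  have me: "\<ominus>\<^bsub>K\<^esub> e \<in> carrier K" "\<ominus>\<^bsub>K\<^esub> e \<otimes>\<^bsub>K\<^esub> \<ominus>\<^bsub>K\<^esub> e = \<ominus>\<^bsub>K\<^esub> \<one>\<^bsub>K\<^esub>"
    using neg_sqrt_minus_one[OF e] by auto
  have "\<exists>q\<in>carrier P. r s = q \<otimes>\<^bsub>P\<^esub> f" if r: "r \<in> T.relations S" and s: "s \<in> S" for r s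
  proof -
    \<comment> \<open>Since \<open>f\<close> annihilates \<open>M\<close>, the vector with the
      single entry \<open>f\<close> is a relation; this is how \<open>f\<close> gets into
      \<open>I\<close>.\<close>
    define r0 where "r0 t = (if t = s then f else \<zero>\<^bsub>P\<^esub>)" for t
    have "(\<Oplus>\<^bsub>M\<^esub>t\<in>S. r0 t \<odot>\<^bsub>M\<^esub> t) = f \<odot>\<^bsub>M\<^esub> s"
      unfolding r0_def by (rule T.comb_single[OF S(1) s S(2)]) simp
    then have "r0 \<in> T.relations S" using fM s S(2) by (auto simp: T.relations_def r0_def)
    then have "r0 s \<in> I" using relI[OF GI _ s] by blast
    then have fI: "f \<in> I" by (simp add: r0_def)
    show ?thesis
      by (rule stable_ideal_eq[OF e I fI sub[OF e] sub[OF me] _ relI[OF GI r s]])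
        (use stable e me in auto)
  qed
  then show ?thesis using S by blast
qed

end

section \<open>Restriction along a ring homomorphism\<close>

definition pullback_module :: "('p \<Rightarrow> 'a) \<Rightarrow> ('a, 'm, 't) module_scheme \<Rightarrow> ('p, 'm) module"
  where "pullback_module \<psi> M = \<lparr>carrier = carrier M, monoid.mult = monoid.mult M, one = one M,
    ring.zero = ring.zero M, add = add M, smult = (\<lambda>p. smult M (\<psi> p))\<rparr>"

lemma pullback_simps [simp]:
  "carrier (pullback_module \<psi> M) = carrier M" "ring.zero (pullback_module \<psi> M) = ring.zero M"
  "add (pullback_module \<psi> M) = add M" "smult (pullback_module \<psi> M) p = smult M (\<psi> p)"
  unfolding pullback_module_def by simp_all

lemma pullback_a_inv [simp]: "a_inv (pullback_module \<psi> M) x = a_inv M x"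
  by (simp add: a_inv_def m_inv_def)

lemma pullback_finsum [simp]: "finsum (pullback_module \<psi> M) g S = finsum M g S"
  by (simp add: finsum_def finprod_def)

locale surjective_hom = ring_hom_cring +
  assumes surj: "h ` carrier R = carrier S"
begin

lemma lift_ex: "x \<in> carrier S \<Longrightarrow> \<exists>p\<in>carrier R. h p = x"
  unfolding surj[symmetric] by blast

definition lift where "lift x = (SOME p. p \<in> carrier R \<and> h p = x)"

lemma lift:
  assumes "x \<in> carrier S"
  shows "lift x \<in> carrier R" "h (lift x) = x"
proof -
  have "\<exists>p. p \<in> carrier R \<and> h p = x" using lift_ex[OF assms] by blast
  from someI_ex[OF this] show "lift x \<in> carrier R" "h (lift x) = x" by (simp_all add: lift_def)
qed

lemma image_ideal: "ideal I R \<Longrightarrow> ideal (h ` I) S"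
proof -
  assume "ideal I R"
  then interpret I: ideal I R .
  show "ideal (h ` I) S"
  proof (rule idealI)
    show "subgroup (h ` I) (add_monoid S)"
    proof (rule S.add.subgroupI)
      show "h ` I \<subseteq> carrier S" using I.Icarr by auto
      show "h ` I \<noteq> {}"
        using additive_subgroup.zero_closed[OF ideal.axioms(1)[OF I.ideal_axioms]] by blast
      fix a b assume "a \<in> h ` I"
      then obtain x where x: "x \<in> I" "a = h x" by auto
      show "\<ominus>\<^bsub>S\<^esub> a \<in> h ` I" using x I.Icarr by (auto intro!: image_eqI[of _ _ "\<ominus> x"])
      assume "b \<in> h ` I"
      then obtain y where "y \<in> I" "b = h y" by auto
      then show "a \<oplus>\<^bsub>S\<^esub> b \<in> h ` I" using x I.Icarr I.a_closed by (auto intro!: image_eqI[of _ _ "x \<oplus> y"])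
    qed
    fix a x assume "a \<in> h ` I" "x \<in> carrier S"
    then obtain i y where iy: "i \<in> I" "a = h i" "y \<in> carrier R" "x = h y" using lift_ex by blast
    show "a \<otimes>\<^bsub>S\<^esub> x \<in> h ` I" using iy I.Icarr I.I_r_closed by (auto intro!: image_eqI[of _ _ "i \<otimes> y"])
    show "x \<otimes>\<^bsub>S\<^esub> a \<in> h ` I" using iy I.Icarr I.I_l_closed by (auto intro!: image_eqI[of _ _ "y \<otimes> i"])
  qed (rule S.ring_axioms)
qed

text \<open>An ideal containing the kernel is recovered from its image, so primality and strict
  inclusions pass to the quotient.\<close>

lemma image_ideal_mem:
  assumes I: "ideal I R" and k: "\<And>x. \<lbrakk>x \<in> carrier R; h x = \<zero>\<^bsub>S\<^esub>\<rbrakk> \<Longrightarrow> x \<in> I" and x: "x \<in> carrier R"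
  shows "h x \<in> h ` I \<longleftrightarrow> x \<in> I"
proof
  interpret I: ideal I R by fact
  assume "h x \<in> h ` I"
  then obtain i where i: "i \<in> I" "h x = h i" by auto
  have ic: "i \<in> carrier R" by (rule I.Icarr[OF i(1)])
  have "h (x \<ominus> i) = \<zero>\<^bsub>S\<^esub>" using i(2) x ic by (simp add: R.minus_eq S.r_neg)
  then have "x \<ominus> i \<in> I" using x ic by (intro k) simp_all
  then have "(x \<ominus> i) \<oplus> i \<in> I" by (rule I.a_closed[OF _ i(1)])
  then show "x \<in> I" using x ic by (simp add: R.minus_eq R.a_assoc R.l_neg)
qed auto

lemma image_prime:
  assumes Q: "primeideal Q R" and k: "\<And>x. \<lbrakk>x \<in> carrier R; h x = \<zero>\<^bsub>S\<^esub>\<rbrakk> \<Longrightarrow> x \<in> Q"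
  shows "primeideal (h ` Q) S"
proof -
  interpret Q: primeideal Q R by fact
  note mem = image_ideal_mem[OF Q.is_ideal k]
  show ?thesis
  proof (rule primeidealI[OF image_ideal[OF Q.is_ideal]])
    show "cring S" ..
    show "carrier S \<noteq> h ` Q"
    proof
      assume "carrier S = h ` Q"
      then have "h \<one> \<in> h ` Q" using S.one_closed by simp
      then show False using mem[of \<one>] Q.one_imp_carrier Q.I_notcarr by simp
    qed
    fix a b assume ab: "a \<in> carrier S" "b \<in> carrier S" "a \<otimes>\<^bsub>S\<^esub> b \<in> h ` Q"
    then obtain x y where xy: "x \<in> carrier R" "a = h x" "y \<in> carrier R" "b = h y" using lift_ex by blast
    then have "x \<otimes> y \<in> Q" using ab(3) mem[of "x \<otimes> y"] by simp
    then show "a \<in> h ` Q \<or> b \<in> h ` Q" using Q.I_prime[of x y] xy by auto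
  qed
qed

lemma pullback_module:
  assumes "module S M"
  shows "module R (pullback_module h M)"
proof -
  interpret M: module S M by fact
  show ?thesis
  proof (rule moduleI)
    show "abelian_group (pullback_module h M)"
    proof (rule abelian_groupI)
      fix x assume "x \<in> carrier (pullback_module h M)"
      then show "\<exists>y\<in>carrier (pullback_module h M). y \<oplus>\<^bsub>pullback_module h M\<^esub> x = \<zero>\<^bsub>pullback_module h M\<^esub>"
        by (intro bexI[of _ "\<ominus>\<^bsub>M\<^esub> x"]) (simp_all add: M.l_neg)
    qed (simp_all add: M.a_ac)
  qed (simp_all add: M.smult_l_distr M.smult_r_distr M.smult_assoc1 R.is_cring)
qed

text \<open>Surjectivity is what makes the two notions agree: every scalar of \<open>S\<close>
  lifts. Spans and finite generation then transfer unchanged.\<close>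

lemma pullback_submodule:
  assumes "module S M"
  shows "submodule N R (pullback_module h M) \<longleftrightarrow> submodule N S M"
proof -
  interpret M: module S M by fact
  interpret PM: module R "pullback_module h M" by (rule pullback_module[OF assms])
  show ?thesis
  proof
    assume N: "submodule N R (pullback_module h M)"
    show "submodule N S M"
    proof (rule M.submoduleI)
      fix a x assume "a \<in> carrier S" "x \<in> N"
      then show "a \<odot>\<^bsub>M\<^esub> x \<in> N" using PM.submoduleE(4)[OF N, of "lift a" x] lift[of a] by simp
    qed (use PM.submoduleE[OF N] PM.submodule_zero[OF N] in auto)
  next
    assume N: "submodule N S M"
    show "submodule N R (pullback_module h M)"
      by (rule PM.submoduleI) (use M.submoduleE[OF N] M.submodule_zero[OF N] in auto)
  qed
qed

lemma pullback_span: "module S M \<Longrightarrow> module_span R (pullback_module h M) T = module_span S M T"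
  unfolding module_span_def by (simp add: pullback_submodule)

lemma pullback_finitely_generated:
  "module S M \<Longrightarrow> finitely_generated R (pullback_module h M) \<longleftrightarrow> finitely_generated S M"
  unfolding finitely_generated_def by (simp add: pullback_span)

lemma pullback_regular3:
  assumes M: "module S M" and abc: "a \<in> carrier R" "b \<in> carrier R" "c \<in> carrier R"
    and "module.regular3 S M (h a) (h b) (h c)"
  shows "module.regular3 R (pullback_module h M) a b c"
  using assms(5) abc unfolding module.regular3_def[OF M] module.regular3_def[OF pullback_module[OF M]]
  by simp

end

section \<open>Free modules\<close>

context module
begin

lemma module_span_mono: "\<lbrakk>F \<subseteq> G; G \<subseteq> carrier M\<rbrakk> \<Longrightarrow> module_span R M F \<subseteq> module_span R M G"
  by (rule module_span_minimal[OF module_span_submodule subset_trans[OF _ module_span_superset]])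

text \<open>Freeness allows an infinite basis, while coordinates below are finite sums. The elements
  lying in spans of finite subsets of the basis form a submodule, hence everything; finitely many
  generators then use only finitely many basis elements.\<close>

lemma finite_basis:
  assumes fg: "finitely_generated R M" and free: "free_module R M"
  shows "\<exists>B. finite B \<and> B \<subseteq> carrier M \<and> lin_independent R M B \<and> module_span R M B = carrier M"
proof -
  obtain B where B: "B \<subseteq> carrier M" "lin_independent R M B" "module_span R M B = carrier M"
    using free unfolding free_module_def by blast
  obtain S where S: "finite S" "S \<subseteq> carrier M" "module_span R M S = carrier M"
    using fg unfolding finitely_generated_def by blast
  define N where "N = {x. \<exists>F. finite F \<and> F \<subseteq> B \<and> x \<in> module_span R M F}"
  have sub: "submodule (module_span R M F) R M" if "F \<subseteq> B" for F
    by (rule module_span_submodule) (use that B in auto)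
  have "submodule N R M"
  proof (rule submoduleI)
    show "N \<subseteq> carrier M" using submoduleE(1)[OF sub] by (auto simp: N_def)
    show "\<zero>\<^bsub>M\<^esub> \<in> N" using submodule_zero[OF sub[of "{}"]] by (auto simp: N_def)
    fix x assume "x \<in> N"
    then obtain F where F: "finite F" "F \<subseteq> B" "x \<in> module_span R M F" by (auto simp: N_def)
    show "\<ominus>\<^bsub>M\<^esub> x \<in> N" using F submoduleE(3)[OF sub[OF F(2)] F(3)] by (auto simp: N_def)
    show "a \<odot>\<^bsub>M\<^esub> x \<in> N" if "a \<in> carrier R" for a
      using F submoduleE(4)[OF sub[OF F(2)] that F(3)] by (auto simp: N_def)
    fix y assume "y \<in> N"
    then obtain G where G: "finite G" "G \<subseteq> B" "y \<in> module_span R M G" by (auto simp: N_def)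
    have FG: "F \<union> G \<subseteq> B" "F \<union> G \<subseteq> carrier M" using F G B by auto
    have "x \<in> module_span R M (F \<union> G)" "y \<in> module_span R M (F \<union> G)"
      using F(3) G(3) module_span_mono[of F "F \<union> G"] module_span_mono[of G "F \<union> G"] FG by auto
    then have "x \<oplus>\<^bsub>M\<^esub> y \<in> module_span R M (F \<union> G)" by (rule submoduleE(5)[OF sub[OF FG(1)]])
    then show "x \<oplus>\<^bsub>M\<^esub> y \<in> N" using F(1) G(1) FG(1) by (auto simp: N_def)
  qed
  moreover have "B \<subseteq> N"
  proof
    fix b assume "b \<in> B"
    then show "b \<in> N" using module_span_superset[of "{b}"] by (auto simp: N_def intro!: exI[of _ "{b}"])
  qed
  ultimately have "carrier M \<subseteq> N" using module_span_minimal B(3) by blast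
  then have "\<forall>s\<in>S. \<exists>F. finite F \<and> F \<subseteq> B \<and> s \<in> module_span R M F" using S(2) by (auto simp: N_def)
  from bchoice[OF this] obtain F where F: "\<forall>s\<in>S. finite (F s) \<and> F s \<subseteq> B \<and> s \<in> module_span R M (F s)"
    by (elim exE)
  define G where "G = (\<Union>s\<in>S. F s)"
  have G: "finite G" "G \<subseteq> B" "G \<subseteq> carrier M" using F S(1) B(1) by (auto simp: G_def)
  have "S \<subseteq> module_span R M G"
  proof
    fix s assume s: "s \<in> S"
    then have "module_span R M (F s) \<subseteq> module_span R M G"
      by (intro module_span_mono G(3)) (auto simp: G_def)
    then show "s \<in> module_span R M G" using F s by auto
  qed
  then have "carrier M \<subseteq> module_span R M G"
    using module_span_minimal[OF sub[OF G(2)]] S(3) by auto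
  then have "module_span R M G = carrier M" using submoduleE(1)[OF sub[OF G(2)]] by auto
  moreover have "lin_independent R M G" using B(2) G(2) unfolding lin_independent_def by (meson subset_trans)
  ultimately show ?thesis using G by blast
qed

lemma coordinates_unique:
  assumes B: "finite B" "B \<subseteq> carrier M" "lin_independent R M B"
    and c: "c \<in> B \<rightarrow> carrier R" "e \<in> B \<rightarrow> carrier R"
    and eq: "(\<Oplus>\<^bsub>M\<^esub>b\<in>B. c b \<odot>\<^bsub>M\<^esub> b) = (\<Oplus>\<^bsub>M\<^esub>b\<in>B. e b \<odot>\<^bsub>M\<^esub> b)" and b: "b \<in> B"
  shows "c b = e b"
proof -
  have ec: "(\<Oplus>\<^bsub>M\<^esub>b\<in>B. e b \<odot>\<^bsub>M\<^esub> b) \<in> carrier M" by (rule comb_closed[OF c(2) B(2)])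
  have "(\<Oplus>\<^bsub>M\<^esub>b\<in>B. (c b \<oplus> \<ominus> \<one> \<otimes> e b) \<odot>\<^bsub>M\<^esub> b) =
     (\<Oplus>\<^bsub>M\<^esub>b\<in>B. c b \<odot>\<^bsub>M\<^esub> b) \<oplus>\<^bsub>M\<^esub> \<ominus> \<one> \<odot>\<^bsub>M\<^esub> (\<Oplus>\<^bsub>M\<^esub>b\<in>B. e b \<odot>\<^bsub>M\<^esub> b)"
    using c B by (subst finsum_comb_add) (auto simp: finsum_comb_smult)
  also have "\<dots> = \<zero>\<^bsub>M\<^esub>" unfolding eq using ec by (simp add: smult_l_minus M.r_neg)
  finally have "(\<Oplus>\<^bsub>M\<^esub>b\<in>B. (c b \<oplus> \<ominus> \<one> \<otimes> e b) \<odot>\<^bsub>M\<^esub> b) = \<zero>\<^bsub>M\<^esub>" .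
  moreover have "(\<lambda>b. c b \<oplus> \<ominus> \<one> \<otimes> e b) \<in> B \<rightarrow> carrier R" using c by auto
  ultimately have "c b \<oplus> \<ominus> \<one> \<otimes> e b = \<zero>"
    using B(1,3) b unfolding lin_independent_def by blast
  moreover have "c b \<in> carrier R" "e b \<in> carrier R" using c b by auto
  ultimately show ?thesis using R.sum_zero_eq_neg[of "c b" "\<ominus> e b"] by (simp add: R.l_minus)
qed

lemma trivial_relations_imp_free:
  assumes S: "finite S" "S \<subseteq> carrier M" "module_span R M S = carrier M"
    and triv: "\<And>r s. \<lbrakk>r \<in> relations S; s \<in> S\<rbrakk> \<Longrightarrow> r s = \<zero>"
  shows "free_module R M"
proof -
  have "lin_independent R M S"
    unfolding lin_independent_def
  proof (intro allI impI ballI, elim conjE)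
    fix F c b assume F: "finite F" "F \<subseteq> S" "c \<in> F \<rightarrow> carrier R" "(\<Oplus>\<^bsub>M\<^esub>b\<in>F. c b \<odot>\<^bsub>M\<^esub> b) = \<zero>\<^bsub>M\<^esub>"
      and b: "b \<in> F"
    define r where "r s = (if s \<in> F then c s else \<zero>)" for s
    have "(\<Oplus>\<^bsub>M\<^esub>b\<in>F. c b \<odot>\<^bsub>M\<^esub> b) = (\<Oplus>\<^bsub>M\<^esub>s\<in>S. r s \<odot>\<^bsub>M\<^esub> s)"
      by (rule M.add.finprod_mono_neutral_cong_left) (use S F in \<open>auto simp: r_def Pi_iff subset_iff\<close>)
    then have "r \<in> relations S" using F by (auto simp: relations_def r_def)
    then have "r b = \<zero>" using triv F(2) b by blast
    then show "c b = \<zero>" using b by (simp add: r_def)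
  qed
  then show ?thesis using S unfolding free_module_def by blast
qed

text \<open>Nakayama: a minimal generator \<open>s\<close> would be a combination with coefficients
  in \<open>m\<close>, giving a relation in which \<open>s\<close> has the unit coefficient
  \<open>c s - 1\<close>. So a minimal generating set is empty. This covers the convention that such
  a module has infinite depth.\<close>

lemma max_smult_eq_imp_trivial:
  assumes fg: "finitely_generated R M" and m: "ideal m R" "m \<noteq> carrier R"
    and local: "\<And>a. \<lbrakk>a \<in> carrier R; a \<notin> m\<rbrakk> \<Longrightarrow> a \<in> Units R"
    and eq: "set_smult R M m = carrier M"
  shows "free_module R M"
proof -
  interpret m: ideal m R by fact
  obtain S where S: "finite S" "S \<subseteq> carrier M" "module_span R M S = carrier M"
    and rel: "\<forall>c\<in>relations S. \<forall>s\<in>S. c s \<in> m"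
    using minimal_generators[OF fg m(1) local] by blast
  let ?N = "{\<Oplus>\<^bsub>M\<^esub>s\<in>S. c s \<odot>\<^bsub>M\<^esub> s | c. c \<in> S \<rightarrow> m}"
  have N: "submodule ?N R M" by (rule ideal_comb_submodule[OF S(1,2) m(1)])
  have "{a \<odot>\<^bsub>M\<^esub> x | a x. a \<in> m \<and> x \<in> carrier M} \<subseteq> ?N"
    using smult_in_ideal_comb[OF S m(1)] by blast
  then have cN: "carrier M \<subseteq> ?N"
    using module_span_minimal[OF N] eq unfolding set_smult_def by blast
  have "r s = \<zero>" if r: "r \<in> relations S" and s: "s \<in> S" for r s
  proof -
    have sc: "s \<in> carrier M" using s S by auto
    have "s \<in> ?N" using cN sc by (rule subsetD)
    then obtain c where c: "c \<in> S \<rightarrow> m" "s = (\<Oplus>\<^bsub>M\<^esub>t\<in>S. c t \<odot>\<^bsub>M\<^esub> t)" by blast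
    have cR: "c \<in> S \<rightarrow> carrier R" using c(1) by (auto intro!: m.Icarr)
    have "(\<Oplus>\<^bsub>M\<^esub>t\<in>S. (c t \<oplus> (if t = s then \<ominus> \<one> else \<zero>)) \<odot>\<^bsub>M\<^esub> t) =
        s \<oplus>\<^bsub>M\<^esub> (\<ominus> \<one>) \<odot>\<^bsub>M\<^esub> s"
      using cR S s c(2)[symmetric] by (subst finsum_comb_add) (auto simp: comb_single)
    also have "\<dots> = \<zero>\<^bsub>M\<^esub>" using sc by (simp add: smult_l_minus M.r_neg)
    finally have "(\<lambda>t. c t \<oplus> (if t = s then \<ominus> \<one> else \<zero>)) \<in> relations S"
      using cR by (auto simp: relations_def)
    then have "c s \<oplus> \<ominus> \<one> \<in> m" using rel s by fastforce
    then have "\<ominus> (c s \<oplus> \<ominus> \<one>) \<oplus> c s \<in> m" using c(1) s m.a_closed m.a_inv_closed by auto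
    moreover have "c s \<in> carrier R" using cR s by auto
    then have "\<ominus> (c s \<oplus> \<ominus> \<one>) \<oplus> c s = \<one>" by (simp add: R.minus_add R.a_ac R.r_neg1 R.r_neg2 R.neg_cancel_outer R.l_neg R.r_neg)
    ultimately have "\<one> \<in> m" by simp
    then show ?thesis using m.one_imp_carrier m(2) by simp
  qed
  then show ?thesis by (rule trivial_relations_imp_free[OF S])
qed

end

section \<open>From a basis to a connection\<close>

lemma derivationsD:
  assumes "D \<in> carrier (derivations K A)"
  shows "D \<in> carrier A \<rightarrow>\<^sub>E carrier A"
    "\<And>a b. \<lbrakk>a \<in> carrier A; b \<in> carrier A\<rbrakk> \<Longrightarrow> D (a \<oplus>\<^bsub>A\<^esub> b) = D a \<oplus>\<^bsub>A\<^esub> D b"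
    "\<And>c a. \<lbrakk>c \<in> carrier K; a \<in> carrier A\<rbrakk> \<Longrightarrow> D (c \<odot>\<^bsub>A\<^esub> a) = c \<odot>\<^bsub>A\<^esub> D a"
    "\<And>a b. \<lbrakk>a \<in> carrier A; b \<in> carrier A\<rbrakk> \<Longrightarrow> D (a \<otimes>\<^bsub>A\<^esub> b) = a \<otimes>\<^bsub>A\<^esub> D b \<oplus>\<^bsub>A\<^esub> b \<otimes>\<^bsub>A\<^esub> D a"
    "\<And>a. a \<in> carrier A \<Longrightarrow> D a \<in> carrier A"
  using assms unfolding derivations_def linear_maps_def by auto

lemma derivations_simps:
  "D \<oplus>\<^bsub>derivations K A\<^esub> E = (\<lambda>a\<in>carrier A. D a \<oplus>\<^bsub>A\<^esub> E a)"
  "b \<odot>\<^bsub>derivations K A\<^esub> D = (\<lambda>a\<in>carrier A. b \<otimes>\<^bsub>A\<^esub> D a)"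
  unfolding derivations_def by simp_all

lemma derivationsI:
  assumes "D \<in> carrier A \<rightarrow>\<^sub>E carrier A"
    "\<And>a b. \<lbrakk>a \<in> carrier A; b \<in> carrier A\<rbrakk> \<Longrightarrow> D (a \<oplus>\<^bsub>A\<^esub> b) = D a \<oplus>\<^bsub>A\<^esub> D b"
    "\<And>c a. \<lbrakk>c \<in> carrier K; a \<in> carrier A\<rbrakk> \<Longrightarrow> D (c \<odot>\<^bsub>A\<^esub> a) = c \<odot>\<^bsub>A\<^esub> D a"
    "\<And>a b. \<lbrakk>a \<in> carrier A; b \<in> carrier A\<rbrakk> \<Longrightarrow> D (a \<otimes>\<^bsub>A\<^esub> b) = a \<otimes>\<^bsub>A\<^esub> D b \<oplus>\<^bsub>A\<^esub> b \<otimes>\<^bsub>A\<^esub> D a"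
  shows "D \<in> carrier (derivations K A)"
  using assms unfolding derivations_def linear_maps_def by auto

text \<open>The connection for which the basis is flat: a derivation acts on coordinates. Finiteness
  and uniqueness of coordinates make this well defined and give the Leibniz rule.\<close>

lemma free_imp_connection:
  assumes alg: "algebra K A" and M: "module A M"
    and fg: "finitely_generated A M" and free: "free_module A M"
  shows "\<exists>nabla. module_connection K A M nabla"
proof -
  interpret RA: cring A by (rule algebra.M_cring[OF alg])
  interpret A: algebra K A by fact
  interpret AM: module A M by fact
  obtain B where B: "finite B" "B \<subseteq> carrier M" "lin_independent A M B" "module_span A M B = carrier M"
    using AM.finite_basis[OF fg free] by blast
  note uniq = AM.coordinates_unique[OF B(1-3)]
  have "\<forall>x\<in>carrier M. \<exists>c. c \<in> B \<rightarrow> carrier A \<and> x = (\<Oplus>\<^bsub>M\<^esub>b\<in>B. c b \<odot>\<^bsub>M\<^esub> b)"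
    using B(4) unfolding AM.module_span_finite[OF B(1,2)] by blast
  from bchoice[OF this] obtain \<kappa> where
    "\<forall>x\<in>carrier M. \<kappa> x \<in> B \<rightarrow> carrier A \<and> x = (\<Oplus>\<^bsub>M\<^esub>b\<in>B. \<kappa> x b \<odot>\<^bsub>M\<^esub> b)" by (elim exE)
  then have k: "\<kappa> x \<in> B \<rightarrow> carrier A" "(\<Oplus>\<^bsub>M\<^esub>b\<in>B. \<kappa> x b \<odot>\<^bsub>M\<^esub> b) = x" if "x \<in> carrier M" for x
    using that by auto
  have kc: "\<kappa> x b \<in> carrier A" if "x \<in> carrier M" "b \<in> B" for x b using k(1)[OF that(1)] that(2) by auto
  have k_add: "\<kappa> (x \<oplus>\<^bsub>M\<^esub> y) b = \<kappa> x b \<oplus>\<^bsub>A\<^esub> \<kappa> y b" if x: "x \<in> carrier M" and y: "y \<in> carrier M" and b: "b \<in> B" for x y b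
  proof (rule uniq[OF _ _ _ b])
    show "(\<Oplus>\<^bsub>M\<^esub>b\<in>B. \<kappa> (x \<oplus>\<^bsub>M\<^esub> y) b \<odot>\<^bsub>M\<^esub> b) = (\<Oplus>\<^bsub>M\<^esub>b\<in>B. (\<kappa> x b \<oplus>\<^bsub>A\<^esub> \<kappa> y b) \<odot>\<^bsub>M\<^esub> b)"
      using x y k B by (simp add: AM.finsum_comb_add)
  qed (use k[of "x \<oplus>\<^bsub>M\<^esub> y"] x y kc in auto)
  have k_smult: "\<kappa> (a \<odot>\<^bsub>M\<^esub> x) b = a \<otimes>\<^bsub>A\<^esub> \<kappa> x b" if a: "a \<in> carrier A" and x: "x \<in> carrier M" and b: "b \<in> B" for a x b
  proof (rule uniq[OF _ _ _ b])
    show "(\<Oplus>\<^bsub>M\<^esub>b\<in>B. \<kappa> (a \<odot>\<^bsub>M\<^esub> x) b \<odot>\<^bsub>M\<^esub> b) = (\<Oplus>\<^bsub>M\<^esub>b\<in>B. (a \<otimes>\<^bsub>A\<^esub> \<kappa> x b) \<odot>\<^bsub>M\<^esub> b)"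
      using a x k B by (simp add: AM.finsum_comb_smult)
  qed (use k[of "a \<odot>\<^bsub>M\<^esub> x"] a x kc in auto)
  define T where "T D m = (\<Oplus>\<^bsub>M\<^esub>b\<in>B. D (\<kappa> m b) \<odot>\<^bsub>M\<^esub> b)" for D m
  have Dk: "(\<lambda>b. D (\<kappa> m b)) \<in> B \<rightarrow> carrier A" if "D \<in> carrier (derivations K A)" "m \<in> carrier M" for D m
    using derivationsD(5)[OF that(1)] kc[OF that(2)] by auto
  have T_closed: "T D m \<in> carrier M" if "D \<in> carrier (derivations K A)" "m \<in> carrier M" for D m
    unfolding T_def by (rule AM.comb_closed[OF Dk[OF that] B(2)])
  have cong: "(\<Oplus>\<^bsub>M\<^esub>b\<in>B. c b \<odot>\<^bsub>M\<^esub> b) = (\<Oplus>\<^bsub>M\<^esub>b\<in>B. e b \<odot>\<^bsub>M\<^esub> b)"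
    if "\<And>b. b \<in> B \<Longrightarrow> c b = e b" "e \<in> B \<rightarrow> carrier A" for c e
    by (rule AM.finsum_cong') (use that B in \<open>auto simp: Pi_iff subset_iff\<close>)
  have T_add: "T D (x \<oplus>\<^bsub>M\<^esub> y) = T D x \<oplus>\<^bsub>M\<^esub> T D y"
    if D: "D \<in> carrier (derivations K A)" and xy: "x \<in> carrier M" "y \<in> carrier M" for D x y
    unfolding T_def AM.finsum_comb_add[OF Dk[OF D xy(1)] Dk[OF D xy(2)] B(2), symmetric]
    by (rule cong) (use D xy kc k_add derivationsD(2,5)[OF D] in auto)
  have T_leibniz: "T D (a \<odot>\<^bsub>M\<^esub> x) = a \<odot>\<^bsub>M\<^esub> T D x \<oplus>\<^bsub>M\<^esub> D a \<odot>\<^bsub>M\<^esub> x"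
    if D: "D \<in> carrier (derivations K A)" and a: "a \<in> carrier A" and x: "x \<in> carrier M" for D a x
  proof -
    have Da: "D a \<in> carrier A" by (rule derivationsD(5)[OF D a])
    have "T D (a \<odot>\<^bsub>M\<^esub> x) = (\<Oplus>\<^bsub>M\<^esub>b\<in>B. (a \<otimes>\<^bsub>A\<^esub> D (\<kappa> x b) \<oplus>\<^bsub>A\<^esub> D a \<otimes>\<^bsub>A\<^esub> \<kappa> x b) \<odot>\<^bsub>M\<^esub> b)"
      unfolding T_def
      by (rule cong) (use D a Da x kc[OF x] k_smult[OF a x] derivationsD(4,5)[OF D] in \<open>auto simp: RA.m_comm\<close>)
    also have "\<dots> = (\<Oplus>\<^bsub>M\<^esub>b\<in>B. (a \<otimes>\<^bsub>A\<^esub> D (\<kappa> x b)) \<odot>\<^bsub>M\<^esub> b) \<oplus>\<^bsub>M\<^esub> (\<Oplus>\<^bsub>M\<^esub>b\<in>B. (D a \<otimes>\<^bsub>A\<^esub> \<kappa> x b) \<odot>\<^bsub>M\<^esub> b)"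
      by (rule AM.finsum_comb_add) (use a Da Dk[OF D x] kc[OF x] B in auto)
    also have "\<dots> = a \<odot>\<^bsub>M\<^esub> T D x \<oplus>\<^bsub>M\<^esub> D a \<odot>\<^bsub>M\<^esub> x"
      using a Da Dk[OF D x] k[OF x] B by (simp add: AM.finsum_comb_smult T_def)
    finally show ?thesis .
  qed
  \<comment> \<open>Scalars of \<open>K\<close> act on \<open>M\<close> through \<open>A\<close>, so
    linearity over \<open>K\<close> is the Leibniz rule with a vanishing second term.\<close>
  have Dzero: "D (c \<odot>\<^bsub>A\<^esub> \<one>\<^bsub>A\<^esub>) = \<zero>\<^bsub>A\<^esub>" if D: "D \<in> carrier (derivations K A)" and c: "c \<in> carrier K" for D c
  proof -
    have "D \<one>\<^bsub>A\<^esub> \<oplus>\<^bsub>A\<^esub> D \<one>\<^bsub>A\<^esub> = D \<one>\<^bsub>A\<^esub>"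
      using derivationsD(4)[OF D, of "\<one>\<^bsub>A\<^esub>" "\<one>\<^bsub>A\<^esub>"] derivationsD(5)[OF D, of "\<one>\<^bsub>A\<^esub>"] by simp
    then have "D \<one>\<^bsub>A\<^esub> = \<zero>\<^bsub>A\<^esub>"
      using derivationsD(5)[OF D, of "\<one>\<^bsub>A\<^esub>"] RA.add.l_cancel_one'[of "D \<one>\<^bsub>A\<^esub>" "D \<one>\<^bsub>A\<^esub>"] by simp
    then show ?thesis using derivationsD(3)[OF D c, of "\<one>\<^bsub>A\<^esub>"] c by simp
  qed
  define nabla where "nabla = (\<lambda>D\<in>carrier (derivations K A). \<lambda>m\<in>carrier M. T D m)"
  have closed_add: "D \<oplus>\<^bsub>derivations K A\<^esub> E \<in> carrier (derivations K A)"
    if D: "D \<in> carrier (derivations K A)" and E: "E \<in> carrier (derivations K A)" for D E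
    unfolding derivations_simps
    by (rule derivationsI)
      (use derivationsD[OF D] derivationsD[OF E] in
        \<open>simp_all add: RA.a_ac RA.r_distr A.smult_r_distr PiE_iff\<close>)
  have closed_smult: "a \<odot>\<^bsub>derivations K A\<^esub> D \<in> carrier (derivations K A)"
    if D: "D \<in> carrier (derivations K A)" and a: "a \<in> carrier A" for D a
    unfolding derivations_simps
  proof (rule derivationsI)
    fix c x assume "c \<in> carrier K" "x \<in> carrier A"
    then show "(\<lambda>x\<in>carrier A. a \<otimes>\<^bsub>A\<^esub> D x) (c \<odot>\<^bsub>A\<^esub> x) = c \<odot>\<^bsub>A\<^esub> (\<lambda>x\<in>carrier A. a \<otimes>\<^bsub>A\<^esub> D x) x"
      using derivationsD(3,5)[OF D] a A.smult_assoc2[of c "D x" a] by (simp add: RA.m_comm[of a])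
  qed (use derivationsD[OF D] a in \<open>simp_all add: RA.r_distr RA.m_ac PiE_iff\<close>)
  have nabla_end: "nabla D \<in> carrier (endomorphisms K A M)" if D: "D \<in> carrier (derivations K A)" for D
  proof -
    have "(\<lambda>m\<in>carrier M. T D m) \<in> linear_maps K (restrict_scalars A M) (restrict_scalars A M)"
      unfolding linear_maps_def restrict_scalars_def
      using T_closed[OF D] T_add[OF D] T_leibniz[OF D] Dzero[OF D] by simp
    then show ?thesis unfolding endomorphisms_def nabla_def using D by simp
  qed
  have "nabla \<in> linear_maps A (derivations K A) (endomorphisms K A M)"
    unfolding linear_maps_def mem_Collect_eq
  proof (intro conjI ballI)
    show "nabla \<in> carrier (derivations K A) \<rightarrow>\<^sub>E carrier (endomorphisms K A M)"
      using nabla_end by (auto simp: nabla_def)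
    fix D E assume D: "D \<in> carrier (derivations K A)" and E: "E \<in> carrier (derivations K A)"
    have "T (D \<oplus>\<^bsub>derivations K A\<^esub> E) m = T D m \<oplus>\<^bsub>M\<^esub> T E m" if m: "m \<in> carrier M" for m
      unfolding T_def AM.finsum_comb_add[OF Dk[OF D m] Dk[OF E m] B(2), symmetric]
      by (rule cong) (use kc[OF m] derivationsD(5)[OF D] derivationsD(5)[OF E] in \<open>auto simp: derivations_simps\<close>)
    then show "nabla (D \<oplus>\<^bsub>derivations K A\<^esub> E) = nabla D \<oplus>\<^bsub>endomorphisms K A M\<^esub> nabla E"
      using D E closed_add[OF D E] by (auto simp: nabla_def endomorphisms_def fun_eq_iff restrict_def)
  next
    fix a D assume a: "a \<in> carrier A" and D: "D \<in> carrier (derivations K A)"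
    have "T (a \<odot>\<^bsub>derivations K A\<^esub> D) m = a \<odot>\<^bsub>M\<^esub> T D m" if m: "m \<in> carrier M" for m
      unfolding T_def AM.finsum_comb_smult[OF B(1) Dk[OF D m] a B(2), symmetric]
      by (rule cong) (use a kc[OF m] derivationsD(5)[OF D] in \<open>auto simp: derivations_simps\<close>)
    then show "nabla (a \<odot>\<^bsub>derivations K A\<^esub> D) = a \<odot>\<^bsub>endomorphisms K A M\<^esub> nabla D"
      using D closed_smult[OF D a] by (auto simp: nabla_def endomorphisms_def fun_eq_iff restrict_def)
  qed
  moreover have "nabla D (a \<odot>\<^bsub>M\<^esub> m) = a \<odot>\<^bsub>M\<^esub> nabla D m \<oplus>\<^bsub>M\<^esub> D a \<odot>\<^bsub>M\<^esub> m"
    if "D \<in> carrier (derivations K A)" "a \<in> carrier A" "m \<in> carrier M" for D a m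
    using that T_leibniz by (simp add: nabla_def)
  ultimately show ?thesis unfolding module_connection_def by blast
qed

section \<open>Jacobian ideals and the simple equations\<close>

context power_series_field
begin

text \<open>Written as a set of values of derivations, so that membership directly hands over the
  derivation required for the regular sequence.\<close>

definition jacobian where "jacobian F = {D F | D. D \<in> K_derivations}"

lemma K_derivations_closed: "\<lbrakk>D \<in> K_derivations; x \<in> carrier P\<rbrakk> \<Longrightarrow> D x \<in> carrier P"
  unfolding K_derivations_def using ring_derivation.D_closed by auto

lemma jacobianI: "D \<in> K_derivations \<Longrightarrow> D F \<in> jacobian F"
  unfolding jacobian_def by blast

lemma jacobian_comb:
  assumes "x \<in> jacobian F" "y \<in> jacobian F" "a \<in> carrier P" "b \<in> carrier P"
  shows "a \<otimes>\<^bsub>P\<^esub> x \<oplus>\<^bsub>P\<^esub> b \<otimes>\<^bsub>P\<^esub> y \<in> jacobian F"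
proof -
  obtain D E where D: "D \<in> K_derivations" "x = D F" and E: "E \<in> K_derivations" "y = E F"
    using assms unfolding jacobian_def by blast
  have "(\<lambda>z. a \<otimes>\<^bsub>P\<^esub> D z \<oplus>\<^bsub>P\<^esub> b \<otimes>\<^bsub>P\<^esub> E z) \<in> K_derivations"
    by (rule K_derivations_comb[OF D(1) E(1) assms(3,4)])
  from jacobianI[OF this, of F] show ?thesis unfolding D(2) E(2) .
qed

lemma jacobian_ideal:
  assumes F: "F \<in> carrier P"
  shows "ideal (jacobian F) P"
proof -
  have car: "jacobian F \<subseteq> carrier P" unfolding jacobian_def using K_derivations_closed F by auto
  have smult: "a \<otimes>\<^bsub>P\<^esub> x \<in> jacobian F" if "x \<in> jacobian F" "a \<in> carrier P" for a x
    using jacobian_comb[OF that(1) that(1) that(2), of "\<zero>\<^bsub>P\<^esub>"] that car by auto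
  show ?thesis
  proof (rule idealI)
    show "subgroup (jacobian F) (add_monoid P)"
    proof (rule P.add.subgroupI[OF car])
      show "jacobian F \<noteq> {}" using jacobianI[OF ps_deriv_K_derivation[of 0]] by blast
      fix x assume x: "x \<in> jacobian F"
      then have xP: "x \<in> carrier P" using car by auto
      have "\<ominus>\<^bsub>P\<^esub> x = (\<ominus>\<^bsub>P\<^esub> \<one>\<^bsub>P\<^esub>) \<otimes>\<^bsub>P\<^esub> x" using xP by (simp add: P.l_minus)
      then show "\<ominus>\<^bsub>P\<^esub> x \<in> jacobian F" using smult[OF x, of "\<ominus>\<^bsub>P\<^esub> \<one>\<^bsub>P\<^esub>"] by simp
      fix y assume y: "y \<in> jacobian F"
      then have yP: "y \<in> carrier P" using car by auto
      show "x \<oplus>\<^bsub>P\<^esub> y \<in> jacobian F"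
        using jacobian_comb[OF x y P.one_closed P.one_closed] xP yP by simp
    qed
    fix x a assume "x \<in> jacobian F" "a \<in> carrier P"
    then show "a \<otimes>\<^bsub>P\<^esub> x \<in> jacobian F" "x \<otimes>\<^bsub>P\<^esub> a \<in> jacobian F"
      using smult[of x a] P.m_comm[of a x] subsetD[OF car, of x] by simp_all
  qed (rule P.ring_axioms)
qed

lemma ideal_nat_div:
  assumes I: "ideal I P" and p: "p \<in> carrier P" and n: "(n::nat) > 0" "[n] \<cdot>\<^bsub>P\<^esub> p \<in> I"
  shows "p \<in> I"
proof -
  interpret I: ideal I P by fact
  define c where "c = inv ([n] \<cdot>\<^bsub>K\<^esub> \<one>)"
  have c: "c \<in> carrier K" "c \<otimes> [n] \<cdot>\<^bsub>K\<^esub> \<one> = \<one>"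
    using field_Units char_zero[OF n(1)] by (auto simp: c_def)
  have "ps_const c \<otimes>\<^bsub>P\<^esub> ([n] \<cdot>\<^bsub>P\<^esub> p) = p"
  proof -
    have "ps_const c \<otimes>\<^bsub>P\<^esub> ([n] \<cdot>\<^bsub>P\<^esub> p) = c \<odot>\<^bsub>P\<^esub> ([n] \<cdot>\<^bsub>P\<^esub> p)" using c p by (simp add: ps_smult_const)
    also have "\<dots> = p"
    proof (rule ps_eqI)
      fix m assume m: "m \<in> monomials d"
      have "c \<otimes> [n] \<cdot>\<^bsub>K\<^esub> (\<one> \<otimes> p m) = (c \<otimes> [n] \<cdot>\<^bsub>K\<^esub> \<one>) \<otimes> p m"
        using c(1) p m by (simp add: add_pow_ldistr[symmetric] m_assoc del: l_one)
      then show "(c \<odot>\<^bsub>P\<^esub> ([n] \<cdot>\<^bsub>P\<^esub> p)) m = p m" using c p m by (simp add: coeff_nat_multiple)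
    qed (use c p ps_smult_closed in auto)
    finally show ?thesis .
  qed
  moreover have "ps_const c \<otimes>\<^bsub>P\<^esub> ([n] \<cdot>\<^bsub>P\<^esub> p) \<in> I" using n(2) c(1) by (intro I.I_l_closed) auto
  ultimately show ?thesis by simp
qed

lemma ideal_pow_mono:
  assumes I: "ideal I P" and p: "p \<in> carrier P" "p [^]\<^bsub>P\<^esub> (k::nat) \<in> I" and kl: "k \<le> l"
  shows "p [^]\<^bsub>P\<^esub> l \<in> I"
proof -
  interpret I: ideal I P by fact
  have "p [^]\<^bsub>P\<^esub> l = p [^]\<^bsub>P\<^esub> (l - k) \<otimes>\<^bsub>P\<^esub> p [^]\<^bsub>P\<^esub> k"
    using p kl by (simp add: P.nat_pow_mult)
  then show ?thesis using p I.I_l_closed[OF p(2), of "p [^]\<^bsub>P\<^esub> (l - k)"] by simp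
qed

lemma ord_ge_subset_ideal:
  assumes I: "ideal I P" and k: "\<And>i. i \<le> d \<Longrightarrow> ps_var K d i [^]\<^bsub>P\<^esub> (k::nat) \<in> I"
  shows "ord_ge (\<lambda>_. 1) (Suc d * k) \<subseteq> I"
proof
  interpret I: ideal I P by fact
  fix a assume "a \<in> ord_ge (\<lambda>_. 1) (Suc d * k)"
  then obtain c where c: "c \<in> {..d} \<rightarrow> carrier P"
    "a = (\<Oplus>\<^bsub>P\<^esub>i\<in>{..d}. ps_var K d i [^]\<^bsub>P\<^esub> k \<otimes>\<^bsub>P\<^esub> c i)"
    using ord_ge_one_decomposition by blast
  have "finsum P g B \<in> I" if "finite B" "g \<in> B \<rightarrow> I" for g and B :: "nat set"
    using that
  proof (induction B rule: finite_induct)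
    case empty
    then show ?case using additive_subgroup.zero_closed[OF I.is_additive_subgroup] by simp
  next
    case (insert x F)
    then have "g \<in> F \<rightarrow> carrier P" "g x \<in> carrier P" "g x \<in> I" "finsum P g F \<in> I"
      by (auto intro!: I.Icarr)
    then show ?case using insert I.a_closed by simp
  qed
  from this[of "{..d}" "\<lambda>i. ps_var K d i [^]\<^bsub>P\<^esub> k \<otimes>\<^bsub>P\<^esub> c i"] show "a \<in> I"
    unfolding c(2) using c(1) k by (auto intro!: I.I_r_closed)
qed

lemma deriv_pow:
  assumes i: "i \<le> d" and x: "x \<in> carrier P"
  shows "ps_deriv i (x [^]\<^bsub>P\<^esub> Suc n) = [Suc n] \<cdot>\<^bsub>P\<^esub> (x [^]\<^bsub>P\<^esub> n \<otimes>\<^bsub>P\<^esub> ps_deriv i x)"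
proof (induction n)
  case 0
  show ?case using x i by simp
next
  case (Suc n)
  define y where "y = x [^]\<^bsub>P\<^esub> n \<otimes>\<^bsub>P\<^esub> ps_deriv i x"
  have y: "y \<in> carrier P" using x i by (simp add: y_def)
  have "ps_deriv i (x [^]\<^bsub>P\<^esub> Suc (Suc n)) =
      x [^]\<^bsub>P\<^esub> Suc n \<otimes>\<^bsub>P\<^esub> ps_deriv i x \<oplus>\<^bsub>P\<^esub> x \<otimes>\<^bsub>P\<^esub> ps_deriv i (x [^]\<^bsub>P\<^esub> Suc n)"
    using x i ps_deriv_mult[OF i, of "x [^]\<^bsub>P\<^esub> Suc n" x] by simp
  also have "\<dots> = x \<otimes>\<^bsub>P\<^esub> y \<oplus>\<^bsub>P\<^esub> [Suc n] \<cdot>\<^bsub>P\<^esub> (x \<otimes>\<^bsub>P\<^esub> y)"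
    unfolding Suc y_def[symmetric] using x i y
    by (simp add: P.add_pow_rdistr y_def P.m_ac del: P.add.nat_pow_Suc)
  also have "\<dots> = [Suc (Suc n)] \<cdot>\<^bsub>P\<^esub> (x \<otimes>\<^bsub>P\<^esub> y)" using x y by (simp add: P.a_ac)
  also have "x \<otimes>\<^bsub>P\<^esub> y = x [^]\<^bsub>P\<^esub> Suc n \<otimes>\<^bsub>P\<^esub> ps_deriv i x" using x i by (simp add: y_def P.m_ac)
  finally show ?case .
qed

text \<open>The partials of \<open>F\<close> are those of the plane curve \<open>b\<close> together
  with \<open>2 z_j\<close> for \<open>j\<close> at least 2. Powers of all variables thus lie in the
  Jacobian ideal once this holds for the two variables of the curve, which \<open>jac\<close> states
  for any ideal containing its partials.\<close>

lemma suspension_of_curve: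
  assumes d: "3 \<le> d" and b: "b \<in> max_ps" "\<And>i. 2 \<le> i \<Longrightarrow> b \<in> deg_le i 0"
    and jac: "\<And>I. \<lbrakk>ideal I P; ps_deriv 0 b \<in> I; ps_deriv 1 b \<in> I\<rbrakk>
      \<Longrightarrow> ps_var K d 0 [^]\<^bsub>P\<^esub> k \<in> I \<and> ps_var K d 1 [^]\<^bsub>P\<^esub> k \<in> I" and k: "(k::nat) > 0"
    and F: "F = b \<oplus>\<^bsub>P\<^esub> (\<Oplus>\<^bsub>P\<^esub>i\<in>{2..d}. ps_var K d i [^]\<^bsub>P\<^esub> (2::nat))"
  shows "\<exists>g N. double_suspension K d g \<and> F = double_suspension.f K d g \<and>
    ord_ge (\<lambda>_. 1) N \<subseteq> jacobian F"
proof -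
  interpret m: ideal max_ps P by (rule max_ps_ideal)
  have bP: "b \<in> carrier P" using b max_ps_carrier by auto
  define sq where "sq i = ps_var K d i [^]\<^bsub>P\<^esub> (2::nat)" for i
  have sq: "sq i \<in> carrier P" for i by (simp add: sq_def)
  define q where "q = (\<Oplus>\<^bsub>P\<^esub>i\<in>{2..d - 2}. sq i)"
  have q: "q \<in> carrier P" using sq by (auto simp: q_def intro!: P.finsum_closed)
  define g where "g = b \<oplus>\<^bsub>P\<^esub> q"
  \<comment> \<open>The last two squares become those of \<open>w\<close> and \<open>t\<close>, the
    others go into \<open>g\<close>. For \<open>d = 3\<close> the remaining index set is
    empty.\<close>
  have set: "{2..d} = insert d (insert (d - 1) {2..d - 2})" using d by auto
  have "(\<Oplus>\<^bsub>P\<^esub>i\<in>{2..d}. sq i) = sq d \<oplus>\<^bsub>P\<^esub> (sq (d - 1) \<oplus>\<^bsub>P\<^esub> q)"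
    unfolding set q_def using sq d by (subst P.finsum_insert; auto)+
  then have F': "F = sq d \<oplus>\<^bsub>P\<^esub> (sq (d - 1) \<oplus>\<^bsub>P\<^esub> g)"
    using bP sq q by (simp add: F g_def sq_def[symmetric] P.a_ac)
  have var_max: "ps_var K d i \<in> max_ps" if "i \<le> d" for i
    unfolding max_ps_def using ord_ge_var[OF that, of "\<lambda>_. 1"] by simp
  have "q \<in> max_ps"
  proof -
    have "(\<lambda>_. 0) \<in> monomials d" by simp
    then have "q (\<lambda>_. 0) = (\<Oplus>i\<in>{2..d - 2}. sq i (\<lambda>_. 0))" unfolding q_def by (intro coeff_finsum) (use sq in auto)
    also have "\<dots> = \<zero>"
    proof (rule finsum_all_zero)
      fix i assume "i \<in> {2..d - 2}"
      then have "i \<le> d" by auto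
      then have "sq i \<in> max_ps" using var_max[of i] by (simp add: sq_def numeral_2_eq_2 m.I_l_closed)
      then show "sq i (\<lambda>_. 0) = \<zero>" by (simp add: max_ps_iff)
    qed
    finally show ?thesis using q by (simp add: max_ps_iff)
  qed
  then have g_max: "g \<in> max_ps" unfolding g_def using b by (intro m.a_closed) auto
  have g_free: "g \<in> deg_le i 0" if "d - 1 \<le> i" for i
    unfolding g_def q_def sq_def using b(2)[of i] that d
    by (intro deg_le_add deg_le_finsum deg_le_pow deg_le_var) auto
  interpret S: double_suspension K d g
    by unfold_locales (use d g_max g_free in auto)
  have FS: "F = S.f" by (simp add: F' S.f_def sq_def)
  have FP: "F \<in> carrier P" using FS by simp
  have D: "ring_derivation P (ps_deriv j)" if "j \<le> d" for j by (rule ps_deriv_derivation[OF that])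
  have dF: "ps_deriv j F = ps_deriv j b \<oplus>\<^bsub>P\<^esub> (\<Oplus>\<^bsub>P\<^esub>i\<in>{2..d}. ps_deriv j (sq i))" if j: "j \<le> d" for j
    unfolding F sq_def[symmetric] using bP sq
    by (simp add: ring_derivation.D_add[OF D[OF j]] ring_derivation.D_finsum[OF D[OF j]] Pi_def)
  have dsq: "ps_deriv j (sq i) = (if i = j then [(2::nat)] \<cdot>\<^bsub>P\<^esub> ps_var K d i else \<zero>\<^bsub>P\<^esub>)"
    if "j \<le> d" "i \<le> d" for i j
    using deriv_pow[OF that(1) ps_var_closed, of i 1] that
    by (simp add: sq_def ps_deriv_var numeral_2_eq_2)
  interpret J: ideal "jacobian F" P by (rule jacobian_ideal[OF FP])
  have dJ: "ps_deriv j F \<in> jacobian F" if "j \<le> d" for j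
    by (rule jacobianI[OF ps_deriv_K_derivation[OF that]])
  have low: "ps_deriv j b \<in> jacobian F" if "j < 2" for j
  proof -
    have jd: "j \<le> d" using that d by simp
    have "(\<Oplus>\<^bsub>P\<^esub>i\<in>{2..d}. ps_deriv j (sq i)) = \<zero>\<^bsub>P\<^esub>"
      by (rule P.finsum_all_zero) (use dsq[OF jd] that in auto)
    then show ?thesis using dJ[OF jd] dF[OF jd] bP jd by simp
  qed
  have high: "ps_var K d j \<in> jacobian F" if "2 \<le> j" "j \<le> d" for j
  proof -
    have "(\<Oplus>\<^bsub>P\<^esub>i\<in>{2..d}. ps_deriv j (sq i)) = ps_deriv j (sq j)"
      by (rule P.finsum_eq_single) (use dsq[OF that(2)] that in auto)
    also have "\<dots> = [(2::nat)] \<cdot>\<^bsub>P\<^esub> ps_var K d j" using dsq[OF that(2) that(2)] by simp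
    finally have "ps_deriv j F = [(2::nat)] \<cdot>\<^bsub>P\<^esub> ps_var K d j"
      using dF[OF that(2)] deg_le_0_deriv[OF b(2)[OF that(1)] that(2)] by simp
    then have "[(2::nat)] \<cdot>\<^bsub>P\<^esub> ps_var K d j \<in> jacobian F" using dJ[OF that(2)] by simp
    then show ?thesis by (rule ideal_nat_div[OF J.ideal_axioms _ _, rotated 2]) auto
  qed
  have "ps_var K d i [^]\<^bsub>P\<^esub> k \<in> jacobian F" if i: "i \<le> d" for i
  proof -
    consider "i = 0" | "i = 1" | "2 \<le> i" by linarith
    then show ?thesis
    proof cases
      case 3
      then have "ps_var K d i [^]\<^bsub>P\<^esub> (1::nat) \<in> jacobian F" using high[OF 3 i] by simp
      then show ?thesis using ideal_pow_mono[OF J.ideal_axioms ps_var_closed, of i 1 k] k by simp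
    qed (use jac[OF J.ideal_axioms low low] in auto)
  qed
  then have "ord_ge (\<lambda>_. 1) (Suc d * k) \<subseteq> jacobian F"
    by (rule ord_ge_subset_ideal[OF J.ideal_axioms])
  then show ?thesis using S.double_suspension_axioms FS by blast
qed

text \<open>Powers found in the ideal of the partials of the curve: \<open>x\<close>,
  \<open>y^n\<close> for A; \<open>x^3\<close>, \<open>y^(n-1)\<close> for D; \<open>x^2\<close>,
  \<open>y^3\<close> for E6; \<open>x^3\<close>, \<open>y^5\<close> for E7; \<open>x^2\<close>,
  \<open>y^4\<close> for E8. The exponent \<open>k\<close> in each case is large enough for both
  variables.\<close>

lemma simple_equation_suspension:
  assumes d: "3 \<le> d" and F: "F \<in> simple_equations K d"
  shows "\<exists>g N. double_suspension K d g \<and> F = double_suspension.f K d g \<and>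
    ord_ge (\<lambda>_. 1) N \<subseteq> jacobian F"
proof -
  define x y where "x = ps_var K d 0" and "y = ps_var K d 1"
  have xy [simp]: "x \<in> carrier P" "y \<in> carrier P" by (auto simp: x_def y_def)
  interpret m: ideal max_ps P by (rule max_ps_ideal)
  have xm: "x \<in> max_ps" "y \<in> max_ps"
    unfolding x_def y_def max_ps_def using ord_ge_var[of _ "\<lambda>_. 1"] d by auto
  have pm: "z [^]\<^bsub>P\<^esub> n \<in> max_ps" if "z \<in> max_ps" "n > 0" for z and n :: nat
    using that max_ps_carrier[OF that(1)] m.I_l_closed[OF that(1), of "z [^]\<^bsub>P\<^esub> (n - 1)"]
    by (cases n) auto
  have free: "x \<in> deg_le i 0" "y \<in> deg_le i 0" if "2 \<le> i" for i
    using that by (auto simp: x_def y_def intro!: deg_le_var)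
  have mult0: "a \<otimes>\<^bsub>P\<^esub> c \<in> deg_le i 0" if "a \<in> deg_le i 0" "c \<in> deg_le i 0" for a c i
    using deg_le_mult[OF that] by simp
  have dv: "ps_deriv 0 x = \<one>\<^bsub>P\<^esub>" "ps_deriv 0 y = \<zero>\<^bsub>P\<^esub>" "ps_deriv 1 x = \<zero>\<^bsub>P\<^esub>" "ps_deriv 1 y = \<one>\<^bsub>P\<^esub>"
    unfolding x_def y_def using d by (auto simp: ps_deriv_var)
  have d01: "0 \<le> d" "1 \<le> d" using d by auto
  note D = ring_derivation.D_add[OF ps_deriv_derivation] ps_deriv_mult
  have dp: "ps_deriv i (z [^]\<^bsub>P\<^esub> n) = [n] \<cdot>\<^bsub>P\<^esub> (z [^]\<^bsub>P\<^esub> (n - 1) \<otimes>\<^bsub>P\<^esub> ps_deriv i z)"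
    if "i \<le> d" "z \<in> carrier P" "n > 0" for i z and n :: nat
    using deriv_pow[OF that(1,2), of "n - 1"] that(3) by simp
  define q where "q = (\<Oplus>\<^bsub>P\<^esub>i\<in>{2..d}. ps_var K d i [^]\<^bsub>P\<^esub> (2::nat))"
  note curve = suspension_of_curve[OF d, where F = F, folded q_def x_def y_def]
  have add_cancel: "a \<in> I" if "ideal I P" "a \<oplus>\<^bsub>P\<^esub> c \<in> I" "c \<in> I" "a \<in> carrier P" for a c I
  proof -
    interpret I: ideal I P by fact
    have "c \<in> carrier P" by (rule I.Icarr[OF that(3)])
    then have "a = (a \<oplus>\<^bsub>P\<^esub> c) \<oplus>\<^bsub>P\<^esub> \<ominus>\<^bsub>P\<^esub> c" using that(4) by (simp add: P.a_assoc P.r_neg)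
    then show ?thesis using I.a_closed[OF that(2) I.a_inv_closed[OF that(3)]] by simp
  qed
  note ds = D dp dv
  note nodel = One_nat_def P.nat_pow_Suc P.add.nat_pow_Suc
  consider (A) n :: nat where "n \<ge> 1" "F = x [^]\<^bsub>P\<^esub> (2::nat) \<oplus>\<^bsub>P\<^esub> y [^]\<^bsub>P\<^esub> (n + 1) \<oplus>\<^bsub>P\<^esub> q"
    | (D) n :: nat where "n \<ge> 4" "F = x [^]\<^bsub>P\<^esub> (2::nat) \<otimes>\<^bsub>P\<^esub> y \<oplus>\<^bsub>P\<^esub> y [^]\<^bsub>P\<^esub> (n - 1) \<oplus>\<^bsub>P\<^esub> q"
    | (E6) "F = x [^]\<^bsub>P\<^esub> (3::nat) \<oplus>\<^bsub>P\<^esub> y [^]\<^bsub>P\<^esub> (4::nat) \<oplus>\<^bsub>P\<^esub> q"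
    | (E7) "F = x [^]\<^bsub>P\<^esub> (3::nat) \<oplus>\<^bsub>P\<^esub> x \<otimes>\<^bsub>P\<^esub> y [^]\<^bsub>P\<^esub> (3::nat) \<oplus>\<^bsub>P\<^esub> q"
    | (E8) "F = x [^]\<^bsub>P\<^esub> (3::nat) \<oplus>\<^bsub>P\<^esub> y [^]\<^bsub>P\<^esub> (5::nat) \<oplus>\<^bsub>P\<^esub> q"
    using F unfolding simple_equations_def Let_def x_def y_def q_def by blast
  then show ?thesis
  proof cases
    case (A n)
    let ?b = "x [^]\<^bsub>P\<^esub> (2::nat) \<oplus>\<^bsub>P\<^esub> y [^]\<^bsub>P\<^esub> (n + 1)"
    have d0: "ps_deriv 0 ?b = [(2::nat)] \<cdot>\<^bsub>P\<^esub> x" using d01 by (simp add: ds P.nat_pow_eone del: nodel)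
    have d1: "ps_deriv 1 ?b = [(n + 1)] \<cdot>\<^bsub>P\<^esub> (y [^]\<^bsub>P\<^esub> n)" using d01 by (simp add: ds del: nodel)
    show ?thesis
    proof (rule curve[OF _ _ _ _ A(2), where k = n])
      fix I assume I: "ideal I P" "ps_deriv 0 ?b \<in> I" "ps_deriv 1 ?b \<in> I"
      have "x \<in> I" by (rule ideal_nat_div[OF I(1), of x 2]) (use I(2)[unfolded d0] in \<open>auto simp del: nodel\<close>)
      moreover have "y [^]\<^bsub>P\<^esub> n \<in> I"
        by (rule ideal_nat_div[OF I(1), of _ "n + 1"]) (use I(3)[unfolded d1] in \<open>auto simp del: nodel\<close>)
      ultimately show "x [^]\<^bsub>P\<^esub> n \<in> I \<and> y [^]\<^bsub>P\<^esub> n \<in> I"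
        using ideal_pow_mono[OF I(1), of x 1 n] A(1) by simp
    qed (use A(1) pm xm free in \<open>auto intro!: m.a_closed deg_le_add deg_le_pow simp del: nodel\<close>)
  next
    case (D n)
    \<comment> \<open>The shift by three turns the exponents \<open>n - 1\<close> and
      \<open>n - 2\<close> into \<open>l + 2\<close> and \<open>l + 1\<close>, free of truncated
      subtraction.\<close>
    define l where "l = n - 3"
    have n: "n - 1 = l + 2" "n - 1 - 1 = l + 1" using D(1) by (auto simp: l_def)
    let ?b = "x [^]\<^bsub>P\<^esub> (2::nat) \<otimes>\<^bsub>P\<^esub> y \<oplus>\<^bsub>P\<^esub> y [^]\<^bsub>P\<^esub> (l + 2)"
    have d0: "ps_deriv 0 ?b = [(2::nat)] \<cdot>\<^bsub>P\<^esub> (x \<otimes>\<^bsub>P\<^esub> y)"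
    proof -
      define Y where "Y = y [^]\<^bsub>P\<^esub> (l + 2)"
      have "ps_deriv 0 Y = \<zero>\<^bsub>P\<^esub>" unfolding Y_def using d01
        by (subst dp) (simp_all add: dv del: nodel)
      moreover have "Y \<in> carrier P" by (simp add: Y_def)
      ultimately show ?thesis unfolding Y_def[symmetric]
        using d01 by (simp add: ds P.nat_pow_eone P.add_pow_rdistr P.m_comm[of y x] del: nodel)
    qed
    have d1: "ps_deriv 1 ?b = x [^]\<^bsub>P\<^esub> (2::nat) \<oplus>\<^bsub>P\<^esub> [(l + 2)] \<cdot>\<^bsub>P\<^esub> (y [^]\<^bsub>P\<^esub> (l + 1))"
    proof -
      define Y where "Y = y [^]\<^bsub>P\<^esub> (l + 2)"
      have "ps_deriv 1 Y = [(l + 2)] \<cdot>\<^bsub>P\<^esub> (y [^]\<^bsub>P\<^esub> (l + 1))" unfolding Y_def using d01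
        by (subst dp) (simp_all add: dv[unfolded One_nat_def] del: P.add.nat_pow_Suc)
      moreover have "Y \<in> carrier P" by (simp add: Y_def)
      ultimately show ?thesis unfolding Y_def[symmetric] using d01 by (simp add: ds del: nodel)
    qed
    show ?thesis
    proof (rule curve[OF _ _ _ _ D(2)[unfolded n], where k = "l + 3"])
      fix I assume I: "ideal I P" "ps_deriv 0 ?b \<in> I" "ps_deriv 1 ?b \<in> I"
      interpret I: ideal I P by (rule I(1))
      have xy_I: "x \<otimes>\<^bsub>P\<^esub> y \<in> I"
        by (rule ideal_nat_div[OF I(1), of _ 2]) (use I(2)[unfolded d0] in \<open>auto simp del: nodel\<close>)
      \<comment> \<open>Modulo \<open>x y\<close>, which is in the ideal by the other partial,
        multiplying this partial by \<open>x\<close> isolates \<open>x^3\<close>, and multiplying it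
        by \<open>y\<close> isolates \<open>y^(l+2)\<close>.\<close>
      have "x \<otimes>\<^bsub>P\<^esub> ps_deriv 1 ?b = x [^]\<^bsub>P\<^esub> (3::nat) \<oplus>\<^bsub>P\<^esub> ([(l + 2)] \<cdot>\<^bsub>P\<^esub> (y [^]\<^bsub>P\<^esub> l)) \<otimes>\<^bsub>P\<^esub> (x \<otimes>\<^bsub>P\<^esub> y)"
        unfolding d1 by (simp add: P.r_distr P.add_pow_rdistr P.add_pow_ldistr P.m_ac numeral_3_eq_3 numeral_2_eq_2 del: P.add.nat_pow_Suc)
      moreover have "x \<otimes>\<^bsub>P\<^esub> ps_deriv 1 ?b \<in> I" by (rule I.I_l_closed[OF I(3)]) simp
      ultimately have x3: "x [^]\<^bsub>P\<^esub> (3::nat) \<in> I"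
        by (simp only:) (erule add_cancel[OF I(1) _ I.I_l_closed[OF xy_I, of "[(l + 2)] \<cdot>\<^bsub>P\<^esub> (y [^]\<^bsub>P\<^esub> l)"]]; simp del: nodel)
      have "y \<otimes>\<^bsub>P\<^esub> ps_deriv 1 ?b = [(l + 2)] \<cdot>\<^bsub>P\<^esub> (y [^]\<^bsub>P\<^esub> (l + 2)) \<oplus>\<^bsub>P\<^esub> x \<otimes>\<^bsub>P\<^esub> (x \<otimes>\<^bsub>P\<^esub> y)"
        unfolding d1 by (simp add: P.r_distr P.add_pow_rdistr P.m_ac P.a_ac numeral_2_eq_2 del: P.add.nat_pow_Suc)
      moreover have "y \<otimes>\<^bsub>P\<^esub> ps_deriv 1 ?b \<in> I" by (rule I.I_l_closed[OF I(3)]) simp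
      ultimately have "[(l + 2)] \<cdot>\<^bsub>P\<^esub> (y [^]\<^bsub>P\<^esub> (l + 2)) \<in> I"
        by (simp only:) (erule add_cancel[OF I(1) _ I.I_l_closed[OF xy_I, of x]]; simp del: nodel)
      then have "y [^]\<^bsub>P\<^esub> (l + 2) \<in> I"
        by (rule ideal_nat_div[OF I(1), of _ "l + 2", rotated 2]) (auto simp del: nodel)
      then show "x [^]\<^bsub>P\<^esub> (l + 3) \<in> I \<and> y [^]\<^bsub>P\<^esub> (l + 3) \<in> I"
        using ideal_pow_mono[OF I(1) xy(1) x3, of "l + 3"] ideal_pow_mono[OF I(1) xy(2), of "l + 2" "l + 3"]
        by (simp del: nodel)
    qed (use pm xm free mult0 in \<open>auto intro!: m.a_closed m.I_l_closed deg_le_add deg_le_pow mult0 simp del: nodel\<close>)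
  next
    case E6
    let ?b = "x [^]\<^bsub>P\<^esub> (3::nat) \<oplus>\<^bsub>P\<^esub> y [^]\<^bsub>P\<^esub> (4::nat)"
    have d0: "ps_deriv 0 ?b = [(3::nat)] \<cdot>\<^bsub>P\<^esub> (x [^]\<^bsub>P\<^esub> (2::nat))" using d01 by (simp add: ds del: nodel)
    have d1: "ps_deriv 1 ?b = [(4::nat)] \<cdot>\<^bsub>P\<^esub> (y [^]\<^bsub>P\<^esub> (3::nat))" using d01 by (simp add: ds del: nodel)
    show ?thesis
    proof (rule curve[OF _ _ _ _ E6, where k = 3])
      fix I assume I: "ideal I P" "ps_deriv 0 ?b \<in> I" "ps_deriv 1 ?b \<in> I"
      have "x [^]\<^bsub>P\<^esub> (2::nat) \<in> I"
        by (rule ideal_nat_div[OF I(1), of _ 3]) (use I(2)[unfolded d0] in \<open>auto simp del: nodel\<close>)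
      moreover have "y [^]\<^bsub>P\<^esub> (3::nat) \<in> I"
        by (rule ideal_nat_div[OF I(1), of _ 4]) (use I(3)[unfolded d1] in \<open>auto simp del: nodel\<close>)
      ultimately show "x [^]\<^bsub>P\<^esub> (3::nat) \<in> I \<and> y [^]\<^bsub>P\<^esub> (3::nat) \<in> I"
        using ideal_pow_mono[OF I(1) xy(1), of 2 3] by (simp del: nodel)
    qed (use pm xm free in \<open>auto intro!: m.a_closed deg_le_add deg_le_pow simp del: nodel\<close>)
  next
    case E7
    let ?b = "x [^]\<^bsub>P\<^esub> (3::nat) \<oplus>\<^bsub>P\<^esub> x \<otimes>\<^bsub>P\<^esub> y [^]\<^bsub>P\<^esub> (3::nat)"
    have d0: "ps_deriv 0 ?b = [(3::nat)] \<cdot>\<^bsub>P\<^esub> (x [^]\<^bsub>P\<^esub> (2::nat)) \<oplus>\<^bsub>P\<^esub> y [^]\<^bsub>P\<^esub> (3::nat)"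
      using d01 by (simp add: ds del: nodel)
    have d1: "ps_deriv 1 ?b = [(3::nat)] \<cdot>\<^bsub>P\<^esub> (x \<otimes>\<^bsub>P\<^esub> y [^]\<^bsub>P\<^esub> (2::nat))"
      using d01 by (simp add: ds P.add_pow_rdistr del: nodel)
    show ?thesis
    proof (rule curve[OF _ _ _ _ E7, where k = 5])
      fix I assume I: "ideal I P" "ps_deriv 0 ?b \<in> I" "ps_deriv 1 ?b \<in> I"
      interpret I: ideal I P by (rule I(1))
      have xyy: "x \<otimes>\<^bsub>P\<^esub> y [^]\<^bsub>P\<^esub> (2::nat) \<in> I"
        by (rule ideal_nat_div[OF I(1), of _ 3]) (use I(3)[unfolded d1] in \<open>auto simp del: nodel\<close>)
      \<comment> \<open>Modulo \<open>x y^2\<close>, multiplying the partial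
        \<open>3 x^2 + y^3\<close> by \<open>x\<close> isolates \<open>x^3\<close>, and multiplying
        it by \<open>y^2\<close> isolates \<open>y^5\<close>.\<close>
      have "x \<otimes>\<^bsub>P\<^esub> ps_deriv 0 ?b = [(3::nat)] \<cdot>\<^bsub>P\<^esub> (x [^]\<^bsub>P\<^esub> (3::nat)) \<oplus>\<^bsub>P\<^esub> y \<otimes>\<^bsub>P\<^esub> (x \<otimes>\<^bsub>P\<^esub> y [^]\<^bsub>P\<^esub> (2::nat))"
        unfolding d0 by (simp add: P.r_distr P.add_pow_rdistr P.m_ac numeral_3_eq_3 numeral_2_eq_2 del: P.add.nat_pow_Suc)
      moreover have "x \<otimes>\<^bsub>P\<^esub> ps_deriv 0 ?b \<in> I" by (rule I.I_l_closed[OF I(2)]) simp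
      ultimately have "[(3::nat)] \<cdot>\<^bsub>P\<^esub> (x [^]\<^bsub>P\<^esub> (3::nat)) \<in> I"
        by (simp only:) (erule add_cancel[OF I(1) _ I.I_l_closed[OF xyy, of y]]; simp del: nodel)
      then have x3: "x [^]\<^bsub>P\<^esub> (3::nat) \<in> I"
        by (rule ideal_nat_div[OF I(1), of _ 3, rotated 2]) (auto simp del: nodel)
      have "y [^]\<^bsub>P\<^esub> (2::nat) \<otimes>\<^bsub>P\<^esub> ps_deriv 0 ?b = y [^]\<^bsub>P\<^esub> (5::nat) \<oplus>\<^bsub>P\<^esub>
          ([(3::nat)] \<cdot>\<^bsub>P\<^esub> x) \<otimes>\<^bsub>P\<^esub> (x \<otimes>\<^bsub>P\<^esub> y [^]\<^bsub>P\<^esub> (2::nat))"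
        unfolding d0 by (simp add: P.r_distr P.add_pow_rdistr P.add_pow_ldistr P.m_ac P.a_ac numeral_eq_Suc del: P.add.nat_pow_Suc)
      moreover have "y [^]\<^bsub>P\<^esub> (2::nat) \<otimes>\<^bsub>P\<^esub> ps_deriv 0 ?b \<in> I" by (rule I.I_l_closed[OF I(2)]) simp
      ultimately have y5: "y [^]\<^bsub>P\<^esub> (5::nat) \<in> I"
        by (simp only:) (erule add_cancel[OF I(1) _ I.I_l_closed[OF xyy, of "[(3::nat)] \<cdot>\<^bsub>P\<^esub> x"]]; simp del: nodel)
      show "x [^]\<^bsub>P\<^esub> (5::nat) \<in> I \<and> y [^]\<^bsub>P\<^esub> (5::nat) \<in> I"
        using ideal_pow_mono[OF I(1) xy(1) x3, of 5] y5 by (simp del: nodel)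
    qed (use pm xm free in \<open>auto intro!: m.a_closed m.I_l_closed deg_le_add deg_le_pow mult0 simp del: nodel\<close>)
  next
    case E8
    let ?b = "x [^]\<^bsub>P\<^esub> (3::nat) \<oplus>\<^bsub>P\<^esub> y [^]\<^bsub>P\<^esub> (5::nat)"
    have d0: "ps_deriv 0 ?b = [(3::nat)] \<cdot>\<^bsub>P\<^esub> (x [^]\<^bsub>P\<^esub> (2::nat))" using d01 by (simp add: ds del: nodel)
    have d1: "ps_deriv 1 ?b = [(5::nat)] \<cdot>\<^bsub>P\<^esub> (y [^]\<^bsub>P\<^esub> (4::nat))" using d01 by (simp add: ds del: nodel)
    show ?thesis
    proof (rule curve[OF _ _ _ _ E8, where k = 4])
      fix I assume I: "ideal I P" "ps_deriv 0 ?b \<in> I" "ps_deriv 1 ?b \<in> I"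
      have "x [^]\<^bsub>P\<^esub> (2::nat) \<in> I"
        by (rule ideal_nat_div[OF I(1), of _ 3]) (use I(2)[unfolded d0] in \<open>auto simp del: nodel\<close>)
      moreover have "y [^]\<^bsub>P\<^esub> (4::nat) \<in> I"
        by (rule ideal_nat_div[OF I(1), of _ 5]) (use I(3)[unfolded d1] in \<open>auto simp del: nodel\<close>)
      ultimately show "x [^]\<^bsub>P\<^esub> (4::nat) \<in> I \<and> y [^]\<^bsub>P\<^esub> (4::nat) \<in> I"
        using ideal_pow_mono[OF I(1) xy(1), of 2 4] by (simp del: nodel)
    qed (use pm xm free in \<open>auto intro!: m.a_closed deg_le_add deg_le_pow simp del: nodel\<close>)
  qed
qed

end

section \<open>Descent to the quotient algebra\<close>

text \<open>The map is the projection to the quotient followed by the inverse of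
  \<open>\<phi>\<close>. It replaces cosets by a surjection with known kernel, which is all that is
  used of the presentation afterwards.\<close>

lemma (in power_series_ring) quotient_algebra_hom:
  assumes alg: "algebra K A" and F: "F \<in> carrier P"
    and phi: "\<phi> \<in> algebra_iso K A (quotient_algebra P (PIdl\<^bsub>P\<^esub> F))"
  shows "\<exists>\<psi>. surjective_hom P A \<psi> \<and> (\<forall>p\<in>carrier P. \<psi> p = \<zero>\<^bsub>A\<^esub> \<longleftrightarrow> p \<in> PIdl\<^bsub>P\<^esub> F) \<and>
    (\<forall>c\<in>carrier K. \<forall>p\<in>carrier P. \<psi> (c \<odot>\<^bsub>P\<^esub> p) = c \<odot>\<^bsub>A\<^esub> \<psi> p)"
proof -
  interpret RA: cring A by (rule algebra.M_cring[OF alg])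
  interpret A: algebra K A by fact
  define I where "I = PIdl\<^bsub>P\<^esub> F"
  define Q where "Q = quotient_algebra P I"
  interpret I: ideal I P unfolding I_def by (rule P.cgenideal_ideal[OF F])
  interpret PQ: ring "P Quot I" by (rule I.quotient_is_ring)
  define \<pi> where "\<pi> p = I +>\<^bsub>P\<^esub> p" for p
  have Qs: "carrier Q = carrier (P Quot I)" "monoid.mult Q = monoid.mult (P Quot I)" "add Q = add (P Quot I)"
    "one Q = one (P Quot I)" "ring.zero Q = ring.zero (P Quot I)"
    "\<And>c Y. c \<odot>\<^bsub>Q\<^esub> Y = (\<Union>x\<in>Y. I +>\<^bsub>P\<^esub> (c \<odot>\<^bsub>P\<^esub> x))"
    unfolding Q_def quotient_algebra_def by (simp_all add: ring.defs)
  have pi_hom: "\<pi> \<in> ring_hom P (P Quot I)"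
    unfolding \<pi>_def[abs_def] by (rule I.rcos_ring_hom)
  note pih = ring_hom_closed[OF pi_hom] ring_hom_mult[OF pi_hom] ring_hom_add[OF pi_hom] ring_hom_one[OF pi_hom]
  have pi_surj: "\<exists>p\<in>carrier P. Y = \<pi> p" if "Y \<in> carrier (P Quot I)" for Y
    using that unfolding FactRing_def A_RCOSETS_def' \<pi>_def by auto
  have phi_hom: "\<phi> \<in> ring_hom A Q" and bij: "bij_betw \<phi> (carrier A) (carrier Q)"
    and phi_K: "\<And>c a. \<lbrakk>c \<in> carrier K; a \<in> carrier A\<rbrakk> \<Longrightarrow> \<phi> (c \<odot>\<^bsub>A\<^esub> a) = c \<odot>\<^bsub>Q\<^esub> \<phi> a"
    using phi unfolding algebra_iso_def ring_iso_def Q_def I_def by auto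
  note ph = ring_hom_closed[OF phi_hom] ring_hom_mult[OF phi_hom] ring_hom_add[OF phi_hom] ring_hom_one[OF phi_hom]
  define \<psi> where "\<psi> p = inv_into (carrier A) \<phi> (\<pi> p)" for p
  have inj: "inj_on \<phi> (carrier A)" and img: "\<phi> ` carrier A = carrier Q"
    using bij by (auto simp: bij_betw_def)
  have psi: "\<psi> p \<in> carrier A" "\<phi> (\<psi> p) = \<pi> p" if "p \<in> carrier P" for p
  proof -
    have "\<pi> p \<in> \<phi> ` carrier A" unfolding img Qs by (rule pih(1)[OF that])
    then show "\<psi> p \<in> carrier A" "\<phi> (\<psi> p) = \<pi> p"
      unfolding \<psi>_def by (rule inv_into_into, rule f_inv_into_f)
  qed
  have psiI: "\<psi> p = a" if "p \<in> carrier P" "a \<in> carrier A" "\<phi> a = \<pi> p" for p a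
    by (rule inj_onD[OF inj]) (use psi[OF that(1)] that in auto)
  have psi_hom: "\<psi> \<in> ring_hom P A"
  proof (rule ring_hom_memI)
    fix p q assume p: "p \<in> carrier P" and q: "q \<in> carrier P"
    show "\<psi> (p \<otimes>\<^bsub>P\<^esub> q) = \<psi> p \<otimes>\<^bsub>A\<^esub> \<psi> q"
      by (rule psiI) (use p q psi in \<open>simp_all add: ph pih Qs\<close>)
    show "\<psi> (p \<oplus>\<^bsub>P\<^esub> q) = \<psi> p \<oplus>\<^bsub>A\<^esub> \<psi> q"
      by (rule psiI) (use p q psi in \<open>simp_all add: ph pih Qs\<close>)
  next
    show "\<psi> \<one>\<^bsub>P\<^esub> = \<one>\<^bsub>A\<^esub>" by (rule psiI) (simp_all add: ph pih Qs)
  qed (rule psi)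
  have surj: "\<psi> ` carrier P = carrier A"
  proof (intro equalityI subsetI)
    fix a assume a: "a \<in> carrier A"
    then have "\<phi> a \<in> carrier (P Quot I)" using ph(1) Qs by simp
    then obtain p where "p \<in> carrier P" "\<phi> a = \<pi> p" using pi_surj by blast
    then show "a \<in> \<psi> ` carrier P" using psiI[of p a] a by (intro image_eqI[of _ _ p]) auto
  qed (use psi in auto)
  have S: "surjective_hom P A \<psi>"
    by (intro surjective_hom.intro ring_hom_cring.intro surjective_hom_axioms.intro ring_hom_cring_axioms.intro
        psi_hom surj P.is_cring RA.is_cring)
  have phi0: "\<phi> \<zero>\<^bsub>A\<^esub> = \<zero>\<^bsub>P Quot I\<^esub>"
  proof -
    have "\<phi> \<zero>\<^bsub>A\<^esub> \<oplus>\<^bsub>P Quot I\<^esub> \<phi> \<zero>\<^bsub>A\<^esub> = \<phi> \<zero>\<^bsub>A\<^esub>" using ph(3)[of "\<zero>\<^bsub>A\<^esub>" "\<zero>\<^bsub>A\<^esub>"] by (simp add: Qs)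
    moreover have "\<phi> \<zero>\<^bsub>A\<^esub> \<in> carrier (P Quot I)" using ph(1)[of "\<zero>\<^bsub>A\<^esub>"] by (simp add: Qs)
    ultimately show ?thesis using PQ.add.l_cancel_one'[of "\<phi> \<zero>\<^bsub>A\<^esub>" "\<phi> \<zero>\<^bsub>A\<^esub>"] by simp
  qed
  have zeroQ: "\<zero>\<^bsub>P Quot I\<^esub> = I" unfolding FactRing_def by simp
  have ker: "\<psi> p = \<zero>\<^bsub>A\<^esub> \<longleftrightarrow> p \<in> I" if p: "p \<in> carrier P" for p
  proof
    assume "\<psi> p = \<zero>\<^bsub>A\<^esub>"
    then have "\<pi> p = I" using psi(2)[OF p] phi0 zeroQ by simp
    then show "p \<in> I" unfolding \<pi>_def by (rule I.rcos_const_imp_mem[OF p])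
  next
    assume "p \<in> I"
    then have "\<pi> p = I" unfolding \<pi>_def by (intro P.a_rcos_zero I.is_ideal)
    then show "\<psi> p = \<zero>\<^bsub>A\<^esub>" using p phi0 zeroQ by (intro psiI) auto
  qed
  have "\<psi> (c \<odot>\<^bsub>P\<^esub> p) = c \<odot>\<^bsub>A\<^esub> \<psi> p" if c: "c \<in> carrier K" and p: "p \<in> carrier P" for c p
  proof (rule psiI)
    have cp: "c \<odot>\<^bsub>P\<^esub> x \<in> carrier P" if "x \<in> carrier P" for x using c that by (rule ps_smult_closed)
    \<comment> \<open>Scalar multiplication on cosets is a union over all representatives; the
      united cosets coincide because the ideal absorbs constants.\<close>
    have "I +>\<^bsub>P\<^esub> (c \<odot>\<^bsub>P\<^esub> x) = I +>\<^bsub>P\<^esub> (c \<odot>\<^bsub>P\<^esub> p)" if x: "x \<in> \<pi> p" for x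
    proof -
      obtain i where i: "i \<in> I" "x = i \<oplus>\<^bsub>P\<^esub> p" using x unfolding \<pi>_def a_r_coset_def' by auto
      have iP: "i \<in> carrier P" by (rule I.Icarr[OF i(1)])
      have "c \<odot>\<^bsub>P\<^esub> x = ps_const c \<otimes>\<^bsub>P\<^esub> i \<oplus>\<^bsub>P\<^esub> c \<odot>\<^bsub>P\<^esub> p"
        using c p iP i(2) by (simp add: ps_smult_const P.r_distr)
      moreover have "ps_const c \<otimes>\<^bsub>P\<^esub> i \<in> I" using c by (intro I.I_l_closed i) auto
      ultimately have mem: "c \<odot>\<^bsub>P\<^esub> x \<in> I +>\<^bsub>P\<^esub> (c \<odot>\<^bsub>P\<^esub> p)" unfolding a_r_coset_def' by auto
      show ?thesis by (rule P.a_repr_independence[OF mem cp[OF p] I.a_subgroup, symmetric])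
    qed
    moreover have "p \<in> \<pi> p" unfolding \<pi>_def by (rule I.a_rcos_self[OF p])
    ultimately have "(\<Union>x\<in>\<pi> p. I +>\<^bsub>P\<^esub> (c \<odot>\<^bsub>P\<^esub> x)) = I +>\<^bsub>P\<^esub> (c \<odot>\<^bsub>P\<^esub> p)" by blast
    then show "\<phi> (c \<odot>\<^bsub>A\<^esub> \<psi> p) = \<pi> (c \<odot>\<^bsub>P\<^esub> p)"
      using c p psi phi_K by (simp add: Qs \<pi>_def)
  qed (use that psi ps_smult_closed in auto)
  then show ?thesis using S ker unfolding I_def by blast
qed

locale double_suspension_quotient = double_suspension K d g + S: surjective_hom "power_series K d" A \<psi>
  for K :: "('k, 'q) ring_scheme" (structure) and d g and A :: "('k, 'a) module" and \<psi> +
  assumes algebra: "algebra K A"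
    and kernel: "p \<in> carrier P \<Longrightarrow> \<psi> p = \<zero>\<^bsub>A\<^esub> \<longleftrightarrow> p \<in> PIdl\<^bsub>P\<^esub> f"
    and psi_smult: "\<lbrakk>c \<in> carrier K; p \<in> carrier P\<rbrakk> \<Longrightarrow> \<psi> (c \<odot>\<^bsub>P\<^esub> p) = c \<odot>\<^bsub>A\<^esub> \<psi> p"
begin

lemma kernelD: "\<lbrakk>p \<in> carrier P; \<psi> p = \<zero>\<^bsub>A\<^esub>\<rbrakk> \<Longrightarrow> \<exists>q\<in>carrier P. p = q \<otimes>\<^bsub>P\<^esub> f"
  using kernel unfolding cgenideal_def by auto

lemma psi_f: "\<psi> f = \<zero>\<^bsub>A\<^esub>"
  using kernel[OF f_closed] P.cgenideal_self[OF f_closed] by simp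

definition descend where "descend D = (\<lambda>x\<in>carrier A. \<psi> (D (S.lift x)))"

text \<open>Independence of the chosen lift: two lifts differ by some \<open>q f\<close>, and
  \<open>D (q f) = f D q\<close> when \<open>D f\<close> is zero, which maps to zero.\<close>

lemma descend_apply:
  assumes D: "D \<in> K_derivations" "D f = \<zero>\<^bsub>P\<^esub>" and p: "p \<in> carrier P"
  shows "descend D (\<psi> p) = \<psi> (D p)"
proof -
  interpret D: ring_derivation P D using D by (simp add: K_derivations_def)
  define p' where "p' = S.lift (\<psi> p)"
  have p': "p' \<in> carrier P" "\<psi> p' = \<psi> p" using S.lift[of "\<psi> p"] p by (auto simp: p'_def)
  have "\<psi> (p' \<ominus>\<^bsub>P\<^esub> p) = \<zero>\<^bsub>A\<^esub>" using p p' by (simp add: P.minus_eq S.S.r_neg)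
  then obtain q where q: "q \<in> carrier P" "p' \<ominus>\<^bsub>P\<^esub> p = q \<otimes>\<^bsub>P\<^esub> f"
    using kernelD[of "p' \<ominus>\<^bsub>P\<^esub> p"] p p' by auto
  have "\<psi> (D (p' \<ominus>\<^bsub>P\<^esub> p)) = \<zero>\<^bsub>A\<^esub>"
    unfolding q(2) using q(1) D(2) psi_f by (simp add: D.D_mult)
  then have "\<psi> (D p' \<ominus>\<^bsub>P\<^esub> D p) = \<zero>\<^bsub>A\<^esub>" using p p' by (simp add: D.D_minus)
  then have "\<psi> (D p') \<ominus>\<^bsub>A\<^esub> \<psi> (D p) = \<zero>\<^bsub>A\<^esub>" using p p' by (simp add: P.minus_eq S.S.minus_eq)
  then have "\<psi> (D p') = \<psi> (D p)" using p p' by (simp add: S.S.r_right_minus_eq)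
  then show ?thesis using p by (simp add: descend_def p'_def)
qed

lemma K_derivation_smult:
  assumes "D \<in> K_derivations" "c \<in> carrier K" "p \<in> carrier P"
  shows "D (c \<odot>\<^bsub>P\<^esub> p) = c \<odot>\<^bsub>P\<^esub> D p"
proof -
  interpret D: ring_derivation P D using assms by (simp add: K_derivations_def)
  have "D (ps_const c) = \<zero>\<^bsub>P\<^esub>" using assms by (simp add: K_derivations_def)
  then show ?thesis using assms by (simp add: ps_smult_const D.D_mult)
qed

lemma descend_derivation:
  assumes D: "D \<in> K_derivations" "D f = \<zero>\<^bsub>P\<^esub>"
  shows "descend D \<in> carrier (derivations K A)"
proof -
  interpret D: ring_derivation P D using D by (simp add: K_derivations_def)
  note ap = descend_apply[OF D]
  interpret A: algebra K A by (rule algebra)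
  show ?thesis
  proof (rule derivationsI)
    show "descend D \<in> carrier A \<rightarrow>\<^sub>E carrier A"
      unfolding descend_def by (rule restrict_PiE_iff[THEN iffD2]) (simp add: S.lift)
    fix a b assume a: "a \<in> carrier A" and b: "b \<in> carrier A"
    obtain p where p: "p \<in> carrier P" "\<psi> p = a" using S.lift_ex[OF a] by blast
    obtain q where q: "q \<in> carrier P" "\<psi> q = b" using S.lift_ex[OF b] by blast
    show "descend D (a \<oplus>\<^bsub>A\<^esub> b) = descend D a \<oplus>\<^bsub>A\<^esub> descend D b"
      unfolding p(2)[symmetric] q(2)[symmetric]
      using ap[of "p \<oplus>\<^bsub>P\<^esub> q"] ap[OF p(1)] ap[OF q(1)] p(1) q(1) by (simp add: D.D_add)
    show "descend D (a \<otimes>\<^bsub>A\<^esub> b) = a \<otimes>\<^bsub>A\<^esub> descend D b \<oplus>\<^bsub>A\<^esub> b \<otimes>\<^bsub>A\<^esub> descend D a"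
      unfolding p(2)[symmetric] q(2)[symmetric]
      using ap[of "p \<otimes>\<^bsub>P\<^esub> q"] ap[OF p(1)] ap[OF q(1)] p(1) q(1) by (simp add: D.D_mult)
  next
    fix c a assume c: "c \<in> carrier K" and a: "a \<in> carrier A"
    obtain p where p: "p \<in> carrier P" "\<psi> p = a" using S.lift_ex[OF a] by blast
    have "descend D (c \<odot>\<^bsub>A\<^esub> a) = descend D (\<psi> (c \<odot>\<^bsub>P\<^esub> p))" using c p psi_smult by simp
    also have "\<dots> = c \<odot>\<^bsub>A\<^esub> descend D a"
      using ap[OF ps_smult_closed[OF c p(1)]] ap[OF p(1)] c p(1) psi_smult[OF c] K_derivation_smult[OF D(1) c p(1)]
      by (simp add: p(2)[symmetric])
    finally show "descend D (c \<odot>\<^bsub>A\<^esub> a) = c \<odot>\<^bsub>A\<^esub> descend D a" .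
  qed
qed

text \<open>Since descending derivations is compatible with linear combinations along
  \<open>\<psi>\<close>, linearity of \<open>nabla\<close> over \<open>A\<close> becomes linearity
  over \<open>P\<close> on derivations killing \<open>f\<close>.\<close>

lemma connection_tangential:
  assumes M: "module A M" and nabla: "module_connection K A M nabla"
  shows "tangential_connection P (pullback_module \<psi> M) K_derivations f (\<lambda>D. nabla (descend D))"
proof -
  interpret PM: module P "pullback_module \<psi> M" by (rule S.pullback_module[OF M])
  interpret AM: module A M by (rule M)
  have lin: "nabla \<in> linear_maps A (derivations K A) (endomorphisms K A M)"
    and leib: "\<And>D a m. \<lbrakk>D \<in> carrier (derivations K A); a \<in> carrier A; m \<in> carrier M\<rbrakk> \<Longrightarrow>
      nabla D (a \<odot>\<^bsub>M\<^esub> m) = a \<odot>\<^bsub>M\<^esub> nabla D m \<oplus>\<^bsub>M\<^esub> D a \<odot>\<^bsub>M\<^esub> m"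
    using nabla unfolding module_connection_def by auto
  have nE: "nabla D \<in> carrier (endomorphisms K A M)" if "D \<in> carrier (derivations K A)" for D
    using lin that unfolding linear_maps_def by auto
  have n_closed: "nabla D m \<in> carrier M"
    and n_add: "m' \<in> carrier M \<Longrightarrow> nabla D (m \<oplus>\<^bsub>M\<^esub> m') = nabla D m \<oplus>\<^bsub>M\<^esub> nabla D m'"
    if "D \<in> carrier (derivations K A)" "m \<in> carrier M" for D m m'
    using nE[OF that(1)] that(2) unfolding endomorphisms_def linear_maps_def restrict_scalars_def by auto
  have n_plus: "nabla (D \<oplus>\<^bsub>derivations K A\<^esub> E) m = nabla D m \<oplus>\<^bsub>M\<^esub> nabla E m"
    if "D \<in> carrier (derivations K A)" "E \<in> carrier (derivations K A)" "m \<in> carrier M" for D E m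
    using lin that unfolding linear_maps_def by (auto simp: endomorphisms_def)
  have n_smult: "nabla (a \<odot>\<^bsub>derivations K A\<^esub> D) m = a \<odot>\<^bsub>M\<^esub> nabla D m"
    if "D \<in> carrier (derivations K A)" "a \<in> carrier A" "m \<in> carrier M" for D a m
    using lin that unfolding linear_maps_def by (auto simp: endomorphisms_def)
  have ap: "descend D x = \<psi> (D (S.lift x))" if "x \<in> carrier A" for D x
    using that by (simp add: descend_def)
  have cl: "D p \<in> carrier P" if "D \<in> K_derivations" "p \<in> carrier P" for D p
    by (rule K_derivations_closed[OF that])
  show ?thesis
  proof (intro tangential_connection.intro tangential_connection_axioms.intro PM.module_axioms)
    fix D assume "D \<in> K_derivations"
    then show "ring_derivation P D" by (simp add: K_derivations_def)
  next
    fix D x assume D: "D \<in> K_derivations" "D f = \<zero>\<^bsub>P\<^esub>" and x: "x \<in> carrier (pullback_module \<psi> M)"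
    note dD = descend_derivation[OF D]
    have x': "x \<in> carrier M" using x by simp
    show "nabla (descend D) x \<in> carrier (pullback_module \<psi> M)" using n_closed[OF dD x'] by simp
    show "nabla (descend D) (x \<oplus>\<^bsub>pullback_module \<psi> M\<^esub> y) =
      nabla (descend D) x \<oplus>\<^bsub>pullback_module \<psi> M\<^esub> nabla (descend D) y"
      if "y \<in> carrier (pullback_module \<psi> M)" for y using n_add[OF dD x'] that by simp
    show "nabla (descend D) (a \<odot>\<^bsub>pullback_module \<psi> M\<^esub> x) =
      D a \<odot>\<^bsub>pullback_module \<psi> M\<^esub> x \<oplus>\<^bsub>pullback_module \<psi> M\<^esub> a \<odot>\<^bsub>pullback_module \<psi> M\<^esub> nabla (descend D) x"
      if a: "a \<in> carrier P" for a
      using leib[OF dD S.hom_closed[OF a] x'] descend_apply[OF D a] n_closed[OF dD x'] x' a cl[OF D(1) a]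
      by (simp add: AM.M.a_comm)
  next
    fix D E a b x assume D: "D \<in> K_derivations" "D f = \<zero>\<^bsub>P\<^esub>" and E: "E \<in> K_derivations" "E f = \<zero>\<^bsub>P\<^esub>"
      and a: "a \<in> carrier P" and b: "b \<in> carrier P" and x: "x \<in> carrier (pullback_module \<psi> M)"
    have x': "x \<in> carrier M" using x by simp
    \<comment> \<open>Closure under scaling in the quotient is obtained by descending a scaled
      derivation; the zero summand fits it to \<open>K_derivations_comb\<close>.\<close>
    have scaled: "\<psi> c \<odot>\<^bsub>derivations K A\<^esub> descend G \<in> carrier (derivations K A)"
      if c: "c \<in> carrier P" and G: "G \<in> K_derivations" "G f = \<zero>\<^bsub>P\<^esub>" for c G
    proof -
      let ?G = "\<lambda>x. c \<otimes>\<^bsub>P\<^esub> G x \<oplus>\<^bsub>P\<^esub> \<zero>\<^bsub>P\<^esub> \<otimes>\<^bsub>P\<^esub> G x"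
      have "?G \<in> K_derivations" "?G f = \<zero>\<^bsub>P\<^esub>" using K_derivations_comb[OF G(1) G(1) c P.zero_closed] c G by auto
      then have "descend ?G \<in> carrier (derivations K A)" by (rule descend_derivation)
      moreover have "descend ?G = \<psi> c \<odot>\<^bsub>derivations K A\<^esub> descend G"
        using c G cl[OF G(1)] S.lift by (auto simp: derivations_simps descend_def fun_eq_iff restrict_def)
      ultimately show ?thesis by simp
    qed
    have "descend (\<lambda>x. a \<otimes>\<^bsub>P\<^esub> D x \<oplus>\<^bsub>P\<^esub> b \<otimes>\<^bsub>P\<^esub> E x) =
      (\<psi> a \<odot>\<^bsub>derivations K A\<^esub> descend D) \<oplus>\<^bsub>derivations K A\<^esub> (\<psi> b \<odot>\<^bsub>derivations K A\<^esub> descend E)"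
      using a b cl[OF D(1)] cl[OF E(1)] S.lift
      by (auto simp: derivations_simps descend_def fun_eq_iff restrict_def)
    then show "nabla (descend (\<lambda>x. a \<otimes>\<^bsub>P\<^esub> D x \<oplus>\<^bsub>P\<^esub> b \<otimes>\<^bsub>P\<^esub> E x)) x =
      a \<odot>\<^bsub>pullback_module \<psi> M\<^esub> nabla (descend D) x \<oplus>\<^bsub>pullback_module \<psi> M\<^esub>
      b \<odot>\<^bsub>pullback_module \<psi> M\<^esub> nabla (descend E) x"
      using n_plus[OF scaled[OF a D] scaled[OF b E] x'] n_smult[OF descend_derivation[OF D] S.hom_closed[OF a] x']
        n_smult[OF descend_derivation[OF E] S.hom_closed[OF b] x'] by simp
  next
    fix D E x assume "D \<in> K_derivations" "E \<in> K_derivations" and eq: "\<And>a. a \<in> carrier P \<Longrightarrow> D a = E a"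
    have "descend D = descend E"
      unfolding descend_def by (rule restrict_ext) (simp add: eq S.lift)
    then show "nabla (descend D) x = nabla (descend E) x" by simp
  qed (auto intro: K_derivations_comb)
qed

section \<open>Local structure, dimension and depth of the quotient\<close>

definition max_A where "max_A = \<psi> ` max_ps"

lemma kernel_max: "\<lbrakk>p \<in> carrier P; \<psi> p = \<zero>\<^bsub>A\<^esub>\<rbrakk> \<Longrightarrow> p \<in> max_ps"
proof -
  interpret m: ideal max_ps P by (rule max_ps_ideal)
  assume "p \<in> carrier P" "\<psi> p = \<zero>\<^bsub>A\<^esub>"
  then show ?thesis using kernelD m.I_l_closed[OF f_max] by blast
qed

lemma max_A_ideal: "ideal max_A A"
  unfolding max_A_def by (rule S.image_ideal[OF max_ps_ideal])

lemma max_A_proper: "max_A \<noteq> carrier A"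
  using primeideal.I_notcarr[OF S.image_prime[OF max_ps_prime kernel_max]] unfolding max_A_def by auto

lemma max_A_units: "\<lbrakk>a \<in> carrier A; a \<notin> max_A\<rbrakk> \<Longrightarrow> a \<in> Units A"
proof -
  assume a: "a \<in> carrier A" "a \<notin> max_A"
  obtain p where p: "p \<in> carrier P" "\<psi> p = a" using S.lift_ex[OF a(1)] by blast
  then have "p \<notin> max_ps" using a(2) by (auto simp: max_A_def)
  then obtain s where s: "s \<in> carrier P" "p \<otimes>\<^bsub>P\<^esub> s = \<one>\<^bsub>P\<^esub>" using unit_outside_max_ps p by blast
  have "a \<otimes>\<^bsub>A\<^esub> \<psi> s = \<one>\<^bsub>A\<^esub>" using p s S.hom_mult[of p s] S.hom_one by simp
  moreover have "\<psi> s \<in> carrier A" using s by simp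
  ultimately show ?thesis using a(1) S.S.m_comm[of a "\<psi> s"] unfolding Units_def by auto
qed

text \<open>\<open>max_ideal\<close> is a definite description, so uniqueness is part of the claim:
  a proper ideal contains no units and hence lies in \<open>max_A\<close>.\<close>

lemma max_ideal_A: "max_ideal A = max_A"
  unfolding max_ideal_def
proof (rule the_equality)
  interpret m: ideal max_A A by (rule max_A_ideal)
  have sub: "J \<subseteq> max_A" if J: "ideal J A" "J \<noteq> carrier A" for J
  proof (rule ccontr)
    interpret J: ideal J A by fact
    assume "\<not> ?thesis"
    then obtain a where a: "a \<in> J" "a \<notin> max_A" by blast
    then have "a \<in> Units A" using max_A_units J.Icarr by blast
    then have "inv\<^bsub>A\<^esub> a \<otimes>\<^bsub>A\<^esub> a \<in> J" using a(1) by (intro J.I_l_closed) auto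
    then show False using \<open>a \<in> Units A\<close> J.one_imp_carrier J(2) by simp
  qed
  show "maximalideal max_A A"
  proof (rule maximalidealI[OF max_A_ideal])
    show "carrier A \<noteq> max_A" using max_A_proper by auto
    show "J = max_A \<or> J = carrier A" if "ideal J A" "max_A \<subseteq> J" "J \<subseteq> carrier A" for J
      using sub[OF that(1)] that by blast
  qed
  fix J assume "maximalideal J A"
  then interpret J: maximalideal J A .
  have "J \<subseteq> max_A" using sub[OF J.is_ideal] J.I_notcarr by auto
  moreover have "max_A \<subseteq> carrier A" by (rule subsetI) (rule m.Icarr)
  ultimately show "J = max_A" using J.I_maximal[OF max_A_ideal] max_A_proper by auto
qed

text \<open>All four primes of the chain contain \<open>f\<close>, hence the kernel, so their images
  are again prime and strictly increasing.\<close>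

lemma krull_dim_A:
  assumes e: "e \<in> carrier K" "e \<otimes> e = \<ominus> \<one>"
  shows "3 \<le> krull_dim A"
proof -
  obtain Q where Q: "\<forall>i\<le>3. primeideal (Q i) P \<and> f \<in> Q i" "\<forall>i<3. Q i \<subset> Q (Suc i)"
    using prime_chain[OF e] by blast
  have ker: "p \<in> Q i" if "i \<le> 3" "p \<in> carrier P" "\<psi> p = \<zero>\<^bsub>A\<^esub>" for i p
  proof -
    interpret Q: primeideal "Q i" P using Q that by blast
    show ?thesis using kernelD[OF that(2,3)] Q.I_l_closed Q(1) that(1) by blast
  qed
  have prime: "primeideal (\<psi> ` Q i) A" if "i \<le> 3" for i
    by (rule S.image_prime) (use Q that ker[OF that] in auto)
  have "\<psi> ` Q i \<subset> \<psi> ` Q (Suc i)" if i: "i < 3" for i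
  proof -
    interpret Qi: primeideal "Q i" P using Q i by auto
    interpret Qs: primeideal "Q (Suc i)" P using Q i by auto
    obtain x where x: "x \<in> Q (Suc i)" "x \<notin> Q i" using Q(2) i by blast
    have "\<psi> x \<in> \<psi> ` Q i \<longleftrightarrow> x \<in> Q i"
      by (rule S.image_ideal_mem[OF Qi.is_ideal ker Qs.Icarr[OF x(1)]]) (use i in simp_all)
    moreover have "\<psi> x \<in> \<psi> ` Q (Suc i)" using x(1) by (rule imageI)
    moreover have "Q i \<subseteq> Q (Suc i)" using Q(2) i by auto
    then have "\<psi> ` Q i \<subseteq> \<psi> ` Q (Suc i)" by (rule image_mono)
    ultimately show ?thesis using x(2) by blast
  qed
  then have "(\<forall>i\<le>3. primeideal (\<psi> ` Q i) A) \<and> (\<forall>i<3. \<psi> ` Q i \<subset> \<psi> ` Q (Suc i))"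
    using prime by simp
  then have "\<exists>p. (\<forall>i\<le>3. primeideal (p i) A) \<and> (\<forall>i<3. p i \<subset> p (Suc (i::nat)))"
    by (rule exI[of _ "\<lambda>i. \<psi> ` Q i"])
  then have "enat 3 \<in> {enat n | n. \<exists>p. (\<forall>i\<le>n. primeideal (p i) A) \<and> (\<forall>i<n. p i \<subset> p (Suc i))}"
    by (intro CollectI exI[of _ 3] conjI refl)
  then have "enat 3 \<le> krull_dim A" unfolding krull_dim_def by (rule Sup_upper)
  then show ?thesis by (simp add: numeral_eq_enat)
qed

lemma connection_imp_free:
  fixes M :: "('a, 'm) module"
  assumes e: "e \<in> carrier K" "e \<otimes> e = \<ominus> \<one>" and jac: "ord_ge (\<lambda>_. 1) N \<subseteq> jacobian f"
    and mcm: "maximal_cohen_macaulay A M" and nabla: "module_connection K A M nabla"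
  shows "free_module A M"
proof -
  have M: "module A M" and fg: "finitely_generated A M" and dep: "depth A M = krull_dim A"
    using mcm unfolding maximal_cohen_macaulay_def by auto
  interpret AM: module A M by (rule M)
  show ?thesis
  proof (cases "set_smult A M (max_ideal A) = carrier M")
    \<comment> \<open>Here the depth is infinite by convention and yields no regular sequence;
      Nakayama gives the result directly.\<close>
    case True
    then show ?thesis
      by (intro AM.max_smult_eq_imp_trivial[OF fg max_A_ideal max_A_proper max_A_units])
        (auto simp: max_ideal_A)
  next
    case False
    have "3 \<le> Sup {enat (length xs) | xs. set xs \<subseteq> max_A \<and> regular_sequence A M xs}"
      using krull_dim_A[OF e] dep False unfolding depth_def max_ideal_A by simp
    \<comment> \<open>The depth is a supremum, so a sequence of length at least three is extracted
      by contradiction: otherwise the supremum would be at most 2.\<close>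
    moreover have "Sup {enat (length xs) | xs. set xs \<subseteq> max_A \<and> regular_sequence A M xs} \<le> 2"
      if "\<And>xs. \<lbrakk>set xs \<subseteq> max_A; regular_sequence A M xs\<rbrakk> \<Longrightarrow> length xs < 3"
      by (rule Sup_least) (use that in \<open>force simp: numeral_eq_enat\<close>)
    moreover have "\<not> (3::enat) \<le> 2" by (simp add: numeral_eq_enat)
    ultimately obtain xs where xs: "set xs \<subseteq> max_A" "regular_sequence A M xs" "3 \<le> length xs"
      by (meson not_le order_trans)
    have "xs ! i \<in> max_A" if "i < 3" for i using xs that nth_mem[of i xs] by auto
    then have ex: "\<exists>p\<in>max_ps. \<psi> p = xs ! i" if "i < 3" for i using that unfolding max_A_def by fastforce
    obtain a b c where abc: "a \<in> max_ps" "b \<in> max_ps" "c \<in> max_ps"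
      "\<psi> a = xs ! 0" "\<psi> b = xs ! 1" "\<psi> c = xs ! 2"
      using ex[of 0] ex[of 1] ex[of 2] by auto
    have reg: "module.regular3 P (pullback_module \<psi> M) a b c"
      by (rule S.pullback_regular3[OF M])
        (use abc max_ps_carrier AM.regular_sequence_regular3[OF xs(2,3)] in auto)
    have fM: "f \<odot>\<^bsub>pullback_module \<psi> M\<^esub> x = \<zero>\<^bsub>pullback_module \<psi> M\<^esub>" if "x \<in> carrier (pullback_module \<psi> M)" for x
      using that psi_f by simp
    have jac': "\<exists>D\<in>K_derivations. D f = y" if "y \<in> ord_ge (\<lambda>_. 1) N" for y
      using jac that unfolding jacobian_def by auto
    obtain B where B: "finite B" "B \<subseteq> carrier M" "module_span A M B = carrier M"
      and rel: "\<forall>r\<in>module.relations P (pullback_module \<psi> M) B. \<forall>s\<in>B. \<exists>q\<in>carrier P. r s = q \<otimes>\<^bsub>P\<^esub> f"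
      using relations_trivial[where N = N, OF connection_tangential[OF M nabla] _ fM e jac' reg abc(1-3)] fg
      by (auto simp: S.pullback_finitely_generated[OF M] S.pullback_span[OF M])
    show ?thesis
    proof (rule AM.trivial_relations_imp_free[OF B])
      fix r s assume r: "r \<in> AM.relations B" and s: "s \<in> B"
      \<comment> \<open>A relation over \<open>A\<close> lifts coefficientwise to one over
        \<open>P\<close>; its coefficients are multiples of \<open>f\<close> there and so vanish in
        \<open>A\<close>.\<close>
      define r' where "r' t = S.lift (r t)" for t
      have rc: "r t \<in> carrier A" if "t \<in> B" for t using r that by (auto simp: AM.relations_def)
      have r': "r' t \<in> carrier P" "\<psi> (r' t) = r t" if "t \<in> B" for t
        using S.lift[OF rc[OF that]] by (auto simp: r'_def)
      have "(\<Oplus>\<^bsub>M\<^esub>t\<in>B. \<psi> (r' t) \<odot>\<^bsub>M\<^esub> t) = (\<Oplus>\<^bsub>M\<^esub>t\<in>B. r t \<odot>\<^bsub>M\<^esub> t)"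
        by (rule AM.M.finsum_cong') (use r' rc B(2) in auto)
      then have "r' \<in> module.relations P (pullback_module \<psi> M) B"
        using r r' unfolding AM.relations_def module.relations_def[OF S.pullback_module[OF M]] by auto
      then obtain q where q: "q \<in> carrier P" "r' s = q \<otimes>\<^bsub>P\<^esub> f" using rel s by blast
      have "r s = \<psi> (q \<otimes>\<^bsub>P\<^esub> f)" using r'(2)[OF s] q(2) by simp
      then show "r s = \<zero>\<^bsub>A\<^esub>" using q(1) psi_f by simp
    qed
  qed
qed

end

text \<open>A root of \<open>X^2 + 1\<close>, whose coefficient list starts with the leading term.
  This square root splits \<open>w^2 + t^2\<close> into two isotropic factors.\<close>

lemma algebraically_closed_sqrt_minus_one:
  assumes "algebraically_closed K"
  shows "\<exists>e\<in>carrier K. e \<otimes>\<^bsub>K\<^esub> e = \<ominus>\<^bsub>K\<^esub> \<one>\<^bsub>K\<^esub>"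
proof -
  interpret algebraically_closed K by fact
  define p where "p = [\<one>\<^bsub>K\<^esub>, \<zero>\<^bsub>K\<^esub>, \<one>\<^bsub>K\<^esub>]"
  have p: "p \<in> carrier (poly_ring K)"
    unfolding p_def univ_poly_carrier[symmetric] polynomial_def by auto
  have "size (roots p) = 2" using roots_over_carrier[OF p] unfolding splitted_def by (simp add: p_def)
  then obtain e where "e \<in># roots p" by (metis multiset_nonemptyE size_empty zero_neq_numeral)
  then have e: "e \<in> carrier K" "eval p e = \<zero>\<^bsub>K\<^esub>"
    using roots_mem_iff_is_root[OF p] unfolding is_root_def by auto
  then have "e \<otimes>\<^bsub>K\<^esub> e \<oplus>\<^bsub>K\<^esub> \<one>\<^bsub>K\<^esub> = \<zero>\<^bsub>K\<^esub>" by (simp add: p_def numeral_2_eq_2)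
  then show ?thesis using e(1) by (intro bexI[of _ e]) (auto simp: sum_zero_eq_neg)
qed

theorem theorem1:
  fixes K :: "'k ring" and A :: "('k, 'a) module" and M :: "('a, 'm) module" and d :: nat
  assumes "algebraically_closed K"
    and "\<forall>n::nat. n > 0 \<longrightarrow> [n] \<cdot>\<^bsub>K\<^esub> \<one>\<^bsub>K\<^esub> \<noteq> \<zero>\<^bsub>K\<^esub>"
    and "d \<ge> 3"
    and "simple_singularity K d A"
    and "maximal_cohen_macaulay A M"
  shows "(\<exists>nabla. module_connection K A M nabla) \<longleftrightarrow> free_module A M"
proof
  have K: "field K" using assms(1) by (rule algebraically_closed.axioms(1))
  interpret K: field K by (rule K)
  interpret power_series_field K d
    by (intro power_series_field.intro power_series_ring.intro power_series_field_axioms.intro)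
      (use assms(2) K K.is_cring in auto)
  obtain e where e: "e \<in> carrier K" "e \<otimes>\<^bsub>K\<^esub> e = \<ominus>\<^bsub>K\<^esub> \<one>\<^bsub>K\<^esub>"
    using algebraically_closed_sqrt_minus_one[OF assms(1)] by blast
  have alg: "algebra K A" using assms(4) by (simp add: simple_singularity_def)
  obtain F \<phi> where F: "F \<in> simple_equations K d"
    and phi: "\<phi> \<in> algebra_iso K A (quotient_algebra (power_series K d) (PIdl\<^bsub>power_series K d\<^esub> F))"
    using assms(4) unfolding simple_singularity_def by blast
  obtain g N where g: "double_suspension K d g" and Fg: "F = double_suspension.f K d g"
    and jac: "ord_ge (\<lambda>_. 1) N \<subseteq> jacobian F"
    using simple_equation_suspension[OF assms(3) F] by blast
  interpret double_suspension K d g by (rule g)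
  obtain \<psi> where psi: "surjective_hom P A \<psi>" "\<forall>p\<in>carrier P. \<psi> p = \<zero>\<^bsub>A\<^esub> \<longleftrightarrow> p \<in> PIdl\<^bsub>P\<^esub> F"
    "\<forall>c\<in>carrier K. \<forall>p\<in>carrier P. \<psi> (c \<odot>\<^bsub>P\<^esub> p) = c \<odot>\<^bsub>A\<^esub> \<psi> p"
    using quotient_algebra_hom[OF alg _ phi] Fg by auto
  interpret Q: double_suspension_quotient K d g A \<psi>
    by (intro double_suspension_quotient.intro double_suspension_quotient_axioms.intro g psi(1) alg)
      (use psi Fg in auto)
  { assume "\<exists>nabla. module_connection K A M nabla"
    then show "free_module A M" using Q.connection_imp_free[OF e jac[unfolded Fg] assms(5)] by blast }
  assume "free_module A M"
  then show "\<exists>nabla. module_connection K A M nabla"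
    using free_imp_connection[OF alg] assms(5) unfolding maximal_cohen_macaulay_def by blast
qed

end
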